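(* Assuming Gap-ETH, for any constant $\rho\in(0,1)$ there exist constants $\delta>0$ and $d_0\in\mathbb{N}$ such that the following holds: for any constant $d\ge d_0$, there is no $\rho$-approximation algorithm for $d$-dimensional knapsack that runs in time $O(n^{\delta\sqrt{d}})$, where $n$ is the encoding size of the input instance.
   Context: $d$-dimensional knapsack: an instance $\mathcal{I}=(I,p,c,B)$ consists of a finite set of items $I$, a profit function $p: I\to\mathbb{N}$, a cost function $c: I\to \mathbb{N}^d$, and a budget $B\in\mathbb{N}^d$ (here $0\in\mathbb{N}$). A solution is a subset $S\subseteq I$ with $c_j(S):=\sum_{i\in S}c_j(i)\le B_j$ for all $j\in[d]=\{1,\dots,d\}$; its profit is $p(S)=\sum_{i\in S}p(i)$, to be maximized. $\mathrm{OPT}(\mathcal{I})$ is the maximum profit of a solution. For $\alpha\in(0,1)$, an $\alpha$-approximation algorithm returns, on every instance, a solution of profit at least $\alpha\cdot \mathrm{OPT}(\mathcal{I})$. 3-SAT$(D)$: an instance is $\phi=(V,C)$, where $V$ is a set of variables and $C$ a set of clauses, each a disjunction of three literals (variables of $V$ or their negations), such that each variable appears in at most $D$ clauses. $\mathrm{SAT}(\phi)$ is the maximum number of clauses satisfied by a single assignment $V\to\{0,1\}$. Gap-ETH is the hypothesis: there exist constants $D\in\mathbb{N}$ and $\delta',\varepsilon'\in(0,1)$ such that no algorithm, given a 3-SAT$(D)$ instance $\phi$ with $n$ variables and $m$ clauses, distinguishes between $\mathrm{SAT}(\phi)=m$ and $\mathrm{SAT}(\phi)<(1-\varepsilon')m$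 in time $O(2^{\delta' n})$. *)

theory Defs
  imports Complex_Main "HOL-Library.Landau_Symbols" "HOL-Library.Log_Nat"
begin

section \<open>Model of computation\<close>

text \<open>
  Algorithms are programs for a random access machine with logarithmic cost (Cook and Reckhow,
  Time bounded random access machines, 1973), with structured control flow instead of jumps. The
  machine has registers, addressed by constants in the program, and a memory, addressed through
  registers. Both hold arbitrary natural numbers. \<open>Skip\<close> and \<open>Const\<close>, whose operands are part of the
  program, take unit time; every other instruction or test is charged the number of
  binary digits of the numbers it handles, addresses included. This model and multitape Turing
  machines simulate each other with polynomial overhead. Subtraction is truncated.
\<close>

type_synonym state = "(nat \<Rightarrow> nat) \<times> (nat \<Rightarrow> nat)"

abbreviation reg :: "state \<Rightarrow> nat \<Rightarrow> nat" where "reg \<equiv> fst"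

abbreviation mem :: "state \<Rightarrow> nat \<Rightarrow> nat" where "mem \<equiv> snd"

datatype com =
    Skip
  | Const nat nat
  | Add nat nat nat
  | Sub nat nat nat
  | Load nat nat
  | Store nat nat
  | Seq com com
  | If nat com com
  | While nat com

text \<open>The number of binary digits, where \<open>0\<close> has one digit.\<close>

definition digits :: "nat \<Rightarrow> nat" where
  "digits x = max 1 (floorlog 2 x)"

text \<open>\<open>exec c s t s'\<close>: started in state \<open>s\<close>, program \<open>c\<close> halts in state \<open>s'\<close> after time \<open>t\<close>.\<close>

inductive exec :: "com \<Rightarrow> state \<Rightarrow> nat \<Rightarrow> state \<Rightarrow> bool" where
  Skip: "exec Skip s 1 s"
| Const: "exec (Const i k) (r, m) 1 (r(i := k), m)"
| Add: "exec (Add i j k) (r, m) (digits (r j) + digits (r k)) (r(i := r j + r k), m)"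
| Sub: "exec (Sub i j k) (r, m) (digits (r j) + digits (r k)) (r(i := r j - r k), m)"
| Load: "exec (Load i j) (r, m) (digits (r j) + digits (m (r j))) (r(i := m (r j)), m)"
| Store: "exec (Store i j) (r, m) (digits (r i) + digits (r j)) (r, m(r i := r j))"
| Seq: "exec c1 s t1 s1 \<Longrightarrow> exec c2 s1 t2 s2 \<Longrightarrow> exec (Seq c1 c2) s (t1 + t2) s2"
| IfTrue: "reg s i \<noteq> 0 \<Longrightarrow> exec c1 s t s1 \<Longrightarrow> exec (If i c1 c2) s (digits (reg s i) + t) s1"
| IfFalse: "reg s i = 0 \<Longrightarrow> exec c2 s t s1 \<Longrightarrow> exec (If i c1 c2) s (digits (reg s i) + t) s1"
| WhileTrue: "reg s i \<noteq> 0 \<Longrightarrow> exec c s t1 s1 \<Longrightarrow> exec (While i c) s1 t2 s2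
    \<Longrightarrow> exec (While i c) s (digits (reg s i) + t1 + t2) s2"
| WhileFalse: "reg s i = 0 \<Longrightarrow> exec (While i c) s (digits (reg s i)) s"

lemma exec_deterministic:
  assumes "exec c s t s'" "exec c s u s''"
  shows "u = t \<and> s'' = s'"
  using assms
proof (induction arbitrary: u s'' rule: exec.induct)
  case (Skip s)
  from Skip.prems show ?case by cases auto
next
  case (Const i k r m)
  from Const.prems show ?case by cases auto
next
  case (Add i j k r m)
  from Add.prems show ?case by cases auto
next
  case (Sub i j k r m)
  from Sub.prems show ?case by cases auto
next
  case (Load i j r m)
  from Load.prems show ?case by cases auto
next
  case (Store i j r m)
  from Store.prems show ?case by cases auto
next
  case (Seq c1 s t1 s1 c2 t2 s2)
  from Seq.prems show ?case by cases (use Seq.IH in blast)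
next
  case (IfTrue s i c1 t s1 c2)
  from IfTrue.prems show ?case by cases (use IfTrue.hyps IfTrue.IH in blast)+
next
  case (IfFalse s i c2 t s1 c1)
  from IfFalse.prems show ?case by cases (use IfFalse.hyps IfFalse.IH in blast)+
next
  case (WhileTrue s i c t1 s1 t2 s2)
  from WhileTrue.prems show ?case by cases (use WhileTrue.hyps WhileTrue.IH in blast)+
next
  case (WhileFalse s i c)
  from WhileFalse.prems show ?case by cases (use WhileFalse.hyps in blast)+
qed

definition initial :: "nat list \<Rightarrow> state" where
  "initial xs = ((\<lambda>_. 0), (\<lambda>k. if k < length xs then xs ! k else 0))"

text \<open>The size of an input is the length of the word over \<open>0\<close>, \<open>1\<close>, \<open>#\<close> in which every number is
  written in binary and followed by the separator \<open>#\<close>.\<close>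

definition encoding_size :: "nat list \<Rightarrow> nat" where
  "encoding_size xs = (\<Sum>x\<leftarrow>xs. digits x + 1)"


section \<open>Multidimensional knapsack\<close>

text \<open>Coordinates of cost and budget vectors are indexed by \<open>{1..d}\<close>. Profits and costs of
  non-items and coordinates outside \<open>{1..d}\<close> are ignored throughout.\<close>

record 'i knapsack =
  items :: "'i set"
  profit :: "'i \<Rightarrow> nat"
  cost :: "'i \<Rightarrow> nat \<Rightarrow> nat"
  budget :: "nat \<Rightarrow> nat"

definition knapsack_solution :: "nat \<Rightarrow> 'i knapsack \<Rightarrow> 'i set \<Rightarrow> bool" where
  "knapsack_solution d \<I> S \<longleftrightarrow>
    S \<subseteq> items \<I> \<and> (\<forall>j\<in>{1..d}. (\<Sum>i\<in>S. cost \<I> i j) \<le> budget \<I> j)"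

definition total_profit :: "'i knapsack \<Rightarrow> 'i set \<Rightarrow> nat" where
  "total_profit \<I> S = (\<Sum>i\<in>S. profit \<I> i)"

definition knapsack_OPT :: "nat \<Rightarrow> 'i knapsack \<Rightarrow> nat" where
  "knapsack_OPT d \<I> = Max {total_profit \<I> S |S. knapsack_solution d \<I> S}"

text \<open>Instances given to a machine have their items numbered consecutively from \<open>0\<close>.\<close>

definition numbered_knapsack :: "nat knapsack \<Rightarrow> bool" where
  "numbered_knapsack \<I> \<longleftrightarrow> (\<exists>N. items \<I> = {..<N})"

definition encode_knapsack :: "nat \<Rightarrow> nat knapsack \<Rightarrow> nat list" where
  "encode_knapsack d \<I> = card (items \<I>) # d # map (budget \<I>) [1..<d + 1] @
     concat (map (\<lambda>i. profit \<I> i # map (cost \<I> i) [1..<d + 1]) [0..<card (items \<I>)])"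

text \<open>A machine returns a set of items by its characteristic vector, starting at memory cell \<open>0\<close>.\<close>

definition output_items :: "nat knapsack \<Rightarrow> state \<Rightarrow> nat set" where
  "output_items \<I> s = {i \<in> items \<I>. mem s i \<noteq> 0}"

definition knapsack_approximation :: "real \<Rightarrow> nat \<Rightarrow> com \<Rightarrow> bool" where
  "knapsack_approximation \<alpha> d A \<longleftrightarrow>
    (\<forall>\<I>. numbered_knapsack \<I> \<longrightarrow>
      (\<exists>t s. exec A (initial (encode_knapsack d \<I>)) t s \<and>
        knapsack_solution d \<I> (output_items \<I> s) \<and>
        real (total_profit \<I> (output_items \<I> s)) \<ge> \<alpha> * real (knapsack_OPT d \<I>)))"

text \<open>\<open>T\<close> bounds the running time in terms of the encoding size of the instance.\<close>

definition knapsack_time :: "nat \<Rightarrow> com \<Rightarrow> (nat \<Rightarrow> real) \<Rightarrow> bool" where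
  "knapsack_time d A T \<longleftrightarrow>
    (\<forall>\<I>. numbered_knapsack \<I> \<longrightarrow>
      (\<exists>t s. exec A (initial (encode_knapsack d \<I>)) t s \<and>
        real t \<le> T (encoding_size (encode_knapsack d \<I>))))"


section \<open>Bounded-occurrence 3-SAT and Gap-ETH\<close>

datatype 'v literal = Pos (var: 'v) | Neg (var: 'v)

text \<open>A clause is identified with the set of its literals.\<close>

record 'v cnf =
  vars :: "'v set"
  clauses :: "'v literal set set"

definition sat3_instance :: "nat \<Rightarrow> 'v cnf \<Rightarrow> bool" where
  "sat3_instance D \<phi> \<longleftrightarrow>
    finite (vars \<phi>) \<and>
    (\<forall>c\<in>clauses \<phi>. card c = 3 \<and> var ` c \<subseteq> vars \<phi>) \<and>
    (\<forall>v\<in>vars \<phi>. card {c \<in> clauses \<phi>. v \<in> var ` c} \<le> D)"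

fun lit_true :: "('v \<Rightarrow> bool) \<Rightarrow> 'v literal \<Rightarrow> bool" where
  "lit_true \<sigma> (Pos v) = \<sigma> v"
| "lit_true \<sigma> (Neg v) = (\<not> \<sigma> v)"

definition SAT :: "'v cnf \<Rightarrow> nat" where
  "SAT \<phi> = Max {card {c \<in> clauses \<phi>. \<exists>l\<in>c. lit_true \<sigma> l} |\<sigma>. True}"

fun lit_code :: "nat literal \<Rightarrow> nat" where
  "lit_code (Pos v) = 2 * v"
| "lit_code (Neg v) = 2 * v + 1"

text \<open>The variables are numbered consecutively from \<open>0\<close>; the clauses, and the literals of each
  clause, may be listed in any order, each of them once.\<close>

definition encodes_cnf :: "nat list \<Rightarrow> nat cnf \<Rightarrow> bool" where
  "encodes_cnf xs \<phi> \<longleftrightarrow>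
    (\<exists>n cs. vars \<phi> = {..<n} \<and> clauses \<phi> = set ` set cs \<and>
      distinct (map set cs) \<and> (\<forall>c\<in>set cs. distinct c) \<and>
      xs = n # length cs # concat (map (map lit_code) cs))"

text \<open>A machine accepts by halting with a nonzero number in register \<open>0\<close>.\<close>

definition accepts :: "state \<Rightarrow> bool" where
  "accepts s \<longleftrightarrow> reg s 0 \<noteq> 0"

definition distinguishes_gap :: "nat \<Rightarrow> real \<Rightarrow> com \<Rightarrow> bool" where
  "distinguishes_gap D \<epsilon> A \<longleftrightarrow>
    (\<forall>\<phi> xs. sat3_instance D \<phi> \<and> encodes_cnf xs \<phi> \<longrightarrow>
      (\<exists>t s. exec A (initial xs) t s \<and>
        (SAT \<phi> = card (clauses \<phi>) \<longrightarrow> accepts s) \<and>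
        (real (SAT \<phi>) < (1 - \<epsilon>) * real (card (clauses \<phi>)) \<longrightarrow> \<not> accepts s)))"

text \<open>\<open>T\<close> bounds the running time in terms of the number of variables.\<close>

definition sat3_time :: "nat \<Rightarrow> com \<Rightarrow> (nat \<Rightarrow> real) \<Rightarrow> bool" where
  "sat3_time D A T \<longleftrightarrow>
    (\<forall>\<phi> xs. sat3_instance D \<phi> \<and> encodes_cnf xs \<phi> \<longrightarrow>
      (\<exists>t s. exec A (initial xs) t s \<and> real t \<le> T (card (vars \<phi>))))"

definition Gap_ETH :: bool where
  "Gap_ETH \<longleftrightarrow>
    (\<exists>(D::nat) (\<delta>::real) (\<epsilon>::real). 0 < \<delta> \<and> \<delta> < 1 \<and> 0 < \<epsilon> \<and> \<epsilon> < 1 \<and>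
      \<not> (\<exists>A T. distinguishes_gap D \<epsilon> A \<and> sat3_time D A T \<and>
            T \<in> O(\<lambda>n. 2 powr (\<delta> * real n))))"

end

theory Submission
  imports Defs "HOL-Library.Nat_Bijection"
begin

text \<open>
  Let \<open>k\<close> be the largest power of two with \<open>k\<^sup>2 \<le> d\<close>, and choose a constant \<open>q\<close> with \<open>2 * (1 - \<rho>) ^ q \<le> \<epsilon>\<close>. Place every
  clause into the parts that occur among \<open>q\<close> base-\<open>k\<close> digits of its index. Each of the \<open>k\<close> parts has about \<open>q m / k\<close>
  clauses, but any \<open>\<rho> k\<close> parts together miss at most a fraction \<open>\<epsilon>\<close> of all clauses. The items of the knapsack
  instance are the partial assignments to the variables of a part, all of profit \<open>1\<close>; \<open>k\<^sup>2\<close> dimensions ensure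
  that a solution contains at most one item per part, that it satisfies the clauses of its part, and that the
  chosen items agree on common variables. A satisfiable formula yields a solution of profit \<open>k\<close>, and a
  solution of profit \<open>\<rho> k\<close> yields an assignment that violates at most a fraction \<open>\<epsilon>\<close> of the clauses. The instance
  has size \<open>2 ^ O(n / k)\<close>, so a running time of \<open>size powr (\<delta> * sqrt d)\<close> with \<open>sqrt d \<le> 2 * k\<close> becomes \<open>2 ^ O(\<delta> n)\<close>.
\<close>

section \<open>Polynomial bounds\<close>

text \<open>The order of the choices is the crux. The reduction itself costs a fixed power
  \<open>K\<close> of the instance width, which is about 2^(3 q D n / k) for a formula with at most
  \<open>D * n\<close> clauses. So the overhead is about 2^(3 K q D n / k), and it is harmless only
  when \<open>k\<close> is large compared with \<open>K q D\<close>. Hence \<open>K\<close> must be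
  known before \<open>d\<close>: every computability statement below fixes its polynomial before
  registers, parameters and the approximation algorithm enter, and only a constant factor may depend
  on those. Since the reduction has to be an explicit program, clauses are not distributed at
  random. The \<open>q\<close> digits of an index imitate \<open>q\<close> independent choices of a
  part, and a set of \<open>\<rho> * k\<close> parts misses a fraction of about (1 - \<rho>)^q of
  the clauses. Taking \<open>k\<close> to be a power of two makes the powers of \<open>k\<close>
  powers of two, which repeated doubling computes.\<close>

definition polyb :: "(nat \<Rightarrow> nat) \<Rightarrow> bool" where
  "polyb p \<longleftrightarrow> (\<exists>K. \<forall>W\<ge>2. p W \<le> W ^ K)"

text \<open>Starting at \<open>W = 2\<close>, a constant is dominated by a power, so
  \<open>polyb\<close> can do without leading coefficients.\<close>

lemma const_le_power: "2 \<le> W \<Longrightarrow> c \<le> W ^ c" for W c :: nat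
  by (meson less_exp order_trans less_imp_le power_mono zero_le)

lemma polyb_const: "polyb (\<lambda>_. c)"
  unfolding polyb_def using const_le_power by blast

lemma polyb_id: "polyb (\<lambda>W. W)"
  unfolding polyb_def by (rule exI[of _ 1]) simp

lemma polyb_mult:
  assumes "polyb p" "polyb r" shows "polyb (\<lambda>W. p W * r W)"
proof -
  obtain K L where "\<forall>W\<ge>2. p W \<le> W ^ K" "\<forall>W\<ge>2. r W \<le> W ^ L"
    using assms unfolding polyb_def by blast
  then have "\<forall>W\<ge>2. p W * r W \<le> W ^ (K + L)"
    by (simp add: power_add mult_le_mono)
  then show ?thesis unfolding polyb_def by blast
qed

text \<open>A sum of two powers costs the factor 2, which one more factor \<open>W\<close> pays
  for.\<close>

lemma polyb_add:
  assumes "polyb p" "polyb r" shows "polyb (\<lambda>W. p W + r W)"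
proof -
  obtain K L where KL: "\<forall>W\<ge>2. p W \<le> W ^ K" "\<forall>W\<ge>2. r W \<le> W ^ L"
    using assms unfolding polyb_def by blast
  have "p W + r W \<le> W ^ (K + L + 1)" if W: "W \<ge> 2" for W
  proof -
    have "p W \<le> W ^ (K + L)" "r W \<le> W ^ (K + L)"
      using KL W by (meson order_trans le_add1 le_add2 power_increasing one_le_numeral)+
    then have "p W + r W \<le> 2 * W ^ (K + L)" by simp
    also have "\<dots> \<le> W * W ^ (K + L)" using W by (rule mult_le_mono1)
    finally show ?thesis by simp
  qed
  then show ?thesis unfolding polyb_def by blast
qed

lemmas polyb_intros = polyb_const polyb_id polyb_mult polyb_add

lemma polyb_compose:
  assumes "polyb p" "polyb r" "\<And>W. 2 \<le> W \<Longrightarrow> 2 \<le> r W" shows "polyb (\<lambda>W. p (r W))"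
proof -
  obtain K L where KL: "\<forall>W\<ge>2. p W \<le> W ^ K" "\<forall>W\<ge>2. r W \<le> W ^ L"
    using assms unfolding polyb_def by blast
  have "p (r W) \<le> W ^ (L * K)" if "W \<ge> 2" for W
  proof -
    have "p (r W) \<le> r W ^ K" using KL assms(3)[OF that] by blast
    also have "\<dots> \<le> (W ^ L) ^ K" using KL that by (simp add: power_mono)
    finally show ?thesis by (simp add: power_mult)
  qed
  then show ?thesis unfolding polyb_def by blast
qed

lemma digits_le_power: assumes "x \<le> 2 ^ k" shows "digits x \<le> k + 1"
proof (cases "x = 0")
  case True
  then show ?thesis by (simp add: digits_def floorlog_def)
next
  case False
  have "floorlog 2 x \<le> k + 1"
    using assms by (intro floorlog_leI) (auto intro: le_less_trans)
  then show ?thesis by (simp add: digits_def)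
qed

lemma digits_le_Suc: "digits x \<le> x + 1"
  using digits_le_power[of x x] less_exp[of x] by simp

lemma digits_mono: "x \<le> y \<Longrightarrow> digits x \<le> digits y"
  unfolding digits_def using floorlog_mono[of x y 2] by auto

lemma digits_0 [simp]: "digits 0 = 1" and digits_1 [simp]: "digits (Suc 0) = 1"
  by (simp_all add: digits_def floorlog_def)

section \<open>Loops\<close>

text \<open>The counter is decremented before the body, so the body sees the indices from the top
  down to 0. Register \<open>z\<close> is set to 1 in every pass because the body may use it as
  scratch space.\<close>

definition loop :: "nat \<Rightarrow> nat \<Rightarrow> com \<Rightarrow> com" where
  "loop x z c = While x (Seq (Const z 1) (Seq (Sub x x z) c))"

text \<open>The invariant is indexed by the number of passes left. A pass with counter
  \<open>Suc n\<close> is charged the digits of the counter twice, at most \<open>n + 2\<close>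
  each, then 1 for \<open>Const\<close>, 1 for the digit of the decrement, and the body; the final
  test costs 1.\<close>

lemma exec_loop:
  assumes "I n s" and x: "\<And>j s. I j s \<Longrightarrow> reg s x = j" and "x \<noteq> z"
    and body: "\<And>j r m. j < n \<Longrightarrow> I (Suc j) (r, m) \<Longrightarrow>
      \<exists>T s'. exec c (r(z := 1, x := j), m) T s' \<and> T \<le> B \<and> I j s'"
  shows "\<exists>T s'. exec (loop x z c) s T s' \<and> I 0 s' \<and> T \<le> n * (B + 2 * n + 6) + 1"
  using assms(1) body
proof (induction n arbitrary: s)
  case 0
  have "exec (loop x z c) s (digits 0) s"
    using x[OF 0(1)] WhileFalse[of s x] by (simp add: loop_def)
  then show ?case using 0(1) by (intro exI[of _ "digits 0"] exI[of _ s]) simp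
next
  case (Suc n)
  obtain r m where s: "s = (r, m)" by (cases s)
  have rx: "r x = Suc n" using x[OF Suc.prems(1)] s by simp
  obtain T1 s1 where 1: "exec c (r(z := 1, x := n), m) T1 s1" "T1 \<le> B" "I n s1"
    using Suc.prems s by blast
  obtain T2 s2 where 2: "exec (loop x z c) s1 T2 s2" "I 0 s2" "T2 \<le> n * (B + 2 * n + 6) + 1"
    using Suc.IH[OF 1(3)] Suc.prems(2) less_SucI by blast
  have "exec (Sub x x z) (r(z := 1), m) (digits (Suc n) + digits 1) (r(z := 1, x := n), m)"
    using Sub[of x x z "r(z := 1)" m] rx \<open>x \<noteq> z\<close> by simp
  then have "exec (Seq (Const z 1) (Seq (Sub x x z) c)) s (1 + (digits (Suc n) + digits 1 + T1)) s1"
    unfolding s by (rule exec.Seq[OF exec.Const exec.Seq[OF _ 1(1)]])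
  from WhileTrue[OF _ this 2(1)[unfolded loop_def]] rx s
  have e: "exec (loop x z c) s (digits (Suc n) + (1 + (digits (Suc n) + digits 1 + T1)) + T2) s2"
    by (simp add: loop_def)
  have "digits (Suc n) + (1 + (digits (Suc n) + digits 1 + T1)) + T2 \<le> (B + 2 * n + 6) + (n * (B + 2 * n + 6) + 1)"
    using 1(2) 2(3) digits_le_Suc[of "Suc n"] by simp
  also have "\<dots> \<le> Suc n * (B + 2 * Suc n + 6) + 1"
    by (simp add: algebra_simps)
  finally show ?case using e 2(2) by blast
qed

section \<open>Functions computable in polynomial time\<close>

text \<open>Functions of three arguments are compiled to programs: global parameters \<open>g\<close>, the memory \<open>m\<close>,
  and an environment \<open>e\<close> of loop variables, which are addressed by de Bruijn indices. The bound \<open>W\<close> plays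
  the role of the input size, except that memory cells may contain numbers with \<open>W\<close> digits.\<close>

definition valid :: "nat \<Rightarrow> (nat \<Rightarrow> nat) \<Rightarrow> (nat \<Rightarrow> nat) \<Rightarrow> (nat \<Rightarrow> nat) \<Rightarrow> bool" where
  "valid W g m e \<longleftrightarrow> 2 \<le> W \<and> (\<forall>i. g i \<le> W) \<and> (\<forall>a. m a \<le> 2 ^ W) \<and> (\<forall>i. e i \<le> W)"

type_synonym fn = "(nat \<Rightarrow> nat) \<Rightarrow> (nat \<Rightarrow> nat) \<Rightarrow> (nat \<Rightarrow> nat) \<Rightarrow> nat"

text \<open>Global parameters and loop variables live in the registers given by \<open>gs\<close> and \<open>vs\<close>, all below \<open>t\<close>;
  the value is left in register \<open>t\<close>, and the registers from \<open>t\<close> on are scratch space.\<close>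

definition evaluates :: "(nat \<Rightarrow> nat) \<Rightarrow> (nat \<Rightarrow> nat) \<Rightarrow> (nat \<Rightarrow> nat) \<Rightarrow> nat \<Rightarrow> com \<Rightarrow> fn \<Rightarrow> bool" where
  "evaluates p gs vs t c f \<longleftrightarrow> (\<forall>W r m. valid W (\<lambda>i. r (gs i)) m (\<lambda>i. r (vs i)) \<longrightarrow>
    (\<exists>T r'. exec c (r, m) T (r', m) \<and> T \<le> p W \<and>
      r' t = f (\<lambda>i. r (gs i)) m (\<lambda>i. r (vs i)) \<and> (\<forall>x<t. r' x = r x)))"

lemma le_power2: "x \<le> y \<Longrightarrow> x \<le> 2 ^ y" for x y :: nat
  by (meson less_exp less_imp_le order_trans)

text \<open>A small function has values polynomial in \<open>W\<close> and may therefore bound a loop; other functions only have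
  polynomially many digits. The polynomial is chosen before the registers, so it does not depend on
  the constants (in particular, the dimension) of a concrete program.\<close>

definition pcomp_witness :: "bool \<Rightarrow> fn \<Rightarrow> (nat \<Rightarrow> nat) \<Rightarrow> bool" where
  "pcomp_witness small f p \<longleftrightarrow> polyb p \<and>
    (\<forall>W g m e. valid W g m e \<longrightarrow> f g m e \<le> (if small then p W else 2 ^ p W)) \<and>
    (\<forall>gs vs t. (\<forall>i. gs i < t) \<and> (\<forall>i. vs i < t) \<longrightarrow> (\<exists>c. evaluates p gs vs t c f))"

definition pcomp :: "bool \<Rightarrow> fn \<Rightarrow> bool" where
  "pcomp small f \<longleftrightarrow> (\<exists>p. pcomp_witness small f p)"

lemma pcompI:
  assumes "polyb p" "\<And>W g m e. valid W g m e \<Longrightarrow> f g m e \<le> (if s then p W else 2 ^ p W)"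
    "\<And>gs vs t. (\<And>i. gs i < t) \<Longrightarrow> (\<And>i. vs i < t) \<Longrightarrow> \<exists>c. evaluates p gs vs t c f"
  shows "pcomp s f"
  unfolding pcomp_def pcomp_witness_def using assms by (intro exI[of _ p] conjI allI impI) simp_all

lemma pcompD:
  assumes "pcomp_witness s f p"
  shows pcompD_polyb: "polyb p"
    and pcompD_bound: "valid W g m e \<Longrightarrow> f g m e \<le> (if s then p W else 2 ^ p W)"
    and pcompD_big: "valid W g m e \<Longrightarrow> f g m e \<le> 2 ^ p W"
    and pcompD_eval: "(\<And>i. gs i < t) \<Longrightarrow> (\<And>i. vs i < t) \<Longrightarrow> \<exists>c. evaluates p gs vs t c f"
proof -
  show 1: "polyb p" "valid W g m e \<Longrightarrow> f g m e \<le> (if s then p W else 2 ^ p W)"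
    and "(\<And>i. gs i < t) \<Longrightarrow> (\<And>i. vs i < t) \<Longrightarrow> \<exists>c. evaluates p gs vs t c f"
    using assms unfolding pcomp_witness_def by simp_all
  show "valid W g m e \<Longrightarrow> f g m e \<le> 2 ^ p W"
    using 1(2) le_power2[of "f g m e" "p W"] by (cases s) simp_all
qed

lemma evaluatesE:
  assumes "evaluates p gs vs t c f" "valid W (\<lambda>i. r (gs i)) m (\<lambda>i. r (vs i))"
  obtains T r' where "exec c (r, m) T (r', m)" "T \<le> p W"
    "r' t = f (\<lambda>i. r (gs i)) m (\<lambda>i. r (vs i))" "\<And>x. x < t \<Longrightarrow> r' x = r x"
  using assms unfolding evaluates_def by meson

section \<open>Closure under constants, variables, memory access and binary operations\<close>

lemma pcomp_const: "pcomp s (\<lambda>g m e. k)"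
proof (rule pcompI)
  show "polyb (\<lambda>_. k + 1)" by (rule polyb_const)
  show "k \<le> (if s then k + 1 else 2 ^ (k + 1))" using le_power2[of k "k + 1"] by (cases s) (simp_all del: power_Suc)
  show "\<exists>c. evaluates (\<lambda>_. k + 1) gs vs t c (\<lambda>g m e. k)" for gs vs t
  proof -
    have "evaluates (\<lambda>_. k + 1) gs vs t (Const t k) (\<lambda>g m e. k)"
      unfolding evaluates_def
    proof (intro allI impI)
      fix W r m
      show "\<exists>T r'. exec (Const t k) (r, m) T (r', m) \<and> T \<le> k + 1 \<and> r' t = k \<and> (\<forall>x<t. r' x = r x)"
        by (rule exI[of _ 1], rule exI[of _ "r(t := k)"]) (simp add: exec.Const[of t k r m, simplified])
    qed
    then show ?thesis ..
  qed
qed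

lemma pcomp_reg:
  assumes "\<And>W g m e. valid W g m e \<Longrightarrow> f g m e \<le> W"
    and "\<And>(gs :: nat \<Rightarrow> nat) (vs :: nat \<Rightarrow> nat) t. (\<And>i. gs i < t) \<Longrightarrow> (\<And>i. vs i < t) \<Longrightarrow>
      \<exists>x<t. \<forall>r m. f (\<lambda>i. r (gs i)) m (\<lambda>i. r (vs i)) = r x"
  shows "pcomp s f"
proof (rule pcompI)
  show "polyb (\<lambda>W. W + 3)" by (intro polyb_intros)
  show "f g m e \<le> (if s then W + 3 else 2 ^ (W + 3))" if "valid W g m e" for W g m e
    using assms(1)[OF that] le_power2[of "f g m e" "W + 3"] by (cases s) simp_all
  show "\<exists>c. evaluates (\<lambda>W. W + 3) gs vs t c f" if *: "\<And>i. gs i < t" "\<And>i. vs i < t" for gs vs t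
  proof -
    obtain x where x: "x < t" "\<And>r m. f (\<lambda>i. r (gs i)) m (\<lambda>i. r (vs i)) = r x"
      using assms(2)[of gs t vs] * by blast
    \<comment> \<open>The machine has no move instruction; a register is copied by adding it to
      0.\<close>
    have "evaluates (\<lambda>W. W + 3) gs vs t (Seq (Const t 0) (Add t x t)) f"
      unfolding evaluates_def
    proof (intro allI impI)
      fix W r m assume v: "valid W (\<lambda>i. r (gs i)) m (\<lambda>i. r (vs i))"
      have "r x \<le> W" using assms(1)[OF v] x(2)[of r m] by simp
      then have d: "digits (r x) \<le> W + 1" using digits_le_Suc[of "r x"] by simp
      have "exec (Add t x t) (r(t := 0), m) (digits (r x) + digits 0) (r(t := r x), m)"
        using exec.Add[of t x t "r(t := 0)" m] x(1) by simp
      then have "exec (Seq (Const t 0) (Add t x t)) (r, m) (1 + (digits (r x) + digits 0)) (r(t := r x), m)"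
        by (intro exec.Seq[OF exec.Const])
      moreover have "1 + (digits (r x) + digits 0) \<le> W + 3" using d by simp
      ultimately show "\<exists>T r'. exec (Seq (Const t 0) (Add t x t)) (r, m) T (r', m) \<and> T \<le> W + 3 \<and>
          r' t = f (\<lambda>i. r (gs i)) m (\<lambda>i. r (vs i)) \<and> (\<forall>x<t. r' x = r x)"
        using x(2)[of r m] by (intro exI[of _ "1 + (digits (r x) + digits 0)"] exI[of _ "r(t := r x)"]) auto
    qed
    then show ?thesis ..
  qed
qed

lemma pcomp_var: "pcomp s (\<lambda>g m e. e i)"
  by (rule pcomp_reg) (auto simp: valid_def)

lemma pcomp_global: "pcomp s (\<lambda>g m e. g i)"
  by (rule pcomp_reg) (auto simp: valid_def)

text \<open>A memory cell may hold a number with \<open>W\<close> digits, so the result does not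
  count as small even when the address is.\<close>

lemma pcomp_load:
  assumes "pcomp s f" shows "pcomp False (\<lambda>g m e. m (f g m e))"
proof -
  obtain p where p: "pcomp_witness s f p" using assms unfolding pcomp_def ..
  let ?p = "\<lambda>W. p W + p W + W + 2"
  show ?thesis
  proof (rule pcompI)
    show "polyb ?p" by (intro polyb_intros p[THEN pcompD_polyb])
    show "m (f g m e) \<le> (if False then ?p W else 2 ^ ?p W)" if "valid W g m e" for W g m e
    proof -
      have "m (f g m e) \<le> 2 ^ W" using that by (simp add: valid_def)
      also have "\<dots> \<le> 2 ^ ?p W" by (rule power_increasing) auto
      finally show ?thesis by simp
    qed
    show "\<exists>c. evaluates ?p gs vs t c (\<lambda>g m e. m (f g m e))"
      if *: "\<And>i. gs i < t" "\<And>i. vs i < t" for gs vs t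
    proof -
      obtain c where c: "evaluates p gs vs t c f" using pcompD_eval[OF p, of gs t vs] * by blast
      have "evaluates ?p gs vs t (Seq c (Load t t)) (\<lambda>g m e. m (f g m e))"
        unfolding evaluates_def
      proof (intro allI impI)
        fix W r m assume v: "valid W (\<lambda>i. r (gs i)) m (\<lambda>i. r (vs i))"
        let ?f = "f (\<lambda>i. r (gs i)) m (\<lambda>i. r (vs i))"
        obtain T r' where 1: "exec c (r, m) T (r', m)" "T \<le> p W" "r' t = ?f" "\<And>x. x < t \<Longrightarrow> r' x = r x"
          by (rule evaluatesE[OF c v]) blast
        have "digits ?f \<le> p W + 1" by (rule digits_le_power[OF pcompD_big[OF p v]])
        moreover have "digits (m ?f) \<le> W + 1" by (rule digits_le_power) (use v in \<open>simp add: valid_def\<close>)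
        moreover have "exec (Seq c (Load t t)) (r, m) (T + (digits ?f + digits (m ?f))) (r'(t := m ?f), m)"
          using exec.Seq[OF 1(1) exec.Load[of t t r' m]] 1(3) by simp
        ultimately show "\<exists>T r'. exec (Seq c (Load t t)) (r, m) T (r', m) \<and> T \<le> ?p W \<and>
            r' t = m ?f \<and> (\<forall>x<t. r' x = r x)"
          using 1 by (intro exI[of _ "T + (digits ?f + digits (m ?f))"] exI[of _ "r'(t := m ?f)"]) auto
      qed
      then show ?thesis ..
    qed
  qed
qed

text \<open>The second operand is evaluated with \<open>Suc t\<close> as its result register, so the
  first one survives in \<open>t\<close>.\<close>

lemma evaluates_binop:
  assumes f: "evaluates p gs vs t c1 f" and h: "evaluates p' gs vs (Suc t) c2 h"
    and lt: "\<And>i. gs i < t" "\<And>i. vs i < t"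
    and bf: "\<And>W g m e. valid W g m e \<Longrightarrow> f g m e \<le> 2 ^ p W"
    and bh: "\<And>W g m e. valid W g m e \<Longrightarrow> h g m e \<le> 2 ^ p' W"
    and oc: "\<And>r m. exec oc (r, m) (digits (r t) + digits (r (Suc t))) (r(t := F (r t) (r (Suc t))), m)"
  shows "evaluates (\<lambda>W. p W + p W + p' W + p' W + 2) gs vs t (Seq c1 (Seq c2 oc)) (\<lambda>g m e. F (f g m e) (h g m e))"
  unfolding evaluates_def
proof (intro allI impI)
  fix W r m assume v: "valid W (\<lambda>i. r (gs i)) m (\<lambda>i. r (vs i))"
  let ?f = "f (\<lambda>i. r (gs i)) m (\<lambda>i. r (vs i))" and ?h = "h (\<lambda>i. r (gs i)) m (\<lambda>i. r (vs i))"
  obtain T1 r1 where 1: "exec c1 (r, m) T1 (r1, m)" "T1 \<le> p W" "r1 t = ?f" "\<And>x. x < t \<Longrightarrow> r1 x = r x"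
    by (rule evaluatesE[OF f v]) blast
  have eq: "(\<lambda>i. r1 (gs i)) = (\<lambda>i. r (gs i))" "(\<lambda>i. r1 (vs i)) = (\<lambda>i. r (vs i))" using 1(4) lt by auto
  have v1: "valid W (\<lambda>i. r1 (gs i)) m (\<lambda>i. r1 (vs i))" using v eq by simp
  obtain T2 r2 where 2: "exec c2 (r1, m) T2 (r2, m)" "T2 \<le> p' W" "r2 (Suc t) = ?h"
      "\<And>x. x < Suc t \<Longrightarrow> r2 x = r1 x"
    by (rule evaluatesE[OF h v1]) (simp add: eq)
  have "digits ?f \<le> p W + 1" "digits ?h \<le> p' W + 1"
    by (rule digits_le_power[OF bf[OF v]], rule digits_le_power[OF bh[OF v]])
  moreover have "exec (Seq c1 (Seq c2 oc)) (r, m) (T1 + (T2 + (digits ?f + digits ?h))) (r2(t := F ?f ?h), m)"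
    using exec.Seq[OF 1(1) exec.Seq[OF 2(1) oc[of r2 m]]] 1(3) 2(3) 2(4)[of t] by simp
  ultimately show "\<exists>T r'. exec (Seq c1 (Seq c2 oc)) (r, m) T (r', m) \<and> T \<le> p W + p W + p' W + p' W + 2 \<and>
      r' t = F ?f ?h \<and> (\<forall>x<t. r' x = r x)"
    using 1 2 by (intro exI[of _ "T1 + (T2 + (digits ?f + digits ?h))"] exI[of _ "r2(t := F ?f ?h)"]) auto
qed

lemma add_le_power:
  fixes x y :: nat
  assumes "x \<le> 2 ^ a" "y \<le> 2 ^ b" shows "x + y \<le> 2 ^ (a + a + b + b + 2)"
proof -
  have "(2::nat) ^ a \<le> 2 ^ (a + b)" "(2::nat) ^ b \<le> 2 ^ (a + b)"
    by (rule power_increasing; simp)+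
  then have "x + y \<le> 2 ^ (a + b) + 2 ^ (a + b)" using assms by (meson add_mono order_trans)
  also have "\<dots> = 2 ^ Suc (a + b)" by simp
  also have "\<dots> \<le> 2 ^ (a + a + b + b + 2)" by (rule power_increasing) auto
  finally show ?thesis .
qed

lemma pcomp_add:
  assumes "pcomp s f" "pcomp s h" shows "pcomp s (\<lambda>g m e. f g m e + h g m e)"
proof -
  obtain p where p: "pcomp_witness s f p" using assms(1) unfolding pcomp_def ..
  obtain p' where p': "pcomp_witness s h p'" using assms(2) unfolding pcomp_def ..
  let ?p = "\<lambda>W. p W + p W + p' W + p' W + 2"
  show ?thesis
  proof (rule pcompI)
    show "polyb ?p" by (intro polyb_intros p[THEN pcompD_polyb] p'[THEN pcompD_polyb])
    show "f g m e + h g m e \<le> (if s then ?p W else 2 ^ ?p W)" if v: "valid W g m e" for W g m e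
      using pcompD_bound[OF p v] pcompD_bound[OF p' v] add_le_power[OF pcompD_big[OF p v] pcompD_big[OF p' v]] by auto
    show "\<exists>c. evaluates ?p gs vs t c (\<lambda>g m e. f g m e + h g m e)"
      if *: "\<And>i. gs i < t" "\<And>i. vs i < t" for gs vs t
    proof -
      have lt: "\<And>i. gs i < Suc t" "\<And>i. vs i < Suc t" using * by (simp_all add: less_SucI)
      obtain c where c: "evaluates p gs vs t c f" using pcompD_eval[OF p, of gs t vs] * by blast
      obtain c' where c': "evaluates p' gs vs (Suc t) c' h" using pcompD_eval[OF p', of gs "Suc t" vs] lt by blast
      have "exec (Add t t (Suc t)) (r, m) (digits (r t) + digits (r (Suc t))) (r(t := (+) (r t) (r (Suc t))), m)" for r m
        by (rule exec.Add)
      from evaluates_binop[where F = "(+)", OF c c' * pcompD_big[OF p] pcompD_big[OF p'] this] show ?thesis by blast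
    qed
  qed
qed

text \<open>Truncated subtraction never exceeds its first operand; hence smallness is inherited from
  \<open>f\<close> alone and \<open>h\<close> may be large.\<close>

lemma pcomp_diff:
  assumes "pcomp s f" "pcomp s' h" shows "pcomp s (\<lambda>g m e. f g m e - h g m e)"
proof -
  obtain p where p: "pcomp_witness s f p" using assms(1) unfolding pcomp_def ..
  obtain p' where p': "pcomp_witness s' h p'" using assms(2) unfolding pcomp_def ..
  let ?p = "\<lambda>W. p W + p W + p' W + p' W + 2"
  show ?thesis
  proof (rule pcompI)
    show "polyb ?p" by (intro polyb_intros p[THEN pcompD_polyb] p'[THEN pcompD_polyb])
    show "f g m e - h g m e \<le> (if s then ?p W else 2 ^ ?p W)" if v: "valid W g m e" for W g m e
    proof -
      have "(2::nat) ^ p W \<le> 2 ^ ?p W" by (rule power_increasing; simp)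
      then show ?thesis using pcompD_bound[OF p v] by (auto split: if_splits)
    qed
    show "\<exists>c. evaluates ?p gs vs t c (\<lambda>g m e. f g m e - h g m e)"
      if *: "\<And>i. gs i < t" "\<And>i. vs i < t" for gs vs t
    proof -
      have lt: "\<And>i. gs i < Suc t" "\<And>i. vs i < Suc t" using * by (simp_all add: less_SucI)
      obtain c where c: "evaluates p gs vs t c f" using pcompD_eval[OF p, of gs t vs] * by blast
      obtain c' where c': "evaluates p' gs vs (Suc t) c' h" using pcompD_eval[OF p', of gs "Suc t" vs] lt by blast
      have "exec (Sub t t (Suc t)) (r, m) (digits (r t) + digits (r (Suc t))) (r(t := (-) (r t) (r (Suc t))), m)" for r m
        by (rule exec.Sub)
      from evaluates_binop[where F = "(-)", OF c c' * pcompD_big[OF p] pcompD_big[OF p'] this] show ?thesis by blast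
    qed
  qed
qed


section \<open>Environments, renaming and branching\<close>

lemma valid_mono: "valid W g m e \<Longrightarrow> valid (W + k) g m e"
  unfolding valid_def
  by (meson le_add1 order_trans power_increasing one_le_numeral trans_le_add1)

text \<open>Entering a loop pushes the loop variable as de Bruijn index 0. Its value is bounded only
  by the polynomial for the loop length, so the size parameter grows by that much.\<close>

lemma valid_case_nat: "valid W g m e \<Longrightarrow> a \<le> k \<Longrightarrow> valid (W + k) g m (case_nat a e)"
  using valid_mono[of W g m e k] unfolding valid_def by (auto split: nat.split)

lemma pcomp_rename:
  assumes "pcomp s f" shows "pcomp s (\<lambda>g m e. f g m (\<lambda>i. e (\<pi> i)))"
proof -
  obtain p where p: "pcomp_witness s f p" using assms unfolding pcomp_def ..
  show ?thesis
  proof (rule pcompI[OF pcompD_polyb[OF p]])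
    show "f g m (\<lambda>i. e (\<pi> i)) \<le> (if s then p W else 2 ^ p W)" if "valid W g m e" for W g m e
      by (rule pcompD_bound[OF p]) (use that in \<open>simp add: valid_def\<close>)
    show "\<exists>c. evaluates p gs vs t c (\<lambda>g m e. f g m (\<lambda>i. e (\<pi> i)))"
      if *: "\<And>i. gs i < t" "\<And>i. vs i < t" for gs vs t
    proof -
      obtain c where c: "evaluates p gs (\<lambda>i. vs (\<pi> i)) t c f"
        using pcompD_eval[OF p, of gs t "\<lambda>i. vs (\<pi> i)"] * by blast
      have "evaluates p gs vs t c (\<lambda>g m e. f g m (\<lambda>i. e (\<pi> i)))"
        unfolding evaluates_def
      proof (intro allI impI)
        fix W r m assume "valid W (\<lambda>i. r (gs i)) m (\<lambda>i. r (vs i))"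
        then have v: "valid W (\<lambda>i. r (gs i)) m (\<lambda>i. r (vs (\<pi> i)))" by (simp add: valid_def)
        show "\<exists>T r'. exec c (r, m) T (r', m) \<and> T \<le> p W \<and>
            r' t = f (\<lambda>i. r (gs i)) m (\<lambda>i. r (vs (\<pi> i))) \<and> (\<forall>x<t. r' x = r x)"
          using c v unfolding evaluates_def by simp
      qed
      then show ?thesis ..
    qed
  qed
qed

text \<open>Weakening: an outer expression can be used under one more loop variable.\<close>

lemma pcomp_shift: "pcomp s f \<Longrightarrow> pcomp s (\<lambda>g m e. f g m (\<lambda>i. e (Suc i)))"
  by (rule pcomp_rename)

lemma pcomp_if:
  assumes "pcomp True (\<lambda>g m e. of_bool (P g m e))" "pcomp s f" "pcomp s h"
  shows "pcomp s (\<lambda>g m e. if P g m e then f g m e else h g m e)"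
proof -
  obtain p0 where p0: "pcomp_witness True (\<lambda>g m e. of_bool (P g m e)) p0" using assms(1) unfolding pcomp_def ..
  obtain p1 where p1: "pcomp_witness s f p1" using assms(2) unfolding pcomp_def ..
  obtain p2 where p2: "pcomp_witness s h p2" using assms(3) unfolding pcomp_def ..
  let ?p = "\<lambda>W. p0 W + 1 + (p1 W + p2 W)"
  show ?thesis
  proof (rule pcompI)
    show "polyb ?p" by (intro polyb_intros p0[THEN pcompD_polyb] p1[THEN pcompD_polyb] p2[THEN pcompD_polyb])
    show "(if P g m e then f g m e else h g m e) \<le> (if s then ?p W else 2 ^ ?p W)"
      if v: "valid W g m e" for W g m e
    proof -
      have "f g m e \<le> 2 ^ ?p W"
        by (rule order_trans[OF pcompD_big[OF p1 v]], rule power_increasing) simp_all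
      moreover have "h g m e \<le> 2 ^ ?p W"
        by (rule order_trans[OF pcompD_big[OF p2 v]], rule power_increasing) simp_all
      ultimately show ?thesis
        using pcompD_bound[OF p1 v] pcompD_bound[OF p2 v] by (cases s) auto
    qed
    show "\<exists>c. evaluates ?p gs vs t c (\<lambda>g m e. if P g m e then f g m e else h g m e)"
      if *: "\<And>i. gs i < t" "\<And>i. vs i < t" for gs vs t
    proof -
      obtain c0 where c0: "evaluates p0 gs vs t c0 (\<lambda>g m e. of_bool (P g m e))"
        using pcompD_eval[OF p0, of gs t vs] * by blast
      obtain c1 where c1: "evaluates p1 gs vs t c1 f" using pcompD_eval[OF p1, of gs t vs] * by blast
      obtain c2 where c2: "evaluates p2 gs vs t c2 h" using pcompD_eval[OF p2, of gs t vs] * by blast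
      have "evaluates ?p gs vs t (Seq c0 (If t c1 c2)) (\<lambda>g m e. if P g m e then f g m e else h g m e)"
        unfolding evaluates_def
      proof (intro allI impI)
        fix W r m assume v: "valid W (\<lambda>i. r (gs i)) m (\<lambda>i. r (vs i))"
        let ?P = "P (\<lambda>i. r (gs i)) m (\<lambda>i. r (vs i))"
        obtain T0 r0 where 0: "exec c0 (r, m) T0 (r0, m)" "T0 \<le> p0 W" "r0 t = of_bool ?P" "\<And>x. x < t \<Longrightarrow> r0 x = r x"
          by (rule evaluatesE[OF c0 v]) blast
        have eq: "(\<lambda>i. r0 (gs i)) = (\<lambda>i. r (gs i))" "(\<lambda>i. r0 (vs i)) = (\<lambda>i. r (vs i))" using 0(4) * by auto
        have v0: "valid W (\<lambda>i. r0 (gs i)) m (\<lambda>i. r0 (vs i))" using v eq by simp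
        show "\<exists>T r'. exec (Seq c0 (If t c1 c2)) (r, m) T (r', m) \<and> T \<le> ?p W \<and>
            r' t = (if ?P then f (\<lambda>i. r (gs i)) m (\<lambda>i. r (vs i)) else h (\<lambda>i. r (gs i)) m (\<lambda>i. r (vs i))) \<and>
            (\<forall>x<t. r' x = r x)"
        proof (cases ?P)
          case True
          obtain T1 r1 where 1: "exec c1 (r0, m) T1 (r1, m)" "T1 \<le> p1 W"
              "r1 t = f (\<lambda>i. r (gs i)) m (\<lambda>i. r (vs i))" "\<And>x. x < t \<Longrightarrow> r1 x = r0 x"
            by (rule evaluatesE[OF c1 v0]) (simp add: eq)
          have "exec (Seq c0 (If t c1 c2)) (r, m) (T0 + (digits (r0 t) + T1)) (r1, m)"
            using exec.Seq[OF 0(1) exec.IfTrue[OF _ 1(1), of t c2]] 0(3) True by simp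
          then show ?thesis using 0 1 True
            by (intro exI[of _ "T0 + (digits (r0 t) + T1)"] exI[of _ r1]) auto
        next
          case False
          obtain T1 r1 where 1: "exec c2 (r0, m) T1 (r1, m)" "T1 \<le> p2 W"
              "r1 t = h (\<lambda>i. r (gs i)) m (\<lambda>i. r (vs i))" "\<And>x. x < t \<Longrightarrow> r1 x = r0 x"
            by (rule evaluatesE[OF c2 v0]) (simp add: eq)
          have "exec (Seq c0 (If t c1 c2)) (r, m) (T0 + (digits (r0 t) + T1)) (r1, m)"
            using exec.Seq[OF 0(1) exec.IfFalse[OF _ 1(1), of t c1]] 0(3) False by simp
          then show ?thesis using 0 1 False
            by (intro exI[of _ "T0 + (digits (r0 t) + T1)"] exI[of _ r1]) auto
        qed
      qed
      then show ?thesis ..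
    qed
  qed
qed

text \<open>Repeated doubling. The exponent must be small because it is the length of the loop; the
  power then has polynomially many digits but is not itself small.\<close>

lemma pcomp_pow2:
  assumes "pcomp True f" shows "pcomp False (\<lambda>g m e. 2 ^ f g m e)"
proof -
  obtain p where p: "pcomp_witness True f p" using assms unfolding pcomp_def ..
  let ?p = "\<lambda>W. p W + 1 + (p W * (4 * p W + 8) + 1)"
  show ?thesis
  proof (rule pcompI)
    show "polyb ?p" by (intro polyb_intros p[THEN pcompD_polyb])
    show "2 ^ f g m e \<le> (if False then ?p W else 2 ^ ?p W)" if v: "valid W g m e" for W g m e
      using pcompD_bound[OF p v] by (simp del: power_Suc power_add)
    show "\<exists>c. evaluates ?p gs vs t c (\<lambda>g m e. 2 ^ f g m e)"
      if *: "\<And>i. gs i < t" "\<And>i. vs i < t" for gs vs t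
    proof -
      have lt: "\<And>i. gs i < Suc t" "\<And>i. vs i < Suc t" using * by (simp_all add: less_SucI)
      obtain c where c: "evaluates p gs vs (Suc t) c f"
        using pcompD_eval[OF p, of gs "Suc t" vs] lt by blast
      let ?l = "loop (Suc t) (Suc (Suc t)) (Add t t t)"
      have "evaluates ?p gs vs t (Seq c (Seq (Const t 1) ?l)) (\<lambda>g m e. 2 ^ f g m e)"
        unfolding evaluates_def
      proof (intro allI impI)
        fix W r m assume v: "valid W (\<lambda>i. r (gs i)) m (\<lambda>i. r (vs i))"
        define n where "n = f (\<lambda>i. r (gs i)) m (\<lambda>i. r (vs i))"
        have n: "n \<le> p W" using pcompD_bound[OF p v] by (simp add: n_def)
        obtain T1 r1 where 1: "exec c (r, m) T1 (r1, m)" "T1 \<le> p W" "r1 (Suc t) = n" "\<And>x. x < Suc t \<Longrightarrow> r1 x = r x"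
          by (rule evaluatesE[OF c v]) (simp add: n_def)
        let ?I = "\<lambda>j s. snd s = m \<and> fst s (Suc t) = j \<and> fst s t = 2 ^ (n - j) \<and> (\<forall>x<t. fst s x = r x) \<and> j \<le> n"
        have "\<exists>T s'. exec ?l (r1(t := 1), m) T s' \<and> ?I 0 s' \<and> T \<le> n * ((2 * n + 2) + 2 * n + 6) + 1"
        proof (rule exec_loop[where I = ?I and B = "2 * n + 2"])
          show "?I n (r1(t := 1), m)" using 1 by simp
          show "\<exists>T s'. exec (Add t t t) (r'(Suc (Suc t) := 1, Suc t := j), m') T s' \<and> T \<le> 2 * n + 2 \<and> ?I j s'"
            if "j < n" "?I (Suc j) (r', m')" for j r' m'
          proof -
            have "r' t = 2 ^ (n - Suc j)" using that by simp
            moreover have "digits (2 ^ (n - Suc j)) \<le> (n - Suc j) + 1" by (rule digits_le_power) simp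
            moreover have "(2::nat) ^ (n - Suc j) + 2 ^ (n - Suc j) = 2 ^ (n - j)"
              using that by (simp add: Suc_diff_Suc[symmetric])
            ultimately show ?thesis
              using that exec.Add[of t t t "r'(Suc (Suc t) := 1, Suc t := j)" m]
              by (intro exI[of _ "digits (r' t) + digits (r' t)"]
                  exI[of _ "(r'(Suc (Suc t) := 1, Suc t := j, t := r' t + r' t), m)"]) (simp add: fun_upd_twist)
          qed
        qed auto
        then obtain T2 s2 where 2: "exec ?l (r1(t := 1), m) T2 s2" "?I 0 s2" "T2 \<le> n * (4 * n + 8) + 1"
          by (auto simp: algebra_simps)
        obtain r2 where s2: "s2 = (r2, m)" using 2(2) by (cases s2) auto
        have "n * (4 * n + 8) \<le> p W * (4 * p W + 8)" using n by (intro mult_le_mono) auto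
        then have "T1 + (1 + T2) \<le> ?p W" using 1(2) 2(3) by linarith
        moreover have "exec (Seq c (Seq (Const t 1) ?l)) (r, m) (T1 + (1 + T2)) (r2, m)"
          using exec.Seq[OF 1(1) exec.Seq[OF exec.Const 2(1)]] s2 by simp
        ultimately show "\<exists>T r'. exec (Seq c (Seq (Const t 1) ?l)) (r, m) T (r', m) \<and> T \<le> ?p W \<and>
            r' t = 2 ^ f (\<lambda>i. r (gs i)) m (\<lambda>i. r (vs i)) \<and> (\<forall>x<t. r' x = r x)"
          using 2(2) s2 by (intro exI[of _ "T1 + (1 + T2)"] exI[of _ r2]) (simp add: n_def)
      qed
      then show ?thesis ..
    qed
  qed
qed

text \<open>The only general form of iteration; products, division and bounded quantifiers are all
  derived from it.\<close>

lemma pcomp_sum: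
  assumes "pcomp True a" "pcomp s (\<lambda>g m e. F (e 0) g m (\<lambda>i. e (Suc i)))"
  shows "pcomp s (\<lambda>g m e. \<Sum>i<a g m e. F i g m e)"
proof -
  let ?F = "\<lambda>g m e. F (e 0) g m (\<lambda>i. e (Suc i))"
  obtain p where p: "pcomp_witness True a p" using assms(1) unfolding pcomp_def ..
  obtain p' where p': "pcomp_witness s ?F p'" using assms(2) unfolding pcomp_def ..
  \<comment> \<open>Under the sum the loop variable reaches up to \<open>p W\<close>, so the bound
    of the body is taken at the enlarged parameter.\<close>
  let ?q = "\<lambda>W. p' (W + p W)"
  let ?p = "\<lambda>W. p W + 1 + (p W * (3 * ?q W + 3 * p W + 8) + 1) + (p W * ?q W + ?q W)"
  have bF: "F i g m e \<le> (if s then ?q W else 2 ^ ?q W)" "F i g m e \<le> 2 ^ ?q W"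
    if v: "valid W g m e" and i: "i < a g m e" for W g m e i
  proof -
    have "i \<le> p W" using pcompD_bound[OF p v] i by simp
    then have "valid (W + p W) g m (case_nat i e)" by (rule valid_case_nat[OF v])
    from pcompD_bound[OF p' this] pcompD_big[OF p' this]
    show "F i g m e \<le> (if s then ?q W else 2 ^ ?q W)" "F i g m e \<le> 2 ^ ?q W" by simp_all
  qed
  show ?thesis
  proof (rule pcompI)
    show "polyb ?p"
      by (intro polyb_intros p[THEN pcompD_polyb] polyb_compose[OF p'[THEN pcompD_polyb]]) simp_all
    show "(\<Sum>i<a g m e. F i g m e) \<le> (if s then ?p W else 2 ^ ?p W)" if v: "valid W g m e" for W g m e
    proof (cases s)
      case True
      have "(\<Sum>i<a g m e. F i g m e) \<le> (\<Sum>i<a g m e. ?q W)"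
        by (rule sum_mono) (use bF(1)[OF v] True in simp)
      also have "\<dots> \<le> p W * ?q W" using pcompD_bound[OF p v] by simp
      finally show ?thesis using True by simp
    next
      case False
      have "(\<Sum>i<a g m e. F i g m e) \<le> (\<Sum>i<a g m e. 2 ^ ?q W)"
        by (rule sum_mono) (use bF(2)[OF v] in simp)
      also have "\<dots> \<le> p W * 2 ^ ?q W" using pcompD_bound[OF p v] by simp
      also have "\<dots> \<le> 2 ^ p W * 2 ^ ?q W" by (simp add: less_imp_le)
      also have "\<dots> = 2 ^ (p W + ?q W)" by (simp add: power_add)
      also have "\<dots> \<le> 2 ^ ?p W" by (rule power_increasing) simp_all
      finally show ?thesis using False by simp
    qed
    show "\<exists>c. evaluates ?p gs vs t c (\<lambda>g m e. \<Sum>i<a g m e. F i g m e)"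
      if *: "\<And>i. gs i < t" "\<And>i. vs i < t" for gs vs t
    proof -
      have "\<exists>c. evaluates p gs vs (Suc t) c a"
      proof (rule pcompD_eval[OF p])
        show "gs i < Suc t" for i using *(1)[of i] by simp
        show "vs i < Suc t" for i using *(2)[of i] by simp
      qed
      then obtain c where c: "evaluates p gs vs (Suc t) c a" ..
      have "\<exists>c'. evaluates p' gs (case_nat (Suc t) vs) (Suc (Suc t)) c' ?F"
      proof (rule pcompD_eval[OF p'])
        show "gs i < Suc (Suc t)" for i using *(1)[of i] by simp
        show "case_nat (Suc t) vs i < Suc (Suc t)" for i using *(2)[of "i - 1"] by (cases i) simp_all
      qed
      then obtain c' where c': "evaluates p' gs (case_nat (Suc t) vs) (Suc (Suc t)) c' ?F" ..
      let ?b = "Seq c' (Add t t (Suc (Suc t)))"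
      let ?l = "loop (Suc t) (Suc (Suc t)) ?b"
      have ev: "evaluates ?p gs vs t (Seq c (Seq (Const t 0) ?l)) (\<lambda>g m e. \<Sum>i<a g m e. F i g m e)"
        unfolding evaluates_def
      proof (intro allI impI)
        fix W r m assume v: "valid W (\<lambda>i. r (gs i)) m (\<lambda>i. r (vs i))"
        define n where "n = a (\<lambda>i. r (gs i)) m (\<lambda>i. r (vs i))"
        define G where "G = (\<lambda>i. F i (\<lambda>i. r (gs i)) m (\<lambda>i. r (vs i)))"
        have n: "n \<le> p W" using pcompD_bound[OF p v] by (simp add: n_def)
        have G: "G i \<le> 2 ^ ?q W" if "i < n" for i using bF(2)[OF v, of i] that by (simp add: G_def n_def)
        obtain T1 r1 where 1: "exec c (r, m) T1 (r1, m)" "T1 \<le> p W" "r1 (Suc t) = n" "\<And>x. x < Suc t \<Longrightarrow> r1 x = r x"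
          by (rule evaluatesE[OF c v]) (simp add: n_def)
        let ?I = "\<lambda>j s. snd s = m \<and> fst s (Suc t) = j \<and> fst s t = (\<Sum>i=j..<n. G i) \<and> (\<forall>x<t. fst s x = r x)"
        \<comment> \<open>The summand takes \<open>?q W\<close> steps and has at most
          \<open>?q W + 1\<close> digits; the accumulator is at most \<open>n * 2 ^ ?q W\<close> and
          thus has at most \<open>n + ?q W + 1\<close> digits.\<close>
        let ?B = "3 * ?q W + n + 2"
        have "\<exists>T s'. exec ?l (r1(t := 0), m) T s' \<and> ?I 0 s' \<and> T \<le> n * (?B + 2 * n + 6) + 1"
        proof (rule exec_loop[where I = ?I and B = ?B])
          show "?I n (r1(t := 0), m)" using 1 by simp
          show "\<exists>T s'. exec ?b (r'(Suc (Suc t) := 1, Suc t := j), m') T s' \<and> T \<le> ?B \<and> ?I j s'"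
            if j: "j < n" and I: "?I (Suc j) (r', m')" for j r' m'
          proof -
            let ?r = "r'(Suc (Suc t) := 1, Suc t := j)"
            have m': "m' = m" using I by simp
            have e1: "(\<lambda>i. ?r (gs i)) = (\<lambda>i. r (gs i))"
            proof
              fix i show "?r (gs i) = r (gs i)" using I *(1)[of i] by simp
            qed
            have e2: "(\<lambda>i. ?r (case_nat (Suc t) vs i)) = case_nat j (\<lambda>i. r (vs i))"
            proof
              fix i show "?r (case_nat (Suc t) vs i) = case_nat j (\<lambda>i. r (vs i)) i"
                using I *(2)[of "i - 1"] by (cases i) simp_all
            qed
            have e3: "(\<lambda>i. ?r (vs i)) = (\<lambda>i. r (vs i))"
            proof
              fix i show "?r (vs i) = r (vs i)" using I *(2)[of i] by simp
            qed
            have "j \<le> p W" using j n by simp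
            then have v': "valid (W + p W) (\<lambda>i. ?r (gs i)) m (\<lambda>i. ?r (case_nat (Suc t) vs i))"
              unfolding e1 e2 by (rule valid_case_nat[OF v])
            obtain T2 r2 where 2: "exec c' (?r, m) T2 (r2, m)" "T2 \<le> ?q W"
              "r2 (Suc (Suc t)) = G j" "\<And>x. x < Suc (Suc t) \<Longrightarrow> r2 x = ?r x"
              by (rule evaluatesE[OF c' v']) (simp only: e1 e3 G_def nat.case fun_upd_same)
            have acc: "r2 t = (\<Sum>i=Suc j..<n. G i)" using 2(4)[of t] I by simp
            have "(\<Sum>i=Suc j..<n. G i) \<le> (\<Sum>i=Suc j..<n. 2 ^ ?q W)" by (rule sum_mono) (simp add: G)
            also have "\<dots> \<le> n * 2 ^ ?q W" by simp
            also have "\<dots> \<le> 2 ^ n * 2 ^ ?q W" by (simp add: less_imp_le)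
            also have "\<dots> = 2 ^ (n + ?q W)" by (simp add: power_add)
            finally have d1: "digits (r2 t) \<le> n + ?q W + 1" unfolding acc by (rule digits_le_power)
            have d2: "digits (r2 (Suc (Suc t))) \<le> ?q W + 1" unfolding 2(3) by (rule digits_le_power[OF G[OF j]])
            have e: "exec ?b (?r, m') (T2 + (digits (r2 t) + digits (r2 (Suc (Suc t))))) (r2(t := r2 t + r2 (Suc (Suc t))), m)"
              unfolding m' by (rule exec.Seq[OF 2(1) exec.Add])
            have "r2 t + r2 (Suc (Suc t)) = (\<Sum>i=j..<n. G i)"
              unfolding acc 2(3) using j by (simp add: sum.atLeast_Suc_lessThan)
            moreover have "r2 x = r x" if "x < t" for x using 2(4)[of x] I that by simp
            moreover have "r2 (Suc t) = j" using 2(4)[of "Suc t"] by simp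
            ultimately have inv: "?I j (r2(t := r2 t + r2 (Suc (Suc t))), m)" by simp
            have bd: "T2 + (digits (r2 t) + digits (r2 (Suc (Suc t)))) \<le> ?B" using d1 d2 2(2) by linarith
            show ?thesis by (rule exI, rule exI, rule conjI[OF e conjI[OF bd inv]])
          qed
          show "fst s (Suc t) = j" if "?I j s" for j s using that by (elim conjE)
        qed simp
        then obtain T2 where "\<exists>s'. exec ?l (r1(t := 0), m) T2 s' \<and> ?I 0 s' \<and> T2 \<le> n * (?B + 2 * n + 6) + 1" ..
        then obtain s2 where s: "exec ?l (r1(t := 0), m) T2 s2 \<and> ?I 0 s2 \<and> T2 \<le> n * (?B + 2 * n + 6) + 1" ..
        from s have 2: "exec ?l (r1(t := 0), m) T2 s2" "?I 0 s2" "T2 \<le> n * (?B + 2 * n + 6) + 1"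
          by (rule conjunct1, rule conjunct2[THEN conjunct1], rule conjunct2[THEN conjunct2])
        obtain r2 where s2: "s2 = (r2, m)" using 2(2) by (cases s2) auto
        have "n * (?B + 2 * n + 6) \<le> p W * (3 * ?q W + 3 * p W + 8)" using n by (intro mult_le_mono) auto
        then have bd: "T1 + (1 + T2) \<le> ?p W" using 1(2) 2(3) by linarith
        have e: "exec (Seq c (Seq (Const t 0) ?l)) (r, m) (T1 + (1 + T2)) (r2, m)"
          using exec.Seq[OF 1(1) exec.Seq[OF exec.Const 2(1)]] s2 by simp
        have v: "r2 t = (\<Sum>i<a (\<lambda>i. r (gs i)) m (\<lambda>i. r (vs i)). F i (\<lambda>i. r (gs i)) m (\<lambda>i. r (vs i)))"
          and f: "\<forall>x<t. r2 x = r x"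
          using 2(2) unfolding s2 n_def G_def by (simp_all add: atLeast0LessThan)
        show "\<exists>T r'. exec (Seq c (Seq (Const t 0) ?l)) (r, m) T (r', m) \<and> T \<le> ?p W \<and>
            r' t = (\<Sum>i<a (\<lambda>i. r (gs i)) m (\<lambda>i. r (vs i)). F i (\<lambda>i. r (gs i)) m (\<lambda>i. r (vs i))) \<and> (\<forall>x<t. r' x = r x)"
          by (rule exI, rule exI, rule conjI[OF e conjI[OF bd conjI[OF v f]]])
      qed
      show ?thesis by (rule exI[of _ "Seq c (Seq (Const t 0) ?l)"]) (rule ev)
    qed
  qed
qed

section \<open>Multiplication, comparisons, bounded quantifiers and division\<close>

lemma pcomp_mult:
  assumes "pcomp True a" "pcomp s b" shows "pcomp s (\<lambda>g m e. a g m e * b g m e)"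
proof -
  have "pcomp s (\<lambda>g m e. \<Sum>i<a g m e. b g m e)"
    by (rule pcomp_sum[where F = "\<lambda>_. b", OF assms(1) pcomp_shift[OF assms(2)]])
  then show ?thesis by simp
qed

text \<open>Truncation turns the comparison into a number: \<open>a - b\<close> vanishes exactly
  when \<open>a \<le> b\<close>. The outer difference starts from 1, so the result is small although
  \<open>a\<close> and \<open>b\<close> need not be.\<close>

lemma pcomp_le:
  assumes "pcomp s a" "pcomp s' b" shows "pcomp True (\<lambda>g m e. of_bool (a g m e \<le> b g m e))"
proof -
  have "pcomp True (\<lambda>g m e. 1 - (a g m e - b g m e))"
    by (rule pcomp_diff[OF pcomp_const pcomp_diff[OF assms]])
  moreover have "1 - (x - y) = of_bool (x \<le> y)" for x y :: nat by auto
  ultimately show ?thesis by (simp only:)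
qed

lemma pcomp_not:
  assumes "pcomp True (\<lambda>g m e. of_bool (P g m e))"
  shows "pcomp True (\<lambda>g m e. of_bool (\<not> P g m e))"
  proof -
  have "pcomp True (\<lambda>g m e. 1 - of_bool (P g m e))" by (rule pcomp_diff[OF pcomp_const assms])
  moreover have "1 - of_bool Q = (of_bool (\<not> Q) :: nat)" for Q by simp
  ultimately show ?thesis by (simp only:)
qed

lemma pcomp_less:
  assumes "pcomp s a" "pcomp s' b" shows "pcomp True (\<lambda>g m e. of_bool (a g m e < b g m e))"
  using pcomp_not[OF pcomp_le[OF assms(2,1)]] by (simp only: not_le)

lemma pcomp_conj:
  assumes "pcomp True (\<lambda>g m e. of_bool (P g m e))" "pcomp True (\<lambda>g m e. of_bool (Q g m e))"
  shows "pcomp True (\<lambda>g m e. of_bool (P g m e \<and> Q g m e))"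
  unfolding of_bool_conj by (rule pcomp_mult[OF assms])

lemma pcomp_disj:
  assumes "pcomp True (\<lambda>g m e. of_bool (P g m e))" "pcomp True (\<lambda>g m e. of_bool (Q g m e))"
  shows "pcomp True (\<lambda>g m e. of_bool (P g m e \<or> Q g m e))"
  using pcomp_not[OF pcomp_conj[OF assms[THEN pcomp_not]]] by (simp only: de_Morgan_conj not_not)

lemma pcomp_imp:
  assumes "pcomp True (\<lambda>g m e. of_bool (P g m e))" "pcomp True (\<lambda>g m e. of_bool (Q g m e))"
  shows "pcomp True (\<lambda>g m e. of_bool (P g m e \<longrightarrow> Q g m e))"
  unfolding imp_conv_disj by (rule pcomp_disj[OF pcomp_not[OF assms(1)] assms(2)])

lemma pcomp_eq:
  assumes "pcomp s a" "pcomp s' b" shows "pcomp True (\<lambda>g m e. of_bool (a g m e = b g m e))"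
  using pcomp_conj[OF pcomp_le[OF assms] pcomp_le[OF assms(2,1)]] by (simp only: order.eq_iff)

lemma pcomp_ex:
  assumes "pcomp True a" "pcomp True (\<lambda>g m e. of_bool (P (e 0) g m (\<lambda>i. e (Suc i))))"
  shows "pcomp True (\<lambda>g m e. of_bool (\<exists>i<a g m e. P i g m e))"
proof -
  have "pcomp True (\<lambda>g m e. of_bool (1 \<le> (\<Sum>i<a g m e. of_bool (P i g m e) :: nat)))"
    by (rule pcomp_le[OF pcomp_const[of True] pcomp_sum[where F = "\<lambda>i g m e. of_bool (P i g m e)", OF assms]])
  moreover have "1 \<le> (\<Sum>i<n. of_bool (Q i) :: nat) \<longleftrightarrow> (\<exists>i<n. Q i)" for n :: nat and Q
  proof -
    have "(\<Sum>i<n. of_bool (Q i) :: nat) = 0 \<longleftrightarrow> \<not> (\<exists>i<n. Q i)" by (subst sum_eq_0_iff) auto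
    then show ?thesis by (simp only: less_one[symmetric] not_less[symmetric] not_not)
  qed
  ultimately show ?thesis by (simp only:)
qed

lemma pcomp_all:
  assumes "pcomp True a" "pcomp True (\<lambda>g m e. of_bool (P (e 0) g m (\<lambda>i. e (Suc i))))"
  shows "pcomp True (\<lambda>g m e. of_bool (\<forall>i<a g m e. P i g m e))"
proof -
  have "pcomp True (\<lambda>g m e. of_bool (\<not> (\<exists>i<a g m e. \<not> P i g m e)))"
    by (rule pcomp_not[OF pcomp_ex[where P = "\<lambda>i g m e. \<not> P i g m e", OF assms(1) pcomp_not[OF assms(2)]]])
  moreover have "(\<not> (\<exists>i<n. \<not> Q i)) = (\<forall>i<n. Q i)" for n :: nat and Q by blast
  ultimately show ?thesis by (simp only:)
qed

text \<open>The quotient counts the positive multiples of \<open>b\<close> up to \<open>a\<close>.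
  This replaces division, which the machine lacks, by a sum with \<open>a\<close> terms; only the
  dividend has to be small, while divisors such as \<open>2 ^ (g 3 * t)\<close> need not be.\<close>

lemma div_eq_sum: "0 < b \<Longrightarrow> a div b = (\<Sum>x<a. of_bool (Suc x * b \<le> a))" for a b :: nat
proof -
  assume b: "0 < b"
  have "(\<Sum>x<a. of_bool (Suc x * b \<le> a) :: nat) = card {x. x < a \<and> Suc x * b \<le> a}"
    by (simp add: of_bool_def sum.If_cases Int_def)
  also have "{x. x < a \<and> Suc x * b \<le> a} = {..<a div b}"
  proof -
    have "Suc x * b \<le> a \<longleftrightarrow> x < a div b" for x
      using b by (simp add: less_eq_div_iff_mult_less_eq Suc_le_eq[symmetric] del: mult_Suc)
    moreover have "x < a div b \<Longrightarrow> x < a" for x using div_le_dividend[of a b] by linarith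
    ultimately show ?thesis by auto
  qed
  finally show ?thesis by simp
qed

lemma pcomp_div:
  assumes "pcomp True a" "pcomp s b" shows "pcomp True (\<lambda>g m e. a g m e div b g m e)"
proof -
  have 1: "pcomp s (\<lambda>g m e. (e 0 + 1) * b g m (\<lambda>i. e (Suc i)))"
    by (rule pcomp_mult[OF pcomp_add[OF pcomp_var pcomp_const] pcomp_shift[OF assms(2)]])
  have 2: "pcomp True (\<lambda>g m e. of_bool ((e 0 + 1) * b g m (\<lambda>i. e (Suc i)) \<le> a g m (\<lambda>i. e (Suc i))))"
    by (rule pcomp_le[OF 1 pcomp_shift[OF assms(1)]])
  have 3: "pcomp True (\<lambda>g m e. \<Sum>x<a g m e. of_bool ((x + 1) * b g m e \<le> a g m e))"
    by (rule pcomp_sum[where F = "\<lambda>x g m e. of_bool ((x + 1) * b g m e \<le> a g m e)", OF assms(1) 2])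
  \<comment> \<open>For divisor 0 all summands are 1 and the sum would be \<open>a\<close>, whereas
    HOL division gives 0.\<close>
  have 4: "pcomp True (\<lambda>g m e. if b g m e \<le> 0 then 0 else \<Sum>x<a g m e. of_bool ((x + 1) * b g m e \<le> a g m e))"
    by (rule pcomp_if[OF pcomp_le[OF assms(2) pcomp_const[of True]] pcomp_const 3])
  have "(if b g m e \<le> 0 then 0 else \<Sum>x<a g m e. of_bool ((x + 1) * b g m e \<le> a g m e)) =
      a g m e div b g m e" for g m e
    using div_eq_sum[of "b g m e" "a g m e"] by (cases "b g m e = 0") simp_all
  with 4 show ?thesis by (simp only:)
qed

lemma pcomp_mod:
  assumes "pcomp True a" "pcomp s b" shows "pcomp True (\<lambda>g m e. a g m e mod b g m e)"
proof -
  have "pcomp True (\<lambda>g m e. a g m e - a g m e div b g m e * b g m e)"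
    by (rule pcomp_diff[OF assms(1) pcomp_mult[OF pcomp_div[OF assms] assms(2)]])
  then show ?thesis by (simp only: minus_div_mult_eq_mod)
qed

section \<open>The cells of the knapsack instance as computable functions\<close>

text \<open>Parameters: \<open>g 0\<close> is the number of variables, \<open>g 1\<close> the number \<open>m\<close> of clauses, \<open>g 2 = k = 2 ^ g 3\<close> the number of
  parts, \<open>g 4 = q\<close>, \<open>g 5 = d\<close>, \<open>g 6\<close> the number of items per part, \<open>g 7 = k ^ q\<close>. Clause \<open>c\<close> belongs to the parts
  that occur among the last \<open>q\<close> digits of \<open>c\<close> in base \<open>k\<close>; when there are fewer than \<open>k ^ q\<close> clauses these digits
  are not equidistributed, and every part contains all clauses.\<close>

definition in_part :: "(nat \<Rightarrow> nat) \<Rightarrow> nat \<Rightarrow> nat \<Rightarrow> bool" where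
  "in_part g i c \<longleftrightarrow> g 1 < g 7 \<or> (\<exists>t<g 4. c div 2 ^ (g 3 * t) mod g 2 = i)"

definition in_vars :: "(nat \<Rightarrow> nat) \<Rightarrow> (nat \<Rightarrow> nat) \<Rightarrow> nat \<Rightarrow> nat \<Rightarrow> bool" where
  "in_vars g \<mu> i v \<longleftrightarrow>
    (\<exists>c<g 1. in_part g i c \<and> (\<exists>t<3. \<mu> (2 + (3 * c + t)) = 2 * v \<or> \<mu> (2 + (3 * c + t)) = 2 * v + 1))"

text \<open>Ranks renumber the variables of a part consecutively, so an assignment needs only as
  many bits as the part has variables. Using bit \<open>v\<close> for variable \<open>v\<close>
  would require about \<open>2 ^ n\<close> items per part.\<close>

definition var_rank :: "(nat \<Rightarrow> nat) \<Rightarrow> (nat \<Rightarrow> nat) \<Rightarrow> nat \<Rightarrow> nat \<Rightarrow> nat" where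
  "var_rank g \<mu> i v = (\<Sum>u<v. of_bool (in_vars g \<mu> i u))"

text \<open>Bit \<open>r\<close> of \<open>x\<close> is the value of the variable of rank \<open>r\<close> of part \<open>i\<close>.\<close>

definition assigned :: "(nat \<Rightarrow> nat) \<Rightarrow> (nat \<Rightarrow> nat) \<Rightarrow> nat \<Rightarrow> nat \<Rightarrow> nat \<Rightarrow> bool" where
  "assigned g \<mu> i x v \<longleftrightarrow> x div 2 ^ var_rank g \<mu> i v mod 2 = 1"

definition satisfies :: "(nat \<Rightarrow> nat) \<Rightarrow> (nat \<Rightarrow> nat) \<Rightarrow> nat \<Rightarrow> nat \<Rightarrow> bool" where
  "satisfies g \<mu> i x \<longleftrightarrow> (\<forall>c<g 1. in_part g i c \<longrightarrow> (\<exists>t<3. \<exists>v<g 0.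
    \<mu> (2 + (3 * c + t)) = 2 * v \<and> assigned g \<mu> i x v \<or>
    \<mu> (2 + (3 * c + t)) = 2 * v + 1 \<and> \<not> assigned g \<mu> i x v))"

definition shared_value :: "(nat \<Rightarrow> nat) \<Rightarrow> (nat \<Rightarrow> nat) \<Rightarrow> nat \<Rightarrow> nat \<Rightarrow> nat \<Rightarrow> nat" where
  "shared_value g \<mu> i j x =
    (\<Sum>v<g 0. if in_vars g \<mu> i v \<and> in_vars g \<mu> j v \<and> assigned g \<mu> i x v then 2 ^ v else 0)"

text \<open>The cost of item \<open>(i, x)\<close> in the dimension of the pair \<open>(a, b)\<close>. With budget \<open>1\<close>, dimension \<open>(a, a)\<close> admits at
  most one item of part \<open>a\<close>, and only one that satisfies its clauses. With budget \<open>2 ^ g 0\<close>, the dimensions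
  \<open>(a, b)\<close> and \<open>(b, a)\<close> force the chosen items of the two parts to agree on the common variables.\<close>

definition pair_cost :: "(nat \<Rightarrow> nat) \<Rightarrow> (nat \<Rightarrow> nat) \<Rightarrow> nat \<Rightarrow> nat \<Rightarrow> nat \<Rightarrow> nat \<Rightarrow> nat" where
  "pair_cost g \<mu> i x a b =
    (if a = b then (if i = a then (if satisfies g \<mu> i x then 1 else 2) else 0)
     else if i = a then shared_value g \<mu> i b x
     else if i = b then 2 ^ g 0 - shared_value g \<mu> i a x else 0)"

text \<open>Dimension \<open>a * k + b + 1\<close> of the instance is the pair \<open>(a, b)\<close>, and item \<open>p\<close> is \<open>(p mod k, p div k)\<close>; dimensions
  beyond \<open>k * k\<close> are unused.\<close>

definition column_cost :: "(nat \<Rightarrow> nat) \<Rightarrow> (nat \<Rightarrow> nat) \<Rightarrow> nat \<Rightarrow> nat \<Rightarrow> nat" where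
  "column_cost g \<mu> p j =
    (if j < g 2 * g 2 then pair_cost g \<mu> (p mod g 2) (p div g 2) (j div g 2) (j mod g 2) else 0)"

definition column_budget :: "(nat \<Rightarrow> nat) \<Rightarrow> nat \<Rightarrow> nat" where
  "column_budget g j = (if j div g 2 = j mod g 2 then 1 else 2 ^ g 0)"

text \<open>Random access to the list \<open>encode_knapsack\<close>: two header cells,
  \<open>g 5\<close> budgets, then one row of \<open>g 5 + 1\<close> cells per item, with the profit
  in front.\<close>

definition cell :: "(nat \<Rightarrow> nat) \<Rightarrow> (nat \<Rightarrow> nat) \<Rightarrow> nat \<Rightarrow> nat" where
  "cell g \<mu> a =
    (if a = 0 then g 2 * g 6 else if a = 1 then g 5 else if a < g 5 + 2 then column_budget g (a - 2)
     else if (a - (g 5 + 2)) mod (g 5 + 1) = 0 then 1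
     else column_cost g \<mu> ((a - (g 5 + 2)) div (g 5 + 1)) ((a - (g 5 + 2)) mod (g 5 + 1) - 1))"

lemmas pcomp_intros = pcomp_const pcomp_var pcomp_global pcomp_load pcomp_add pcomp_diff pcomp_mult
  pcomp_if pcomp_pow2 pcomp_sum pcomp_le pcomp_less pcomp_eq pcomp_not pcomp_conj pcomp_disj
  pcomp_imp pcomp_ex pcomp_all pcomp_div pcomp_mod

section \<open>Computability of the cells\<close>

lemma pcomp_in_part:
  assumes "pcomp True i" "pcomp True c"
  shows "pcomp True (\<lambda>g m e. of_bool (in_part g (i g m e) (c g m e)))"
proof -
  note shift = assms[THEN pcomp_shift]
  show ?thesis
    unfolding in_part_def by (rule pcomp_intros assms shift)+
qed

lemma pcomp_in_vars:
  assumes "pcomp True i" "pcomp True v"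
  shows "pcomp True (\<lambda>g m e. of_bool (in_vars g m (i g m e) (v g m e)))"
proof -
  note shift = assms[THEN pcomp_shift]
  note shift2 = shift[THEN pcomp_shift]
  show ?thesis
    unfolding in_vars_def by (rule pcomp_in_part pcomp_intros assms shift shift2)+
qed

lemma pcomp_var_rank:
  assumes "pcomp True i" "pcomp True v"
  shows "pcomp True (\<lambda>g m e. var_rank g m (i g m e) (v g m e))"
proof -
  note shift = assms[THEN pcomp_shift]
  show ?thesis
    unfolding var_rank_def by (rule pcomp_in_vars pcomp_intros assms shift)+
qed

lemma pcomp_assigned:
  assumes "pcomp True i" "pcomp True x" "pcomp True v"
  shows "pcomp True (\<lambda>g m e. of_bool (assigned g m (i g m e) (x g m e) (v g m e)))"
  unfolding assigned_def by (rule pcomp_var_rank pcomp_intros assms)+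

lemma pcomp_satisfies:
  assumes "pcomp True i" "pcomp True x"
  shows "pcomp True (\<lambda>g m e. of_bool (satisfies g m (i g m e) (x g m e)))"
proof -
  note shift = assms[THEN pcomp_shift]
  note shift2 = shift[THEN pcomp_shift]
  note shift3 = shift2[THEN pcomp_shift]
  show ?thesis
    unfolding satisfies_def by (rule pcomp_in_part pcomp_assigned pcomp_intros assms shift shift2 shift3)+
qed

lemma pcomp_shared_value:
  assumes "pcomp True i" "pcomp True j" "pcomp True x"
  shows "pcomp False (\<lambda>g m e. shared_value g m (i g m e) (j g m e) (x g m e))"
proof -
  note shift = assms[THEN pcomp_shift]
  show ?thesis
    unfolding shared_value_def by (rule pcomp_in_vars pcomp_assigned pcomp_intros assms shift)+
qed

lemma pcomp_pair_cost:
  assumes "pcomp True i" "pcomp True x" "pcomp True a" "pcomp True b"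
  shows "pcomp False (\<lambda>g m e. pair_cost g m (i g m e) (x g m e) (a g m e) (b g m e))"
  unfolding pair_cost_def by (rule pcomp_satisfies pcomp_shared_value pcomp_intros assms)+

lemma pcomp_column_cost:
  assumes "pcomp True p" "pcomp True j"
  shows "pcomp False (\<lambda>g m e. column_cost g m (p g m e) (j g m e))"
  unfolding column_cost_def by (rule pcomp_pair_cost pcomp_intros assms)+

lemma pcomp_column_budget:
  assumes "pcomp True j"
  shows "pcomp False (\<lambda>g m e. column_budget g (j g m e))"
  unfolding column_budget_def by (rule pcomp_intros assms)+

lemma pcomp_cell:
  assumes "pcomp True a"
  shows "pcomp False (\<lambda>g m e. cell g m (a g m e))"
  unfolding cell_def by (rule pcomp_column_cost pcomp_column_budget pcomp_intros assms)+

section \<open>Locality and size of the cells\<close>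

lemma in_vars_cong:
  assumes "\<And>a. a < 2 + 3 * g 1 \<Longrightarrow> \<mu>' a = \<mu> a" shows "in_vars g \<mu>' = in_vars g \<mu>"
  unfolding in_vars_def fun_eq_iff
  by (intro allI ex_cong1 conj_cong refl) (simp add: assms)

text \<open>Cells are computed while others are already being written; only the leading
  \<open>2 + 3 * g 1\<close> memory cells, which hold the formula, have to stay intact.\<close>

lemma cell_cong:
  assumes "\<And>a. a < 2 + 3 * g 1 \<Longrightarrow> \<mu>' a = \<mu> a" shows "cell g \<mu>' = cell g \<mu>"
proof -
  have v: "in_vars g \<mu>' = in_vars g \<mu>" using in_vars_cong assms by blast
  have a: "assigned g \<mu>' = assigned g \<mu>" unfolding assigned_def var_rank_def v ..
  have s: "satisfies g \<mu>' = satisfies g \<mu>"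
    unfolding satisfies_def a fun_eq_iff
    by (intro allI all_cong imp_cong ex_cong1 conj_cong refl) (simp add: assms)
  have "shared_value g \<mu>' = shared_value g \<mu>" unfolding shared_value_def v a ..
  then have "column_cost g \<mu>' = column_cost g \<mu>" unfolding column_cost_def pair_cost_def s by (simp only:)
  then show ?thesis unfolding cell_def by (simp only:)
qed

text \<open>Guarantees that \<open>2 ^ g 0 - shared_value ...\<close> in \<open>pair_cost\<close> is
  a genuine subtraction that is never truncated.\<close>

lemma shared_value_less: "shared_value g \<mu> i j x < 2 ^ g 0"
proof -
  have "shared_value g \<mu> i j x \<le> (\<Sum>v<g 0. 2 ^ v)" unfolding shared_value_def by (rule sum_mono) simp
  also have "(\<Sum>v<N. 2 ^ v :: nat) < 2 ^ N" for N by (induction N) simp_all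
  finally show ?thesis .
qed

lemma cell_le:
  assumes "2 \<le> W" "g 2 * g 6 \<le> W" "g 5 \<le> W" "g 0 \<le> W" shows "cell g \<mu> a \<le> 2 ^ W"
proof -
  have W: "W \<le> 2 ^ W" by (rule le_power2) simp
  have n: "(2::nat) ^ g 0 \<le> 2 ^ W" using assms by (intro power_increasing) simp_all
  have "shared_value g \<mu> i j x \<le> 2 ^ W" for i j x using shared_value_less[of g \<mu> i j x] n by linarith
  moreover have "2 ^ g 0 - shared_value g \<mu> i j x \<le> 2 ^ W" for i j x using n by linarith
  ultimately have "pair_cost g \<mu> i x a b \<le> 2 ^ W" for i x a b
    unfolding pair_cost_def using assms W by (auto intro: order_trans)
  then have "column_cost g \<mu> p j \<le> 2 ^ W" for p j unfolding column_cost_def by simp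
  moreover have "column_budget g j \<le> 2 ^ W" for j using n by (simp add: column_budget_def)
  ultimately show ?thesis unfolding cell_def using assms W by (auto intro: order_trans)
qed

section \<open>Program composition\<close>

fun regs_below :: "nat \<Rightarrow> com \<Rightarrow> bool" where
  "regs_below b Skip \<longleftrightarrow> True"
| "regs_below b (Const i k) \<longleftrightarrow> i < b"
| "regs_below b (Add i j k) \<longleftrightarrow> i < b \<and> j < b \<and> k < b"
| "regs_below b (Sub i j k) \<longleftrightarrow> i < b \<and> j < b \<and> k < b"
| "regs_below b (Load i j) \<longleftrightarrow> i < b \<and> j < b"
| "regs_below b (Store i j) \<longleftrightarrow> i < b \<and> j < b"
| "regs_below b (Seq c c') \<longleftrightarrow> regs_below b c \<and> regs_below b c'"
| "regs_below b (If i c c') \<longleftrightarrow> i < b \<and> regs_below b c \<and> regs_below b c'"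
| "regs_below b (While i c) \<longleftrightarrow> i < b \<and> regs_below b c"

lemma regs_below_mono: "regs_below b c \<Longrightarrow> b \<le> b' \<Longrightarrow> regs_below b' c"
  by (induction c) auto

lemma ex_regs_below: "\<exists>b. regs_below b c"
proof (induction c)
  case (Seq c c')
  then obtain b b' where "regs_below b c" "regs_below b' c'" by blast
  then show ?case using regs_below_mono[of _ _ "max b b'"] by (intro exI[of _ "max b b'"]) simp
next
  case (If i c c')
  then obtain b b' where "regs_below b c" "regs_below b' c'" by blast
  then show ?case using regs_below_mono[of _ _ "Suc (i + b + b')"]
    by (intro exI[of _ "Suc (i + b + b')"]) simp
next
  case (While i c)
  then obtain b where "regs_below b c" by blast
  then show ?case using regs_below_mono[of _ _ "Suc (i + b)"] by (intro exI[of _ "Suc (i + b)"]) simp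
next
  case (Add i j k)
  show ?case by (rule exI[of _ "Suc (i + j + k)"]) simp
next
  case (Sub i j k)
  show ?case by (rule exI[of _ "Suc (i + j + k)"]) simp
next
  case (Load i j)
  show ?case by (rule exI[of _ "Suc (i + j)"]) simp
next
  case (Store i j)
  show ?case by (rule exI[of _ "Suc (i + j)"]) simp
next
  case (Const i k)
  show ?case by (rule exI[of _ "Suc i"]) simp
qed simp

text \<open>A program is blind to registers it does not mention. Thus the approximation algorithm
  behaves as if started with all registers 0 although the reduction keeps its data in registers from
  \<open>b\<close> on.\<close>

lemma exec_frame:
  assumes "exec c s t s'" "regs_below b c" "\<And>x. x < b \<Longrightarrow> r x = reg s x"
  shows "exec c (r, mem s) t (\<lambda>x. if x < b then reg s' x else r x, mem s')"
  using assms
proof (induction arbitrary: r rule: exec.induct)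
  case (Skip s)
  then have "(\<lambda>x. if x < b then reg s x else r x) = r" by auto
  then show ?case using exec.Skip by simp
next
  case (Const i k r' m)
  then have "(\<lambda>x. if x < b then reg (r'(i := k), m) x else r x) = r(i := k)" by auto
  then show ?case using exec.Const by simp
next
  case (Add i j k r' m)
  then have "(\<lambda>x. if x < b then reg (r'(i := r' j + r' k), m) x else r x) = r(i := r' j + r' k)" by auto
  moreover have "r j = r' j" "r k = r' k" using Add by auto
  ultimately show ?case using exec.Add[of i j k r m] by simp
next
  case (Sub i j k r' m)
  then have "(\<lambda>x. if x < b then reg (r'(i := r' j - r' k), m) x else r x) = r(i := r' j - r' k)" by auto
  moreover have "r j = r' j" "r k = r' k" using Sub by auto
  ultimately show ?case using exec.Sub[of i j k r m] by simp
next
  case (Load i j r' m)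
  then have "(\<lambda>x. if x < b then reg (r'(i := m (r' j)), m) x else r x) = r(i := m (r' j))" by auto
  moreover have "r j = r' j" using Load by auto
  ultimately show ?case using exec.Load[of i j r m] by simp
next
  case (Store i j r' m)
  then have "(\<lambda>x. if x < b then reg (r', m(r' i := r' j)) x else r x) = r" by auto
  moreover have "r i = r' i" "r j = r' j" using Store by auto
  ultimately show ?case using exec.Store[of i j r m] by (simp add: fun_upd_def)
next
  case (Seq c1 s t1 s1 c2 t2 s2)
  let ?r = "\<lambda>x. if x < b then reg s1 x else r x"
  have "exec c1 (r, mem s) t1 (?r, mem s1)" using Seq by simp
  moreover have "exec c2 (?r, mem s1) t2 (\<lambda>x. if x < b then reg s2 x else ?r x, mem s2)"
    using Seq.prems(1) by (intro Seq.IH(2)) simp_all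
  moreover have "(\<lambda>x. if x < b then reg s2 x else ?r x) = (\<lambda>x. if x < b then reg s2 x else r x)" by auto
  ultimately show ?case using exec.Seq by simp
next
  case (IfTrue s i c1 t s1 c2)
  then have "r i = reg s i" "exec c1 (r, mem s) t (\<lambda>x. if x < b then reg s1 x else r x, mem s1)" by simp_all
  then show ?case using exec.IfTrue[of "(r, mem s)" i c1 t _ c2] IfTrue.hyps by simp
next
  case (IfFalse s i c2 t s1 c1)
  then have "r i = reg s i" "exec c2 (r, mem s) t (\<lambda>x. if x < b then reg s1 x else r x, mem s1)" by simp_all
  then show ?case using exec.IfFalse[of "(r, mem s)" i c2 t _ c1] IfFalse.hyps by simp
next
  case (WhileTrue s i c t1 s1 t2 s2)
  let ?r = "\<lambda>x. if x < b then reg s1 x else r x"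
  have i: "r i = reg s i" using WhileTrue.prems by simp
  have "exec c (r, mem s) t1 (?r, mem s1)" using WhileTrue by simp
  moreover have "exec (While i c) (?r, mem s1) t2 (\<lambda>x. if x < b then reg s2 x else ?r x, mem s2)"
    using WhileTrue.prems(1) by (intro WhileTrue.IH(2)) simp_all
  moreover have "(\<lambda>x. if x < b then reg s2 x else ?r x) = (\<lambda>x. if x < b then reg s2 x else r x)" by auto
  ultimately show ?case using exec.WhileTrue[of "(r, mem s)" i c] WhileTrue.hyps i by simp
next
  case (WhileFalse s i c)
  then have "(\<lambda>x. if x < b then reg s x else r x) = r" "r i = reg s i" by auto
  then show ?case using exec.WhileFalse[of "(r, mem s)" i c] WhileFalse.hyps by simp
qed

section \<open>Growth of numbers during a run\<close>

lemma digits_pos: "0 < digits x"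
  by (simp add: digits_def)

lemma less_two_power_digits: "x < 2 ^ digits x"
proof (cases "x = 0")
  case False
  have "x < 2 ^ floorlog 2 x" using floorlog_bounds[of x 2] False by simp
  also have "\<dots> \<le> 2 ^ digits x" by (rule power_increasing) (simp_all add: digits_def)
  finally show ?thesis .
qed simp

text \<open>Both digit counts are at least 1, so the two powers of two are at least 2 and their sum
  is at most their product. The right-hand side is exactly the charge for \<open>Add\<close>, so
  time pays for the growth of numbers.\<close>

lemma digits_add: "digits (x + y) \<le> digits x + digits y"
proof -
  obtain a b where ab: "digits x = Suc a" "digits y = Suc b"
    using digits_pos gr0_implies_Suc by metis
  have "x + y < 2 ^ Suc a + 2 ^ Suc b"
    using less_two_power_digits[of x] less_two_power_digits[of y] ab by simp
  also have "\<dots> \<le> 2 ^ Suc a * 2 ^ Suc b"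
  proof -
    have "(2::nat) \<le> 2 ^ Suc a" "(2::nat) \<le> 2 ^ Suc b" by simp_all
    moreover have "x + y \<le> x * y" if "2 \<le> x" "2 \<le> y" for x y :: nat
    proof -
      have "2 * y \<le> x * y" "2 * x \<le> x * y" using that by simp_all
      then show ?thesis by linarith
    qed
    ultimately show ?thesis by blast
  qed
  also have "\<dots> = 2 ^ (digits x + digits y)" by (simp only: ab power_add)
  finally have "x + y \<noteq> 0 \<Longrightarrow> floorlog 2 (x + y) \<le> digits x + digits y" by (intro floorlog_leI) auto
  then show ?thesis using ab by (cases "x + y = 0") (auto simp: digits_def floorlog_def)
qed

text \<open>\<open>Const\<close> takes unit time whatever its operand is, so large constants are not
  paid for by time and have to be bounded through the program text.\<close>

fun consts_le :: "nat \<Rightarrow> com \<Rightarrow> bool" where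
  "consts_le D (Const i k) \<longleftrightarrow> digits k \<le> D"
| "consts_le D (Seq c c') \<longleftrightarrow> consts_le D c \<and> consts_le D c'"
| "consts_le D (If i c c') \<longleftrightarrow> consts_le D c \<and> consts_le D c'"
| "consts_le D (While i c) \<longleftrightarrow> consts_le D c"
| "consts_le D _ \<longleftrightarrow> True"

lemma consts_le_mono: "consts_le b c \<Longrightarrow> b \<le> b' \<Longrightarrow> consts_le b' c"
  by (induction c) auto

lemma ex_consts_le: "\<exists>D. consts_le D c"
proof (induction c)
  case (Seq c c')
  then obtain b b' where "consts_le b c" "consts_le b' c'" by blast
  then show ?case using consts_le_mono[of _ _ "max b b'"] by (intro exI[of _ "max b b'"]) simp
next
  case (If i c c')
  then obtain b b' where "consts_le b c" "consts_le b' c'" by blast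
  then show ?case using consts_le_mono[of _ _ "max b b'"] by (intro exI[of _ "max b b'"]) simp
qed auto

definition digits_le :: "nat \<Rightarrow> state \<Rightarrow> bool" where
  "digits_le D s \<longleftrightarrow> (\<forall>x. digits (reg s x) \<le> D) \<and> (\<forall>a. digits (mem s a) \<le> D)"

lemma digits_le_mono: "digits_le D s \<Longrightarrow> D \<le> D' \<Longrightarrow> digits_le D' s"
  unfolding digits_le_def by (meson order_trans)

text \<open>Needed because the cells that the approximation algorithm leaves behind are read at logarithmic cost.\<close>

lemma exec_digits_le:
  assumes "exec c s t s'" "consts_le D c" "digits_le D s"
  shows "digits_le (D + t) s'"
  using assms
proof (induction arbitrary: D rule: exec.induct)
  case (Add i j k r m)
  then show ?case using digits_add[of "r j" "r k"]
    by (auto simp: digits_le_def intro: trans_le_add1 trans_le_add2)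
next
  case (Sub i j k r m)
  have "digits (r j - r k) \<le> digits (r j)" by (rule digits_mono) simp
  with Sub show ?case by (auto simp: digits_le_def intro: trans_le_add1 order_trans)
next
  case (Seq c1 s t1 s1 c2 t2 s2)
  have "digits_le (D + t1) s1" using Seq by simp
  moreover have "consts_le (D + t1) c2" using Seq.prems by (simp add: consts_le_mono[of D])
  ultimately have "digits_le (D + t1 + t2) s2" by (rule Seq.IH(2)[rotated])
  then show ?case by (simp add: add.assoc)
next
  case (WhileTrue s i c t1 s1 t2 s2)
  have "digits_le (D + t1) s1" using WhileTrue by simp
  moreover have "consts_le (D + t1) (While i c)" using WhileTrue.prems by (simp add: consts_le_mono[of D])
  ultimately have "digits_le (D + t1 + t2) s2" by (rule WhileTrue.IH(2)[rotated])
  then show ?case by (rule digits_le_mono) simp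
next
  case (IfTrue s i c1 t s1 c2)
  then have "digits_le (D + t) s1" by simp
  then show ?case by (rule digits_le_mono) simp
next
  case (IfFalse s i c2 t s1 c1)
  then have "digits_le (D + t) s1" by simp
  then show ?case by (rule digits_le_mono) simp
qed (auto simp: digits_le_def intro: trans_le_add1 le_SucI)

text \<open>Registers from \<open>t\<close> on are unspecified before and after the run.\<close>

definition runs :: "nat \<Rightarrow> com \<Rightarrow> nat \<Rightarrow> state \<Rightarrow> state \<Rightarrow> bool" where
  "runs t c T s s' \<longleftrightarrow> (\<forall>r. (\<forall>y<t. r y = reg s y) \<longrightarrow>
    (\<exists>T' r'. exec c (r, mem s) T' (r', mem s') \<and> T' \<le> T \<and> (\<forall>y<t. r' y = reg s' y)))"

section \<open>Runs up to scratch registers\<close>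

lemma runsI:
  assumes "\<And>r. (\<And>y. y < t \<Longrightarrow> r y = reg s y) \<Longrightarrow>
    \<exists>T' r'. exec c (r, mem s) T' (r', mem s') \<and> T' \<le> T \<and> (\<forall>y<t. r' y = reg s' y)"
  shows "runs t c T s s'"
  using assms unfolding runs_def by simp

lemma runsE:
  assumes "runs t c T s s'" "\<And>y. y < t \<Longrightarrow> r y = reg s y"
  obtains T' r' where "exec c (r, mem s) T' (r', mem s')" "T' \<le> T" "\<And>y. y < t \<Longrightarrow> r' y = reg s' y"
proof -
  have "\<exists>T' r'. exec c (r, mem s) T' (r', mem s') \<and> T' \<le> T \<and> (\<forall>y<t. r' y = reg s' y)"
    using assms unfolding runs_def by simp
  then show ?thesis by (elim exE conjE) (rule that, assumption, assumption, simp)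
qed

lemma runs_seq:
  assumes "runs t c1 T1 s s1" "runs t c2 T2 s1 s2"
  shows "runs t (Seq c1 c2) (T1 + T2) s s2"
proof (rule runsI)
  fix r assume r: "\<And>y. y < t \<Longrightarrow> r y = reg s y"
  obtain A r1 where 1: "exec c1 (r, mem s) A (r1, mem s1)" "A \<le> T1" "\<And>y. y < t \<Longrightarrow> r1 y = reg s1 y"
    by (rule runsE[OF assms(1) r]) simp_all
  obtain B r2 where 2: "exec c2 (r1, mem s1) B (r2, mem s2)" "B \<le> T2" "\<And>y. y < t \<Longrightarrow> r2 y = reg s2 y"
    by (rule runsE[OF assms(2) 1(3)]) simp_all
  show "\<exists>T' r'. exec (Seq c1 c2) (r, mem s) T' (r', mem s2) \<and> T' \<le> T1 + T2 \<and> (\<forall>y<t. r' y = reg s2 y)"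
    using exec.Seq[OF 1(1) 2(1)] 1(2) 2(2,3) by (intro exI[of _ "A + B"] exI[of _ r2]) simp
qed

lemma runs_mono: "runs t c T s s' \<Longrightarrow> T \<le> T' \<Longrightarrow> runs t c T' s s'"
  unfolding runs_def by (meson order_trans)

lemma runs_const: "runs t (Const x k) 1 (\<rho>, m) (\<rho>(x := k), m)"
proof (rule runsI)
  fix r assume "\<And>y. y < t \<Longrightarrow> r y = reg (\<rho>, m) y"
  then show "\<exists>T' r'. exec (Const x k) (r, mem (\<rho>, m)) T' (r', mem (\<rho>(x := k), m)) \<and> T' \<le> 1 \<and>
      (\<forall>y<t. r' y = reg (\<rho>(x := k), m) y)"
    using exec.Const[of x k r m] by (intro exI[of _ 1] exI[of _ "r(x := k)"]) simp
qed

lemma runs_eval: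
  assumes c: "evaluates p gs vs t c f" and x: "x < t"
    and lt: "\<And>i. gs i < t" "\<And>i. vs i < t"
    and v: "valid W (\<lambda>i. \<rho> (gs i)) m (\<lambda>i. \<rho> (vs i))"
    and bf: "f (\<lambda>i. \<rho> (gs i)) m (\<lambda>i. \<rho> (vs i)) \<le> 2 ^ p W"
  shows "runs t (Seq c (Seq (Const x 0) (Add x x t))) (2 * p W + 3) (\<rho>, m)
    (\<rho>(x := f (\<lambda>i. \<rho> (gs i)) m (\<lambda>i. \<rho> (vs i))), m)"
proof (rule runsI)
  fix r assume "\<And>y. y < t \<Longrightarrow> r y = reg (\<rho>, m) y"
  then have r: "\<And>y. y < t \<Longrightarrow> r y = \<rho> y" by simp
  let ?f = "f (\<lambda>i. \<rho> (gs i)) m (\<lambda>i. \<rho> (vs i))"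
  have eq: "(\<lambda>i. r (gs i)) = (\<lambda>i. \<rho> (gs i))" "(\<lambda>i. r (vs i)) = (\<lambda>i. \<rho> (vs i))" using r lt by auto
  have v': "valid W (\<lambda>i. r (gs i)) m (\<lambda>i. r (vs i))" using v eq by simp
  obtain T r' where 1: "exec c (r, m) T (r', m)" "T \<le> p W" "r' t = ?f" "\<And>y. y < t \<Longrightarrow> r' y = r y"
    by (rule evaluatesE[OF c v']) (simp add: eq)
  have "exec (Add x x t) (r'(x := 0), m) (digits 0 + digits ?f) (r'(x := ?f), m)"
    using exec.Add[of x x t "r'(x := 0)" m] 1(3) x by simp
  then have "exec (Seq c (Seq (Const x 0) (Add x x t))) (r, m) (T + (1 + (digits 0 + digits ?f))) (r'(x := ?f), m)"
    by (intro exec.Seq[OF 1(1)] exec.Seq[OF exec.Const])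
  moreover have "digits ?f \<le> p W + 1" by (rule digits_le_power[OF bf])
  ultimately show "\<exists>T' r'. exec (Seq c (Seq (Const x 0) (Add x x t))) (r, mem (\<rho>, m)) T' (r', mem (\<rho>(x := ?f), m)) \<and>
      T' \<le> 2 * p W + 3 \<and> (\<forall>y<t. r' y = reg (\<rho>(x := ?f), m) y)"
    using 1(2,4) r by (intro exI[of _ "T + (1 + (digits 0 + digits ?f))"] exI[of _ "r'(x := ?f)"]) simp
qed

text \<open>The invariant is a family of complete states, one per counter value;
  \<open>t \<le> z\<close> makes the register holding 1 scratch space.\<close>

lemma runs_loop:
  assumes x: "x < t" "t \<le> z" and \<sigma>: "\<And>j. reg (\<sigma> j) x = j"
    and body: "\<And>j. j < n \<Longrightarrow> runs t c B ((reg (\<sigma> (Suc j)))(x := j), mem (\<sigma> (Suc j))) (\<sigma> j)"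
  shows "runs t (loop x z c) (n * (B + 2 * n + 6) + 1) (\<sigma> n) (\<sigma> 0)"
proof (rule runsI)
  fix r assume r: "\<And>y. y < t \<Longrightarrow> r y = reg (\<sigma> n) y"
  let ?I = "\<lambda>j s. (\<forall>y<t. reg s y = reg (\<sigma> j) y) \<and> mem s = mem (\<sigma> j)"
  have "\<exists>T s'. exec (loop x z c) (r, mem (\<sigma> n)) T s' \<and> ?I 0 s' \<and> T \<le> n * (B + 2 * n + 6) + 1"
  proof (rule exec_loop[where I = ?I and B = B])
    show "?I n (r, mem (\<sigma> n))" using r by simp
    show "reg s x = j" if "?I j s" for j s using that x \<sigma>[of j] by simp
    show "x \<noteq> z" using x by simp
    show "\<exists>T s'. exec c (r'(z := 1, x := j), m) T s' \<and> T \<le> B \<and> ?I j s'"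
      if j: "j < n" and I: "?I (Suc j) (r', m)" for j r' m
    proof -
      have "y < t \<Longrightarrow> (r'(z := 1, x := j)) y = reg ((reg (\<sigma> (Suc j)))(x := j), mem (\<sigma> (Suc j))) y" for y
        using I x by simp
      from runsE[OF body[OF j] this]
      obtain T r2 where "exec c (r'(z := 1, x := j), mem (\<sigma> (Suc j))) T (r2, mem (\<sigma> j))" "T \<le> B"
        "\<And>y. y < t \<Longrightarrow> r2 y = reg (\<sigma> j) y"
        by (metis (no_types, lifting) snd_conv)
      then show ?thesis using I by (intro exI[of _ T] exI[of _ "(r2, mem (\<sigma> j))"]) simp
    qed
  qed
  then obtain T where "\<exists>s'. exec (loop x z c) (r, mem (\<sigma> n)) T s' \<and> ?I 0 s' \<and> T \<le> n * (B + 2 * n + 6) + 1" ..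
  then obtain s' where s: "exec (loop x z c) (r, mem (\<sigma> n)) T s' \<and> ?I 0 s' \<and> T \<le> n * (B + 2 * n + 6) + 1" ..
  then show "\<exists>T' r'. exec (loop x z c) (r, mem (\<sigma> n)) T' (r', mem (\<sigma> 0)) \<and> T' \<le> n * (B + 2 * n + 6) + 1 \<and>
      (\<forall>y<t. r' y = reg (\<sigma> 0) y)"
    by (intro exI[of _ T] exI[of _ "reg s'"]) (metis prod.collapse)
qed

lemma runs_frame:
  assumes "exec A (\<lambda>_. 0, m) T s'" "regs_below b A" "b \<le> t" "\<And>y. y < b \<Longrightarrow> \<rho> y = 0"
  shows "runs t A T (\<rho>, m) (\<lambda>y. if y < b then reg s' y else \<rho> y, mem s')"
proof (rule runsI)
  fix r assume "\<And>y. y < t \<Longrightarrow> r y = reg (\<rho>, m) y"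
  then have r: "\<And>y. y < t \<Longrightarrow> r y = \<rho> y" by simp
  have "exec A (r, mem (\<lambda>_. 0, m)) T (\<lambda>x. if x < b then reg s' x else r x, mem s')"
    by (rule exec_frame[OF assms(1,2)]) (use assms(3,4) r in simp)
  then show "\<exists>T' r'. exec A (r, mem (\<rho>, m)) T' (r', mem (\<lambda>y. if y < b then reg s' y else \<rho> y, mem s')) \<and>
      T' \<le> T \<and> (\<forall>y<t. r' y = reg (\<lambda>y. if y < b then reg s' y else \<rho> y, mem s') y)"
    using r by (intro exI[of _ T] exI[of _ "\<lambda>x. if x < b then reg s' x else r x"]) simp
qed

lemma runs_store:
  assumes c: "evaluates p gs vs t c f" and x: "x < t" "u < t"
    and lt: "\<And>i. gs i < t" "\<And>i. vs i < t"
    and v: "valid W (\<lambda>i. \<rho> (gs i)) m (\<lambda>i. \<rho> (vs i))"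
    and bf: "f (\<lambda>i. \<rho> (gs i)) m (\<lambda>i. \<rho> (vs i)) \<le> 2 ^ p W" and W: "\<rho> u \<le> W" "\<rho> x \<le> W"
  shows "runs t (Seq c (Seq (Add (Suc t) u x) (Store (Suc t) t))) (2 * p W + 4 * W + 4) (\<rho>, m)
    (\<rho>, m(\<rho> u + \<rho> x := f (\<lambda>i. \<rho> (gs i)) m (\<lambda>i. \<rho> (vs i))))"
proof (rule runsI)
  fix r assume "\<And>y. y < t \<Longrightarrow> r y = reg (\<rho>, m) y"
  then have r: "\<And>y. y < t \<Longrightarrow> r y = \<rho> y" by simp
  let ?f = "f (\<lambda>i. \<rho> (gs i)) m (\<lambda>i. \<rho> (vs i))"
  let ?m = "m(\<rho> u + \<rho> x := ?f)"
  have eq: "(\<lambda>i. r (gs i)) = (\<lambda>i. \<rho> (gs i))" "(\<lambda>i. r (vs i)) = (\<lambda>i. \<rho> (vs i))" using r lt by auto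
  have v': "valid W (\<lambda>i. r (gs i)) m (\<lambda>i. r (vs i))" using v eq by simp
  obtain T r' where 1: "exec c (r, m) T (r', m)" "T \<le> p W" "r' t = ?f" "\<And>y. y < t \<Longrightarrow> r' y = r y"
    by (rule evaluatesE[OF c v']) (simp add: eq)
  let ?r = "r'(Suc t := \<rho> u + \<rho> x)"
  have ux: "r' u = \<rho> u" "r' x = \<rho> x" using 1(4) r x by simp_all
  have 2: "exec (Add (Suc t) u x) (r', m) (digits (\<rho> u) + digits (\<rho> x)) (?r, m)"
    using exec.Add[of "Suc t" u x r' m] ux by simp
  have 3: "exec (Store (Suc t) t) (?r, m) (digits (\<rho> u + \<rho> x) + digits ?f) (?r, ?m)"
    using exec.Store[of "Suc t" t ?r m] 1(3) by (simp add: fun_upd_def)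
  let ?T = "T + (digits (\<rho> u) + digits (\<rho> x) + (digits (\<rho> u + \<rho> x) + digits ?f))"
  have e: "exec (Seq c (Seq (Add (Suc t) u x) (Store (Suc t) t))) (r, m) ?T (?r, ?m)"
    by (rule exec.Seq[OF 1(1) exec.Seq[OF 2 3]])
  have "digits ?f \<le> p W + 1" by (rule digits_le_power[OF bf])
  then have T: "?T \<le> 2 * p W + 4 * W + 4"
    using 1(2) W digits_le_Suc[of "\<rho> u"] digits_le_Suc[of "\<rho> x"] digits_le_Suc[of "\<rho> u + \<rho> x"] by linarith
  have "\<forall>y<t. ?r y = \<rho> y" using 1(4) r by simp
  then show "\<exists>T' r'. exec (Seq c (Seq (Add (Suc t) u x) (Store (Suc t) t))) (r, mem (\<rho>, m)) T' (r', mem (\<rho>, ?m)) \<and>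
      T' \<le> 2 * p W + 4 * W + 4 \<and> (\<forall>y<t. r' y = reg (\<rho>, ?m) y)"
    using e T by (intro exI[of _ ?T] exI[of _ ?r]) simp
qed

text \<open>Registers below \<open>b\<close> are left to the approximation algorithm. The parameters are in \<open>b\<close>, ..., \<open>b + 7\<close>, the
  loop variable is in \<open>b + 8\<close>, derived quantities and the final count are in \<open>b + 9\<close>, ..., \<open>b + 12\<close>.\<close>

abbreviation base_regs :: "nat \<Rightarrow> nat \<Rightarrow> nat" where "base_regs b i \<equiv> b + min i 7"

lemma choice2:
  assumes "\<And>b x. P b x \<Longrightarrow> \<exists>c. Q b x c" shows "\<exists>C. \<forall>b x. P b x \<longrightarrow> Q b x (C b x)"
  using assms by metis

text \<open>\<open>b\<close> depends on the approximation algorithm, so the polynomial precedes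
  \<open>b\<close>. All de Bruijn indices read the same register, since there is a single loop
  variable at this level.\<close>

definition assigner :: "fn \<Rightarrow> (nat \<Rightarrow> nat) \<Rightarrow> (nat \<Rightarrow> nat \<Rightarrow> com) \<Rightarrow> bool" where
  "assigner f p C \<longleftrightarrow> polyb p \<and> (\<forall>b x. x < b + 13 \<longrightarrow> (\<forall>W \<rho> m.
    2 \<le> W \<and> (\<forall>y. \<rho> y \<le> W) \<and> (\<forall>a. m a \<le> 2 ^ W) \<longrightarrow>
    runs (b + 13) (C b x) (p W) (\<rho>, m) (\<rho>(x := f (\<lambda>i. \<rho> (base_regs b i)) m (\<lambda>_. \<rho> (b + 8))), m)))"

lemma assigner_polyb: "assigner f p C \<Longrightarrow> polyb p"
  unfolding assigner_def by (rule conjunct1)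

lemma assigner_runs:
  assumes "assigner f p C" "x < b + 13" "2 \<le> W \<and> (\<forall>y. \<rho> y \<le> W) \<and> (\<forall>a. m a \<le> 2 ^ W)"
  shows "runs (b + 13) (C b x) (p W) (\<rho>, m) (\<rho>(x := f (\<lambda>i. \<rho> (base_regs b i)) m (\<lambda>_. \<rho> (b + 8))), m)"
  using assms(1)[unfolded assigner_def, THEN conjunct2, rule_format, OF assms(2,3)] .

lemma pcomp_assign:
  assumes "pcomp s f"
  shows "\<exists>p C. assigner f p C"
proof -
  obtain p where p: "pcomp_witness s f p" using assms unfolding pcomp_def ..
  show ?thesis
    unfolding assigner_def
  proof (rule exI[of _ "\<lambda>W. 2 * p W + 3"], subst ex_simps(2), rule conjI, goal_cases)
    case 1
    show "polyb (\<lambda>W. 2 * p W + 3)" by (intro polyb_intros pcompD_polyb[OF p])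
  next
    case 2
    show ?case
    proof (rule choice2)
      fix b x :: nat assume x: "x < b + 13"
      have lt: "\<And>i. base_regs b i < b + 13" "\<And>i. b + 8 < b + 13" by simp_all
      have "\<exists>c. evaluates p (base_regs b) (\<lambda>_. b + 8) (b + 13) c f"
        by (rule pcompD_eval[OF p]) simp_all
      then obtain c where c: "evaluates p (base_regs b) (\<lambda>_. b + 8) (b + 13) c f" ..
      show "\<exists>c. \<forall>W \<rho> m. 2 \<le> W \<and> (\<forall>y. \<rho> y \<le> W) \<and> (\<forall>a. m a \<le> 2 ^ W) \<longrightarrow>
        runs (b + 13) c (2 * p W + 3) (\<rho>, m) (\<rho>(x := f (\<lambda>i. \<rho> (base_regs b i)) m (\<lambda>_. \<rho> (b + 8))), m)"
      proof (rule exI[of _ "Seq c (Seq (Const x 0) (Add x x (b + 13)))"], intro allI impI)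
        fix W and \<rho> m :: "nat \<Rightarrow> nat"
        assume "2 \<le> W \<and> (\<forall>y. \<rho> y \<le> W) \<and> (\<forall>a. m a \<le> 2 ^ W)"
        then have v: "valid W (\<lambda>i. \<rho> (base_regs b i)) m (\<lambda>_. \<rho> (b + 8))" unfolding valid_def by simp
        show "runs (b + 13) (Seq c (Seq (Const x 0) (Add x x (b + 13)))) (2 * p W + 3) (\<rho>, m)
            (\<rho>(x := f (\<lambda>i. \<rho> (base_regs b i)) m (\<lambda>_. \<rho> (b + 8))), m)"
          by (rule runs_eval[where \<rho> = \<rho> and m = m, OF c x lt v pcompD_big[OF p v]])
      qed
    qed
  qed
qed

text \<open>The memory in the middle of a downward loop: of the array \<open>F\<close> of length
  \<open>n\<close> at address \<open>u\<close>, only the entries from \<open>j\<close> on have been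
  written.\<close>

definition filled :: "nat \<Rightarrow> nat \<Rightarrow> nat \<Rightarrow> (nat \<Rightarrow> nat) \<Rightarrow> (nat \<Rightarrow> nat) \<Rightarrow> nat \<Rightarrow> nat" where
  "filled u j n F m = (\<lambda>a. if u + j \<le> a \<and> a < u + n then F (a - u) else m a)"

text \<open>Entry \<open>j\<close> is evaluated in the partially overwritten memory; the last
  premise requires that this still gives the intended value \<open>F j\<close>.\<close>

definition filler :: "fn \<Rightarrow> (nat \<Rightarrow> nat) \<Rightarrow> (nat \<Rightarrow> nat \<Rightarrow> com) \<Rightarrow> bool" where
  "filler f p C \<longleftrightarrow> polyb p \<and> (\<forall>b u. u < b + 13 \<and> u \<noteq> b + 8 \<longrightarrow> (\<forall>W \<rho> m n F.
    2 \<le> W \<and> (\<forall>y. \<rho> y \<le> W) \<and> (\<forall>a. m a \<le> 2 ^ W) \<and> n \<le> W \<and> (\<forall>j<n. F j \<le> 2 ^ W) \<and>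
    (\<forall>j<n. f (\<lambda>i. \<rho> (base_regs b i)) (filled (\<rho> u) (Suc j) n F m) (\<lambda>_. j) = F j) \<longrightarrow>
    runs (b + 13) (C b u) (p W) (\<rho>(b + 8 := n), m) (\<rho>(b + 8 := 0), filled (\<rho> u) 0 n F m)))"

lemma filler_polyb: "filler f p C \<Longrightarrow> polyb p"
  unfolding filler_def by (rule conjunct1)

lemma filler_runs:
  assumes "filler f p C" "u < b + 13 \<and> u \<noteq> b + 8"
    "2 \<le> W \<and> (\<forall>y. \<rho> y \<le> W) \<and> (\<forall>a. m a \<le> 2 ^ W) \<and> n \<le> W \<and> (\<forall>j<n. F j \<le> 2 ^ W) \<and>
    (\<forall>j<n. f (\<lambda>i. \<rho> (base_regs b i)) (filled (\<rho> u) (Suc j) n F m) (\<lambda>_. j) = F j)"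
  shows "runs (b + 13) (C b u) (p W) (\<rho>(b + 8 := n), m) (\<rho>(b + 8 := 0), filled (\<rho> u) 0 n F m)"
  using assms(1)[unfolded filler_def, THEN conjunct2, rule_format, OF assms(2,3)] .

lemma pcomp_fill:
  assumes "pcomp s f"
  shows "\<exists>p C. filler f p C"
proof -
  obtain p where p: "pcomp_witness s f p" using assms unfolding pcomp_def ..
  let ?p = "\<lambda>W. W * ((2 * p W + 4 * W + 4) + 2 * W + 6) + 1"
  show ?thesis
    unfolding filler_def
  proof (rule exI[of _ ?p], subst ex_simps(2), rule conjI, goal_cases)
    case 1
    show "polyb ?p" by (intro polyb_intros pcompD_polyb[OF p])
  next
    case 2
    show ?case
    proof (rule choice2)
      fix b u :: nat assume u: "u < b + 13 \<and> u \<noteq> b + 8"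
      have lt: "\<And>i. base_regs b i < b + 13" "\<And>i. b + 8 < b + 13" by simp_all
      have "\<exists>c. evaluates p (base_regs b) (\<lambda>_. b + 8) (b + 13) c f"
        by (rule pcompD_eval[OF p]) simp_all
      then obtain c where c: "evaluates p (base_regs b) (\<lambda>_. b + 8) (b + 13) c f" ..
      let ?c = "Seq c (Seq (Add (Suc (b + 13)) u (b + 8)) (Store (Suc (b + 13)) (b + 13)))"
      show "\<exists>c. \<forall>W \<rho> m n F.
        2 \<le> W \<and> (\<forall>y. \<rho> y \<le> W) \<and> (\<forall>a. m a \<le> 2 ^ W) \<and> n \<le> W \<and> (\<forall>j<n. F j \<le> 2 ^ W) \<and>
        (\<forall>j<n. f (\<lambda>i. \<rho> (base_regs b i)) (filled (\<rho> u) (Suc j) n F m) (\<lambda>_. j) = F j) \<longrightarrow>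
        runs (b + 13) c (?p W) (\<rho>(b + 8 := n), m) (\<rho>(b + 8 := 0), filled (\<rho> u) 0 n F m)"
      proof (rule exI[of _ "loop (b + 8) (b + 13) ?c"], intro allI impI)
        fix W n and \<rho> m F :: "nat \<Rightarrow> nat"
        assume A: "2 \<le> W \<and> (\<forall>y. \<rho> y \<le> W) \<and> (\<forall>a. m a \<le> 2 ^ W) \<and> n \<le> W \<and> (\<forall>j<n. F j \<le> 2 ^ W) \<and>
          (\<forall>j<n. f (\<lambda>i. \<rho> (base_regs b i)) (filled (\<rho> u) (Suc j) n F m) (\<lambda>_. j) = F j)"
        define \<sigma> where "\<sigma> j = (\<rho>(b + 8 := j), filled (\<rho> u) j n F m)" for j
        let ?B = "2 * p W + 4 * W + 4"
        have l: "runs (b + 13) (loop (b + 8) (b + 13) ?c) (n * (?B + 2 * n + 6) + 1) (\<sigma> n) (\<sigma> 0)"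
        proof (rule runs_loop)
          show "b + 8 < b + 13" "b + 13 \<le> b + 13" "reg (\<sigma> j) (b + 8) = j" for j by (simp_all add: \<sigma>_def)
          fix j assume j: "j < n"
          let ?\<rho> = "\<rho>(b + 8 := j)" and ?m = "filled (\<rho> u) (Suc j) n F m"
          \<comment> \<open>The loop register is none of the parameter registers, so counting does
            not change the parameters.\<close>
          have "min i 7 \<noteq> 8" for i :: nat by linarith
          then have g: "(\<lambda>i. ?\<rho> (base_regs b i)) = (\<lambda>i. \<rho> (base_regs b i))" by simp
          have "valid W (\<lambda>i. \<rho> (base_regs b i)) ?m (\<lambda>_. j)"
            using A j by (auto simp: valid_def filled_def)
          then have v: "valid W (\<lambda>i. ?\<rho> (base_regs b i)) ?m (\<lambda>_. ?\<rho> (b + 8))" unfolding g by simp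
          have fj: "f (\<lambda>i. ?\<rho> (base_regs b i)) ?m (\<lambda>_. ?\<rho> (b + 8)) = F j" unfolding g using A j by simp
          have "?\<rho> u \<le> W" "?\<rho> (b + 8) \<le> W" using A j u by simp_all
          from runs_store[where \<rho> = ?\<rho> and m = ?m, OF c lt(2) conjunct1[OF u] lt v pcompD_big[OF p v] this]
          have "runs (b + 13) ?c ?B (?\<rho>, ?m) (?\<rho>, ?m(\<rho> u + j := F j))"
            unfolding fj using u by simp
          moreover have "?m(\<rho> u + j := F j) = filled (\<rho> u) j n F m" using j by (auto simp: filled_def)
          ultimately show "runs (b + 13) ?c ?B ((reg (\<sigma> (Suc j)))(b + 8 := j), mem (\<sigma> (Suc j))) (\<sigma> j)"
            by (simp add: \<sigma>_def)
        qed
        have le: "n * (?B + 2 * n + 6) + 1 \<le> ?p W" using A by (intro add_mono mult_le_mono) auto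
        have "filled (\<rho> u) n n F m = m" by (auto simp: filled_def)
        with runs_mono[OF l le] show "runs (b + 13) (loop (b + 8) (b + 13) ?c) (?p W) (\<rho>(b + 8 := n), m)
            (\<rho>(b + 8 := 0), filled (\<rho> u) 0 n F m)"
          by (simp only: \<sigma>_def)
      qed
    qed
  qed
qed

text \<open>The cells left by the approximation algorithm are arbitrary numbers; \<open>D\<close>
  bounds the charge for loading and testing them.\<close>

lemma runs_count:
  assumes D: "\<And>a. digits (m a) \<le> D" and W: "N \<le> W" and b: "\<rho> (b + 12) = 0"
  shows "runs (b + 13) (loop (b + 8) (b + 13) (Seq (Load (b + 13) (b + 8))
      (If (b + 13) (Seq (Const (b + 13) 1) (Add (b + 12) (b + 12) (b + 13))) Skip)))
    (W * ((2 * D + 2 * W + 4) + 2 * W + 6) + 1) (\<rho>(b + 8 := N), m)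
    (\<rho>(b + 8 := 0, b + 12 := card {i. i < N \<and> m i \<noteq> 0}), m)" (is "runs _ (loop _ _ ?c) _ _ _")
proof -
  let ?n = "\<lambda>j. card {i. j \<le> i \<and> i < N \<and> m i \<noteq> 0}"
  define \<sigma> where "\<sigma> j = (\<rho>(b + 8 := j, b + 12 := ?n j), m)" for j
  let ?B = "2 * D + 2 * W + 4"
  have l: "runs (b + 13) (loop (b + 8) (b + 13) ?c) (N * (?B + 2 * N + 6) + 1) (\<sigma> N) (\<sigma> 0)"
  proof (rule runs_loop)
    show "b + 8 < b + 13" "b + 13 \<le> b + 13" "reg (\<sigma> j) (b + 8) = j" for j by (simp_all add: \<sigma>_def)
    fix j assume j: "j < N"
    show "runs (b + 13) ?c ?B ((reg (\<sigma> (Suc j)))(b + 8 := j), mem (\<sigma> (Suc j))) (\<sigma> j)"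
    proof (rule runsI)
      fix r assume "\<And>y. y < b + 13 \<Longrightarrow> r y = reg ((reg (\<sigma> (Suc j)))(b + 8 := j), mem (\<sigma> (Suc j))) y"
      then have r: "\<And>y. y < b + 13 \<Longrightarrow> r y = (\<rho>(b + 8 := j, b + 12 := ?n (Suc j))) y"
        by (simp add: \<sigma>_def fun_upd_twist)
      have r8: "r (b + 8) = j" and r12: "r (b + 12) = ?n (Suc j)" using r by simp_all
      let ?r = "r(b + 13 := m j)"
      have 1: "exec (Load (b + 13) (b + 8)) (r, m) (digits j + digits (m j)) (?r, m)"
        using exec.Load[of "b + 13" "b + 8" r m] r8 by simp
      have dj: "digits j \<le> W + 1" using digits_le_Suc[of j] j W by simp
      have set: "{i. j \<le> i \<and> i < N \<and> m i \<noteq> 0} =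
          (if m j = 0 then {i. Suc j \<le> i \<and> i < N \<and> m i \<noteq> 0} else insert j {i. Suc j \<le> i \<and> i < N \<and> m i \<noteq> 0})"
        using j by (auto simp: Suc_le_eq le_less)
      show "\<exists>T' r'. exec ?c (r, mem ((reg (\<sigma> (Suc j)))(b + 8 := j), mem (\<sigma> (Suc j)))) T' (r', mem (\<sigma> j)) \<and>
          T' \<le> ?B \<and> (\<forall>y<b + 13. r' y = reg (\<sigma> j) y)"
      proof (cases "m j = 0")
        case True
        have "exec (If (b + 13) (Seq (Const (b + 13) 1) (Add (b + 12) (b + 12) (b + 13))) Skip) (?r, m)
            (digits (m j) + 1) (?r, m)"
          using exec.IfFalse[of "(?r, m)" "b + 13" Skip 1 "(?r, m)"] exec.Skip True by simp
        then have "exec ?c (r, m) (digits j + digits (m j) + (digits (m j) + 1)) (?r, m)"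
          by (rule exec.Seq[OF 1])
        moreover have "digits j + digits (m j) + (digits (m j) + 1) \<le> ?B" using dj D[of j] by linarith
        moreover have "\<forall>y<b + 13. ?r y = (\<rho>(b + 8 := j, b + 12 := ?n j)) y" using r set True by simp
        ultimately show ?thesis unfolding \<sigma>_def
          by (intro exI[of _ "digits j + digits (m j) + (digits (m j) + 1)"] exI[of _ ?r]) simp
      next
        case False
        let ?k = "?n (Suc j)"
        have k: "?k \<le> W"
        proof -
          have "?k \<le> card {..<N}" by (rule card_mono) auto
          then show ?thesis using W by simp
        qed
        let ?r' = "r(b + 13 := 1, b + 12 := ?k + 1)"
        have "exec (Add (b + 12) (b + 12) (b + 13)) (r(b + 13 := 1), m) (digits ?k + digits 1) (?r', m)"
          using exec.Add[of "b + 12" "b + 12" "b + 13" "r(b + 13 := 1)" m] r12 by simp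
        then have "exec (Seq (Const (b + 13) 1) (Add (b + 12) (b + 12) (b + 13))) (?r, m)
            (1 + (digits ?k + digits 1)) (?r', m)"
          using exec.Seq[OF exec.Const[of "b + 13" 1 ?r m]] by simp
        then have "exec (If (b + 13) (Seq (Const (b + 13) 1) (Add (b + 12) (b + 12) (b + 13))) Skip) (?r, m)
            (digits (m j) + (1 + (digits ?k + digits 1))) (?r', m)"
          using exec.IfTrue[of "(?r, m)" "b + 13" "Seq (Const (b + 13) 1) (Add (b + 12) (b + 12) (b + 13))" "1 + (digits ?k + digits 1)" "(?r', m)" Skip] False by simp
        then have "exec ?c (r, m) (digits j + digits (m j) + (digits (m j) + (1 + (digits ?k + digits 1)))) (?r', m)"
          by (rule exec.Seq[OF 1])
        moreover have "digits j + digits (m j) + (digits (m j) + (1 + (digits ?k + digits 1))) \<le> ?B"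
          using dj D[of j] digits_le_Suc[of ?k] k by simp
        moreover have "\<forall>y<b + 13. ?r' y = (\<rho>(b + 8 := j, b + 12 := ?n j)) y"
        proof -
          have "?n j = ?k + 1" using set False by simp
          then show ?thesis using r by simp
        qed
        ultimately show ?thesis unfolding \<sigma>_def
          by (intro exI[of _ "digits j + digits (m j) + (digits (m j) + (1 + (digits ?k + digits 1)))"] exI[of _ ?r']) simp
      qed
    qed
  qed
  have le: "N * (?B + 2 * N + 6) + 1 \<le> W * (?B + 2 * W + 6) + 1"
    using W by (intro add_mono mult_le_mono) auto
  have "\<sigma> N = (\<rho>(b + 8 := N), m)"
  proof -
    have "?n N = 0" by simp
    moreover have "(\<rho>(b + 8 := N))(b + 12 := 0) = \<rho>(b + 8 := N)" using b by (intro fun_upd_idem) simp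
    ultimately show ?thesis unfolding \<sigma>_def by (simp only:)
  qed
  moreover have "\<sigma> 0 = (\<rho>(b + 8 := 0, b + 12 := card {i. i < N \<and> m i \<noteq> 0}), m)" by (simp add: \<sigma>_def)
  ultimately show ?thesis using runs_mono[OF l le] by (simp only:)
qed

section \<open>The program of the reduction\<close>

definition num_items :: "(nat \<Rightarrow> nat) \<Rightarrow> nat" where
  "num_items g = g 2 * g 6"

definition enc_len :: "(nat \<Rightarrow> nat) \<Rightarrow> nat" where
  "enc_len g = g 5 + 2 + g 2 * g 6 * (g 5 + 1)"

definition enc_base :: "(nat \<Rightarrow> nat) \<Rightarrow> nat" where
  "enc_base g = enc_len g + (2 + 3 * g 1)"

text \<open>The exponent bounds the number of variables of a part: three per clause, and for each of
  the \<open>q\<close> digit positions at most \<open>m div k + k ^ q\<close> clauses.\<close>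

definition assignments :: "(nat \<Rightarrow> nat) \<Rightarrow> nat" where
  "assignments g = 2 ^ (3 * (g 4 * (g 1 div g 2 + g 7)))"

text \<open>Environments are total functions but only eight registers are reserved; further indices
  repeat the last parameter, in accordance with \<open>base_regs\<close>.\<close>

definition globals :: "nat \<Rightarrow> nat \<Rightarrow> nat \<Rightarrow> nat \<Rightarrow> nat \<Rightarrow> (nat \<Rightarrow> nat) \<Rightarrow> nat \<Rightarrow> nat" where
  "globals k \<kappa> q d L \<mu> i =
    [\<mu> 0, \<mu> 1, k, \<kappa>, q, d, 2 ^ (3 * (q * (\<mu> 1 div k + L))), L] ! min i 7"

definition enc_mem :: "(nat \<Rightarrow> nat) \<Rightarrow> (nat \<Rightarrow> nat) \<Rightarrow> nat \<Rightarrow> nat" where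
  "enc_mem g \<mu> a = (if a < enc_len g then cell g \<mu> a else 0)"

lemma pcomp_num_items: "pcomp True (\<lambda>g m e. num_items g)"
  unfolding num_items_def by (rule pcomp_intros)+

lemma pcomp_enc_len: "pcomp True (\<lambda>g m e. enc_len g)"
  unfolding enc_len_def by (rule pcomp_intros)+

lemma pcomp_enc_base: "pcomp True (\<lambda>g m e. enc_base g)"
  unfolding enc_base_def by (rule pcomp_enc_len pcomp_intros)+

lemma pcomp_assignments: "pcomp False (\<lambda>g m e. assignments g)"
  unfolding assignments_def by (rule pcomp_intros)+

lemma pcomp_mem_const: "pcomp False (\<lambda>g m e. m a)"
  by (rule pcomp_intros)+

lemma globals_simps:
  "globals k \<kappa> q d L \<mu> 0 = \<mu> 0" "globals k \<kappa> q d L \<mu> 1 = \<mu> 1" "globals k \<kappa> q d L \<mu> (Suc 0) = \<mu> 1"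
  "globals k \<kappa> q d L \<mu> 2 = k" "globals k \<kappa> q d L \<mu> 3 = \<kappa>" "globals k \<kappa> q d L \<mu> 4 = q"
  "globals k \<kappa> q d L \<mu> 5 = d" "globals k \<kappa> q d L \<mu> 6 = 2 ^ (3 * (q * (\<mu> 1 div k + L)))"
  "globals k \<kappa> q d L \<mu> 7 = L"
  by (simp_all add: globals_def)

lemma params_eq:
  assumes "\<rho> b = \<mu> 0" "\<rho> (b + 1) = \<mu> 1" "\<rho> (b + 2) = k" "\<rho> (b + 3) = \<kappa>" "\<rho> (b + 4) = q" "\<rho> (b + 5) = d"
    "\<rho> (b + 6) = 2 ^ (3 * (q * (\<mu> 1 div k + L)))" "\<rho> (b + 7) = L"
  shows "(\<lambda>i. \<rho> (base_regs b i)) = globals k \<kappa> q d L \<mu>"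
proof
  fix i :: nat
  define j where "j = min i 7"
  have "j \<le> 7" by (simp add: j_def)
  then consider "j = 0" | "j = 1" | "j = 2" | "j = 3" | "j = 4" | "j = 5" | "j = 6" | "j = 7" by linarith
  then show "\<rho> (b + min i 7) = globals k \<kappa> q d L \<mu> i"
    unfolding globals_def j_def[symmetric] by cases (simp_all add: assms assms[simplified])
qed

lemma runs_load_program:
  "\<exists>p C. polyb p \<and> (\<forall>b k \<kappa> q d L. \<forall>W \<mu>.
    (let g = globals k \<kappa> q d L \<mu> in
      2 \<le> W \<and> (\<forall>i. g i \<le> W) \<and> enc_base g \<le> W \<and> (\<forall>a. \<mu> a \<le> 2 ^ W) \<longrightarrow>
      (\<exists>R. runs (b + 13) (C b k \<kappa> q d L) (p W) (\<lambda>_. 0, \<mu>) (R, \<mu>) \<and> (\<forall>y. R y \<le> W) \<and>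
        (\<lambda>i. R (base_regs b i)) = g \<and> (\<forall>y<b. R y = 0) \<and> R (b + 8) = 0 \<and> R (b + 12) = 0 \<and>
        R (b + 9) = num_items g \<and> R (b + 10) = enc_len g \<and> R (b + 11) = enc_base g)))"
proof -
  obtain p1 C1 where 1: "assigner (\<lambda>g m e. m 0) p1 C1"
    using pcomp_assign[OF pcomp_mem_const[of 0]] by (elim exE) (rule that)
  obtain p2 C2 where 2: "assigner (\<lambda>g m e. m 1) p2 C2"
    using pcomp_assign[OF pcomp_mem_const[of 1]] by (elim exE) (rule that)
  obtain p3 C3 where 3: "assigner (\<lambda>g m e. assignments g) p3 C3"
    using pcomp_assign[OF pcomp_assignments] by (elim exE) (rule that)
  obtain p4 C4 where 4: "assigner (\<lambda>g m e. num_items g) p4 C4"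
    using pcomp_assign[OF pcomp_num_items] by (elim exE) (rule that)
  obtain p5 C5 where 5: "assigner (\<lambda>g m e. enc_len g) p5 C5"
    using pcomp_assign[OF pcomp_enc_len] by (elim exE) (rule that)
  obtain p6 C6 where 6: "assigner (\<lambda>g m e. enc_base g) p6 C6"
    using pcomp_assign[OF pcomp_enc_base] by (elim exE) (rule that)
  define p where "p W = (1 + (1 + (1 + (1 + 1)))) + (p1 W + (p2 W + (p3 W + (p4 W + (p5 W + p6 W)))))" for W
  define C where "C b k \<kappa> q d L = Seq (Seq (Const (b + 2) k) (Seq (Const (b + 3) \<kappa>) (Seq (Const (b + 4) q)
        (Seq (Const (b + 5) d) (Const (b + 7) L)))))
      (Seq (C1 b b) (Seq (C2 b (b + 1)) (Seq (C3 b (b + 6)) (Seq (C4 b (b + 9)) (Seq (C5 b (b + 10)) (C6 b (b + 11)))))))"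
    for b k \<kappa> q d L
  have "polyb p"
    unfolding p_def by (intro polyb_intros assigner_polyb[OF 1] assigner_polyb[OF 2] assigner_polyb[OF 3] assigner_polyb[OF 4]
      assigner_polyb[OF 5] assigner_polyb[OF 6])
  moreover have "\<exists>R. runs (b + 13) (C b k \<kappa> q d L) (p W) (\<lambda>_. 0, \<mu>) (R, \<mu>) \<and> (\<forall>y. R y \<le> W) \<and>
        (\<lambda>i. R (base_regs b i)) = g \<and> (\<forall>y<b. R y = 0) \<and> R (b + 8) = 0 \<and> R (b + 12) = 0 \<and>
        R (b + 9) = num_items g \<and> R (b + 10) = enc_len g \<and> R (b + 11) = enc_base g"
    if g: "g = globals k \<kappa> q d L \<mu>"
      and W: "2 \<le> W" "\<And>i. g i \<le> W" "enc_base g \<le> W" "\<And>a. \<mu> a \<le> 2 ^ W"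
    for b k \<kappa> q d L W \<mu> g
  proof -
    have gW: "\<mu> 0 \<le> W" "\<mu> 1 \<le> W" "k \<le> W" "\<kappa> \<le> W" "q \<le> W" "d \<le> W" "L \<le> W" "assignments g \<le> W"
      using W(2)[of 0] W(2)[of 1] W(2)[of 2] W(2)[of 3] W(2)[of 4] W(2)[of 5] W(2)[of 6] W(2)[of 7]
      unfolding g assignments_def by (simp_all only: globals_simps)
    have len: "enc_len g \<le> W" using W(3) by (simp add: enc_base_def)
    then have num: "num_items g \<le> W" by (simp add: enc_len_def num_items_def)
    define \<rho>1 where "\<rho>1 = ((((((\<lambda>_. 0)(b + 2 := k))(b + 3 := \<kappa>))(b + 4 := q))(b + 5 := d))(b + 7 := L) :: nat \<Rightarrow> nat)"
    define \<rho>2 where "\<rho>2 = \<rho>1(b := \<mu> 0)"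
    define \<rho>3 where "\<rho>3 = \<rho>2(b + 1 := \<mu> 1)"
    define \<rho>4 where "\<rho>4 = \<rho>3(b + 6 := assignments g)"
    define \<rho>5 where "\<rho>5 = \<rho>4(b + 9 := num_items g)"
    define \<rho>6 where "\<rho>6 = \<rho>5(b + 10 := enc_len g)"
    define R where "R = \<rho>6(b + 11 := enc_base g)"
    have le1: "\<forall>y. \<rho>1 y \<le> W" unfolding \<rho>1_def using gW by simp
    have le2: "\<forall>y. \<rho>2 y \<le> W" unfolding \<rho>2_def using gW le1 by simp
    have le3: "\<forall>y. \<rho>3 y \<le> W" unfolding \<rho>3_def using gW le2 by simp
    have le4: "\<forall>y. \<rho>4 y \<le> W" unfolding \<rho>4_def using gW le3 by simp
    have le5: "\<forall>y. \<rho>5 y \<le> W" unfolding \<rho>5_def using num le4 by simp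
    have le6: "\<forall>y. \<rho>6 y \<le> W" unfolding \<rho>6_def using len le5 by simp
    have leR: "\<forall>y. R y \<le> W" unfolding R_def using W(3) le6 by simp
    have asg: "assignments g = 2 ^ (3 * (q * (\<mu> 1 div k + L)))"
      unfolding assignments_def g by (simp only: globals_simps)
    \<comment> \<open>Register \<open>b + 6\<close> is not yet set here, but
      \<open>assignments\<close> does not read \<open>g 6\<close>, so its value is already the final
      one.\<close>
    have "assignments (\<lambda>i. \<rho>3 (base_regs b i)) = assignments g"
      unfolding asg unfolding assignments_def \<rho>3_def \<rho>2_def \<rho>1_def by simp
    note e3 = this
    have g4: "(\<lambda>i. \<rho>4 (base_regs b i)) = g"
      unfolding g by (rule params_eq) (simp_all add: \<rho>4_def \<rho>3_def \<rho>2_def \<rho>1_def asg)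
    have g5: "(\<lambda>i. \<rho>5 (base_regs b i)) = g"
      unfolding g by (rule params_eq) (simp_all add: \<rho>5_def \<rho>4_def \<rho>3_def \<rho>2_def \<rho>1_def asg)
    have g6: "(\<lambda>i. \<rho>6 (base_regs b i)) = g"
      unfolding g by (rule params_eq) (simp_all add: \<rho>6_def \<rho>5_def \<rho>4_def \<rho>3_def \<rho>2_def \<rho>1_def asg)
    have gR: "(\<lambda>i. R (base_regs b i)) = g"
      unfolding g by (rule params_eq) (simp_all add: R_def \<rho>6_def \<rho>5_def \<rho>4_def \<rho>3_def \<rho>2_def \<rho>1_def asg)
    have \<mu>: "\<forall>a. \<mu> a \<le> 2 ^ W" using W(4) by blast
    have s1: "runs (b + 13) (Seq (Const (b + 2) k) (Seq (Const (b + 3) \<kappa>) (Seq (Const (b + 4) q)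
        (Seq (Const (b + 5) d) (Const (b + 7) L))))) (1 + (1 + (1 + (1 + 1)))) (\<lambda>_. 0, \<mu>) (\<rho>1, \<mu>)"
      unfolding \<rho>1_def by (rule runs_seq[OF runs_const] runs_const)+
    have s2: "runs (b + 13) (C1 b b) (p1 W) (\<rho>1, \<mu>) (\<rho>2, \<mu>)"
      unfolding \<rho>2_def using assigner_runs[OF 1, of b b W \<rho>1 \<mu>] W(1) le1 \<mu> by simp
    have s3: "runs (b + 13) (C2 b (b + 1)) (p2 W) (\<rho>2, \<mu>) (\<rho>3, \<mu>)"
      unfolding \<rho>3_def using assigner_runs[OF 2, of "b + 1" b W \<rho>2 \<mu>] W(1) le2 \<mu> by simp
    have s4: "runs (b + 13) (C3 b (b + 6)) (p3 W) (\<rho>3, \<mu>) (\<rho>4, \<mu>)"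
      unfolding \<rho>4_def using assigner_runs[OF 3, of "b + 6" b W \<rho>3 \<mu>] W(1) le3 \<mu> e3 by simp
    have s5: "runs (b + 13) (C4 b (b + 9)) (p4 W) (\<rho>4, \<mu>) (\<rho>5, \<mu>)"
      unfolding \<rho>5_def using assigner_runs[OF 4, of "b + 9" b W \<rho>4 \<mu>] W(1) le4 \<mu> g4 by simp
    have s6: "runs (b + 13) (C5 b (b + 10)) (p5 W) (\<rho>5, \<mu>) (\<rho>6, \<mu>)"
      unfolding \<rho>6_def using assigner_runs[OF 5, of "b + 10" b W \<rho>5 \<mu>] W(1) le5 \<mu> g5 by simp
    have s7: "runs (b + 13) (C6 b (b + 11)) (p6 W) (\<rho>6, \<mu>) (R, \<mu>)"
      unfolding R_def using assigner_runs[OF 6, of "b + 11" b W \<rho>6 \<mu>] W(1) le6 \<mu> g6 by simp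
    have r: "runs (b + 13) (C b k \<kappa> q d L) (p W) (\<lambda>_. 0, \<mu>) (R, \<mu>)"
      unfolding C_def p_def
      by (rule runs_seq[OF s1 runs_seq[OF s2 runs_seq[OF s3 runs_seq[OF s4 runs_seq[OF s5 runs_seq[OF s6 s7]]]]]])
    have "(\<forall>y<b. R y = 0) \<and> R (b + 8) = 0 \<and> R (b + 12) = 0 \<and>
        R (b + 9) = num_items g \<and> R (b + 10) = enc_len g \<and> R (b + 11) = enc_base g"
      by (simp add: R_def \<rho>6_def \<rho>5_def \<rho>4_def \<rho>3_def \<rho>2_def \<rho>1_def)
    with r leR gR show ?thesis by (intro exI[of _ R] conjI) simp_all
  qed
  ultimately show ?thesis
    by (intro exI[of _ p] exI[of _ C]) (simp add: Let_def)
qed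

text \<open>The input is still needed while the cells are computed, so they are first written behind both the input
  and the final position of the instance, then copied to address \<open>0\<close>, and the rest is erased.\<close>

lemma runs_build_instance:
  "\<exists>p C. polyb p \<and> (\<forall>b k \<kappa> q d L. \<forall>W \<mu>.
    (let g = globals k \<kappa> q d L \<mu> in
      2 \<le> W \<and> (\<forall>i. g i \<le> W) \<and> enc_base g \<le> W \<and> (\<forall>a. \<mu> a \<le> 2 ^ W) \<and>
      (\<forall>a. 2 + 3 * \<mu> 1 \<le> a \<longrightarrow> \<mu> a = 0) \<longrightarrow>
      (\<exists>R. runs (b + 13) (C b k \<kappa> q d L) (p W) (\<lambda>_. 0, \<mu>) (R(b + 8 := num_items g), enc_mem g \<mu>) \<and>
        (\<forall>y<b. R y = 0) \<and> R (b + 12) = 0)))"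
proof -
  obtain p0 C0 where 0: "polyb p0 \<and> (\<forall>b k \<kappa> q d L. \<forall>W \<mu>.
    (let g = globals k \<kappa> q d L \<mu> in
      2 \<le> W \<and> (\<forall>i. g i \<le> W) \<and> enc_base g \<le> W \<and> (\<forall>a. \<mu> a \<le> 2 ^ W) \<longrightarrow>
      (\<exists>R. runs (b + 13) (C0 b k \<kappa> q d L) (p0 W) (\<lambda>_. 0, \<mu>) (R, \<mu>) \<and> (\<forall>y. R y \<le> W) \<and>
        (\<lambda>i. R (base_regs b i)) = g \<and> (\<forall>y<b. R y = 0) \<and> R (b + 8) = 0 \<and> R (b + 12) = 0 \<and>
        R (b + 9) = num_items g \<and> R (b + 10) = enc_len g \<and> R (b + 11) = enc_base g)))"
    using runs_load_program by (elim exE) (rule that)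
  obtain p4 C4 where 4: "assigner (\<lambda>g m e. num_items g) p4 C4"
    using pcomp_assign[OF pcomp_num_items] by (elim exE) (rule that)
  obtain p5 C5 where 5: "assigner (\<lambda>g m e. enc_len g) p5 C5"
    using pcomp_assign[OF pcomp_enc_len] by (elim exE) (rule that)
  obtain p6 C6 where 6: "assigner (\<lambda>g m e. enc_base g) p6 C6"
    using pcomp_assign[OF pcomp_enc_base] by (elim exE) (rule that)
  have f: "pcomp False (\<lambda>g m e. cell g m (e 0))" "pcomp False (\<lambda>g m e. m (enc_base g + e 0))"
    by (rule pcomp_cell pcomp_var pcomp_load pcomp_add pcomp_enc_base)+
  obtain p7 C7 where 7: "filler (\<lambda>g m e. cell g m (e 0)) p7 C7"
    using pcomp_fill[OF f(1)] by (elim exE) (rule that)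
  obtain p8 C8 where 8: "filler (\<lambda>g m e. m (enc_base g + e 0)) p8 C8"
    using pcomp_fill[OF f(2)] by (elim exE) (rule that)
  obtain p9 C9 where 9: "filler (\<lambda>g m e. 0) p9 C9"
    using pcomp_fill[OF pcomp_const[of True 0]] by (elim exE) (rule that)
  define p where "p W = p0 W + (p5 W + (p7 W + (p5 W + (p8 W + (p6 W + (p9 W + p4 W))))))" for W
  define C where "C b k \<kappa> q d L = Seq (C0 b k \<kappa> q d L) (Seq (C5 b (b + 8)) (Seq (C7 b (b + 11))
      (Seq (C5 b (b + 8)) (Seq (C8 b (b + 12)) (Seq (C6 b (b + 8)) (Seq (C9 b (b + 10)) (C4 b (b + 8))))))))"
    for b k \<kappa> q d L
  have "polyb p"
    unfolding p_def by (intro polyb_intros conjunct1[OF 0] assigner_polyb[OF 4] assigner_polyb[OF 5] assigner_polyb[OF 6]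
      filler_polyb[OF 7] filler_polyb[OF 8] filler_polyb[OF 9])
  moreover have "\<exists>R. runs (b + 13) (C b k \<kappa> q d L) (p W) (\<lambda>_. 0, \<mu>) (R(b + 8 := num_items g), enc_mem g \<mu>) \<and>
        (\<forall>y<b. R y = 0) \<and> R (b + 12) = 0"
    if g: "g = globals k \<kappa> q d L \<mu>"
      and W: "2 \<le> W" "\<And>i. g i \<le> W" "enc_base g \<le> W" "\<And>a. \<mu> a \<le> 2 ^ W"
      and z: "\<And>a. 2 + 3 * \<mu> 1 \<le> a \<Longrightarrow> \<mu> a = 0"
    for b k \<kappa> q d L W \<mu> g
  proof -
    obtain R where s0: "runs (b + 13) (C0 b k \<kappa> q d L) (p0 W) (\<lambda>_. 0, \<mu>) (R, \<mu>)" and R: "\<forall>y. R y \<le> W"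
        "(\<lambda>i. R (base_regs b i)) = g" "\<forall>y<b. R y = 0" "R (b + 8) = 0" "R (b + 12) = 0"
        "R (b + 10) = enc_len g" "R (b + 11) = enc_base g"
      using conjunct2[OF 0, rule_format, of k \<kappa> q d L \<mu> W b] W unfolding g[symmetric] Let_def by blast
    have \<mu>: "\<forall>a. \<mu> a \<le> 2 ^ W" using W(4) by blast
    have g1: "g 1 = \<mu> 1" by (simp add: g globals_simps)
    have len: "enc_len g \<le> W" using W(3) by (simp add: enc_base_def)
    then have num: "g 2 * g 6 \<le> W" by (simp add: enc_len_def)
    have cellW: "cell g m a \<le> 2 ^ W" for m a using cell_le[OF W(1) num W(2) W(2)] .
    have R8: "R(b + 8 := 0) = R" using R(4) by (intro fun_upd_idem) simp
    let ?F = "cell g \<mu>"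
    define m1 where "m1 = filled (enc_base g) 0 (enc_len g) ?F \<mu>"
    define m2 where "m2 = filled 0 0 (enc_len g) ?F m1"
    define m3 where "m3 = filled (enc_len g) 0 (enc_base g) (\<lambda>_. 0) m2"
    have m1W: "\<forall>a. m1 a \<le> 2 ^ W" using \<mu> cellW by (simp add: m1_def filled_def)
    have m2W: "\<forall>a. m2 a \<le> 2 ^ W" using m1W cellW by (simp add: m2_def filled_def)
    have m3W: "\<forall>a. m3 a \<le> 2 ^ W" using m2W by (simp add: m3_def filled_def)
    have s1: "runs (b + 13) (C5 b (b + 8)) (p5 W) (R, m) (R(b + 8 := enc_len g), m)"
      if "\<forall>a. m a \<le> 2 ^ W" for m
      using assigner_runs[OF 5, of "b + 8" b W R m] W(1) R(1,2) that by simp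
    have s3: "runs (b + 13) (C6 b (b + 8)) (p6 W) (R, m) (R(b + 8 := enc_base g), m)"
      if "\<forall>a. m a \<le> 2 ^ W" for m
      using assigner_runs[OF 6, of "b + 8" b W R m] W(1) R(1,2) that by simp
    have s4: "runs (b + 13) (C4 b (b + 8)) (p4 W) (R, m) (R(b + 8 := num_items g), m)"
      if "\<forall>a. m a \<le> 2 ^ W" for m
      using assigner_runs[OF 4, of "b + 8" b W R m] W(1) R(1,2) that by simp
    \<comment> \<open>All writes so far are at addresses from \<open>enc_base g\<close> on, beyond
      the formula.\<close>
    have "cell g (filled (enc_base g) (Suc j) (enc_len g) ?F \<mu>) = ?F" for j
      by (rule cell_cong) (simp add: filled_def enc_base_def)
    then have f1: "runs (b + 13) (C7 b (b + 11)) (p7 W) (R(b + 8 := enc_len g), \<mu>) (R, m1)"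
      using filler_runs[OF 7, of "b + 11" b W R \<mu> "enc_len g" ?F] W(1) R \<mu> len cellW
      unfolding R8 m1_def by simp
    \<comment> \<open>The source addresses are at least \<open>enc_len g\<close>, the written ones
      below it, so the copy never overwrites what it still has to read.\<close>
    have "filled 0 (Suc j) (enc_len g) ?F m1 (enc_base g + j) = ?F j" if "j < enc_len g" for j
      using that by (simp add: filled_def m1_def enc_base_def)
    \<comment> \<open>Register \<open>b + 12\<close> holds 0 and serves as the base address of the
      copy.\<close>
    then have f2: "runs (b + 13) (C8 b (b + 12)) (p8 W) (R(b + 8 := enc_len g), m1) (R, m2)"
      using filler_runs[OF 8, of "b + 12" b W R m1 "enc_len g" ?F] W(1) R m1W len cellW
      unfolding R8 m2_def by simp
    \<comment> \<open>Erasing \<open>enc_base g\<close> cells from \<open>enc_len g\<close> on ends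
      exactly behind the scratch copy. What remains of the formula beyond the instance is erased
      too.\<close>
    have f3: "runs (b + 13) (C9 b (b + 10)) (p9 W) (R(b + 8 := enc_base g), m2) (R, m3)"
      using filler_runs[OF 9, of "b + 10" b W R m2 "enc_base g" "\<lambda>_. 0"] W(1,3) R m2W
      unfolding R8 m3_def by simp
    have "m3 = enc_mem g \<mu>"
    proof
      fix a show "m3 a = enc_mem g \<mu> a"
        using z[of a] unfolding m3_def m2_def m1_def filled_def enc_mem_def enc_base_def g1 by auto
    qed
    then have "runs (b + 13) (C b k \<kappa> q d L) (p W) (\<lambda>_. 0, \<mu>) (R(b + 8 := num_items g), enc_mem g \<mu>)"
      unfolding C_def p_def
      using runs_seq[OF s0 runs_seq[OF s1[OF \<mu>] runs_seq[OF f1 runs_seq[OF s1[OF m1W] runs_seq[OF f2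
        runs_seq[OF s3[OF m2W] runs_seq[OF f3 s4[OF m3W]]]]]]]] by simp
    with R show ?thesis by (intro exI[of _ R] conjI)
  qed
  ultimately show ?thesis
    by (intro exI[of _ p] exI[of _ C]) (simp add: Let_def)
qed

text \<open>Separates the time into a factor \<open>X\<close>, which may depend on the approximation
  algorithm and its running time, and a polynomial in \<open>W\<close> that may not. This works
  because every summand is at most linear in \<open>X\<close>.\<close>

lemma polynomial_absorb:
  fixes X a w W :: nat
  assumes "1 \<le> X" "A \<le> X" "B \<le> X" "C \<le> X"
  shows "a + (A + (W * ((2 * (W + 1 + B) + 2 * W + 4) + 2 * W + 6) + 1)) + (2 * W + 7 + C)
    \<le> X * (a + (W * (6 * W + 14) + 2 * W + 10))"
proof -
  have le: "y \<le> X * y" for y using assms(1) by simp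
  have "W * B \<le> W * X" using assms(3) by simp
  moreover have "a + (A + (W * ((2 * (W + 1 + B) + 2 * W + 4) + 2 * W + 6) + 1)) + (2 * W + 7 + C)
    = a + A + W * (6 * W + 12) + 2 * (W * B) + 8 + 2 * W + C"
    by (simp add: algebra_simps)
  ultimately have "a + (A + (W * ((2 * (W + 1 + B) + 2 * W + 4) + 2 * W + 6) + 1)) + (2 * W + 7 + C)
    \<le> a + X + W * (6 * W + 12) + 2 * (W * X) + 8 + 2 * W + X"
    using assms by linarith
  also have "\<dots> \<le> X * a + X + X * (W * (6 * W + 12)) + 2 * (W * X) + X * 8 + X * (2 * W) + X"
    by (intro add_mono le order_refl)
  also have "\<dots> = X * (a + (W * (6 * W + 14) + 2 * W + 10))" by (simp add: algebra_simps)
  finally show ?thesis .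
qed

text \<open>\<open>p\<close> precedes the algorithm \<open>A\<close>, the dimension and the
  threshold \<open>\<theta>\<close>; these influence the time only through the constant
  \<open>D\<close> and the running time of \<open>A\<close>.\<close>

lemma reduction_program:
  "\<exists>p. polyb p \<and> (\<forall>A k \<kappa> q d L \<theta>. \<exists>B D. \<forall>W \<mu> TA sA.
    (let g = globals k \<kappa> q d L \<mu> in
      2 \<le> W \<and> (\<forall>i. g i \<le> W) \<and> enc_base g \<le> W \<and> (\<forall>a. \<mu> a \<le> 2 ^ W) \<and>
      (\<forall>a. 2 + 3 * \<mu> 1 \<le> a \<longrightarrow> \<mu> a = 0) \<and> exec A (\<lambda>_. 0, enc_mem g \<mu>) TA sA \<longrightarrow>
      (\<exists>T s. exec B (\<lambda>_. 0, \<mu>) T s \<and> T \<le> D * (TA + 1) * p W \<and>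
        (reg s 0 \<noteq> 0 \<longleftrightarrow> \<theta> \<le> card {i. i < num_items g \<and> mem sA i \<noteq> 0}))))"
proof -
  obtain p0 C0 where 0: "polyb p0 \<and> (\<forall>b k \<kappa> q d L. \<forall>W \<mu>.
    (let g = globals k \<kappa> q d L \<mu> in
      2 \<le> W \<and> (\<forall>i. g i \<le> W) \<and> enc_base g \<le> W \<and> (\<forall>a. \<mu> a \<le> 2 ^ W) \<and>
      (\<forall>a. 2 + 3 * \<mu> 1 \<le> a \<longrightarrow> \<mu> a = 0) \<longrightarrow>
      (\<exists>R. runs (b + 13) (C0 b k \<kappa> q d L) (p0 W) (\<lambda>_. 0, \<mu>) (R(b + 8 := num_items g), enc_mem g \<mu>) \<and>
        (\<forall>y<b. R y = 0) \<and> R (b + 12) = 0)))"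
    using runs_build_instance by (elim exE) (rule that)
  define p where "p W = p0 W + (W * (6 * W + 14) + 2 * W + 10)" for W
  have "polyb p" unfolding p_def by (intro polyb_intros conjunct1[OF 0])
  moreover have "\<exists>B D. \<forall>W \<mu> TA sA.
    (let g = globals k \<kappa> q d L \<mu> in
      2 \<le> W \<and> (\<forall>i. g i \<le> W) \<and> enc_base g \<le> W \<and> (\<forall>a. \<mu> a \<le> 2 ^ W) \<and>
      (\<forall>a. 2 + 3 * \<mu> 1 \<le> a \<longrightarrow> \<mu> a = 0) \<and> exec A (\<lambda>_. 0, enc_mem g \<mu>) TA sA \<longrightarrow>
      (\<exists>T s. exec B (\<lambda>_. 0, \<mu>) T s \<and> T \<le> D * (TA + 1) * p W \<and>
        (reg s 0 \<noteq> 0 \<longleftrightarrow> \<theta> \<le> card {i. i < num_items g \<and> mem sA i \<noteq> 0})))" for A k \<kappa> q d L \<theta>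
  proof -
    obtain b where b: "regs_below b A" using ex_regs_below by blast
    obtain DA where DA: "consts_le DA A" using ex_consts_le by blast
    \<comment> \<open>The test that the count reaches \<open>\<theta>\<close> is made by truncated
      subtraction: count + 1 - \<theta> is nonzero exactly then.\<close>
    define F where "F = Seq (Const (b + 13) 1) (Seq (Add (b + 12) (b + 12) (b + 13))
      (Seq (Const (b + 13) \<theta>) (Sub 0 (b + 12) (b + 13))))"
    define L1 where "L1 = loop (b + 8) (b + 13) (Seq (Load (b + 13) (b + 8))
      (If (b + 13) (Seq (Const (b + 13) 1) (Add (b + 12) (b + 12) (b + 13))) Skip))"
    define D where "D = DA + digits \<theta> + 1"
    have "\<exists>T s. exec (Seq (Seq (C0 b k \<kappa> q d L) (Seq A L1)) F) (\<lambda>_. 0, \<mu>) T s \<and> T \<le> D * (TA + 1) * p W \<and>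
        (reg s 0 \<noteq> 0 \<longleftrightarrow> \<theta> \<le> card {i. i < num_items g \<and> mem sA i \<noteq> 0})"
      if g: "g = globals k \<kappa> q d L \<mu>"
        and W: "2 \<le> W" "\<And>i. g i \<le> W" "enc_base g \<le> W" "\<And>a. \<mu> a \<le> 2 ^ W"
        and z: "\<And>a. 2 + 3 * \<mu> 1 \<le> a \<Longrightarrow> \<mu> a = 0"
        and A: "exec A (\<lambda>_. 0, enc_mem g \<mu>) TA sA"
      for g W \<mu> TA sA
    proof -
      obtain R where s0: "runs (b + 13) (C0 b k \<kappa> q d L) (p0 W) (\<lambda>_. 0, \<mu>) (R(b + 8 := num_items g), enc_mem g \<mu>)"
          and R: "\<forall>y<b. R y = 0" "R (b + 12) = 0"
        using conjunct2[OF 0, rule_format, of k \<kappa> q d L \<mu> W b] W z unfolding g[symmetric] Let_def by blast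
      have len: "enc_len g \<le> W" using W(3) by (simp add: enc_base_def)
      then have num: "num_items g \<le> W" by (simp add: enc_len_def num_items_def)
      have encW: "enc_mem g \<mu> a \<le> 2 ^ W" for a
        using cell_le[OF W(1) num[unfolded num_items_def] W(2) W(2)] by (simp add: enc_mem_def)
      have d0: "digits_le (W + 1 + DA) (\<lambda>_. 0, enc_mem g \<mu>)"
      proof -
        have "digits (enc_mem g \<mu> a) \<le> W + 1 + DA" for a using digits_le_power[OF encW[of a]] by simp
        then show ?thesis by (simp add: digits_le_def)
      qed
      have "digits_le (W + 1 + DA + TA) sA"
        by (rule exec_digits_le[OF A consts_le_mono[OF DA] d0]) simp
      then have dig: "digits (mem sA a) \<le> W + 1 + (DA + TA)" for a by (simp add: digits_le_def add.assoc)
      define R' where "R' y = (if y < b then reg sA y else R y)" for y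
      let ?N = "num_items g"
      let ?n = "card {i. i < ?N \<and> mem sA i \<noteq> 0}"
      have "runs (b + 13) A TA (R(b + 8 := ?N), enc_mem g \<mu>)
          (\<lambda>y. if y < b then reg sA y else (R(b + 8 := ?N)) y, mem sA)"
        by (rule runs_frame[OF A b]) (use R in simp_all)
      moreover have "(\<lambda>y. if y < b then reg sA y else (R(b + 8 := ?N)) y) = R'(b + 8 := ?N)"
        by (auto simp: R'_def)
      ultimately have sA: "runs (b + 13) A TA (R(b + 8 := ?N), enc_mem g \<mu>) (R'(b + 8 := ?N), mem sA)" by simp
      have "R' (b + 12) = 0" using R by (simp add: R'_def)
      from runs_count[where m = "mem sA" and \<rho> = R' and b = b, OF dig num this]
      have sL: "runs (b + 13) L1 (W * ((2 * (W + 1 + (DA + TA)) + 2 * W + 4) + 2 * W + 6) + 1)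
          (R'(b + 8 := ?N), mem sA) (R'(b + 8 := 0, b + 12 := ?n), mem sA)"
        unfolding L1_def .
      obtain T r where 1: "exec (Seq (C0 b k \<kappa> q d L) (Seq A L1)) (\<lambda>_. 0, mem (\<lambda>_. 0, \<mu>)) T
            (r, mem (R'(b + 8 := 0, b + 12 := ?n), mem sA))"
          "T \<le> p0 W + (TA + (W * ((2 * (W + 1 + (DA + TA)) + 2 * W + 4) + 2 * W + 6) + 1))"
          "\<And>y. y < b + 13 \<Longrightarrow> r y = reg (R'(b + 8 := 0, b + 12 := ?n), mem sA) y"
        by (rule runsE[OF runs_seq[OF s0 runs_seq[OF sA sL]], of "\<lambda>_. 0"]) simp_all
      have r12: "r (b + 12) = ?n" using 1(3)[of "b + 12"] by simp
      let ?r1 = "r(b + 13 := 1)" let ?r2 = "?r1(b + 12 := ?n + 1)" let ?r3 = "?r2(b + 13 := \<theta>)"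
      let ?r4 = "?r3(0 := ?n + 1 - \<theta>)"
      have F: "exec F (r, mem sA) (1 + ((digits ?n + digits 1) + (1 + (digits (?n + 1) + digits \<theta>)))) (?r4, mem sA)"
        unfolding F_def
        using exec.Add[of "b + 12" "b + 12" "b + 13" ?r1 "mem sA"] exec.Sub[of 0 "b + 12" "b + 13" ?r3 "mem sA"] r12
        by (intro exec.Seq[OF exec.Const] exec.Seq[where ?s1.0 = "(?r2, mem sA)"] exec.Seq[OF exec.Const]) simp_all
      have n: "?n \<le> W"
      proof -
        have "?n \<le> card {..<?N}" by (rule card_mono) auto
        then show ?thesis using num by simp
      qed
      let ?T = "T + (1 + ((digits ?n + digits 1) + (1 + (digits (?n + 1) + digits \<theta>))))"
      have "exec (Seq (Seq (C0 b k \<kappa> q d L) (Seq A L1)) F) (\<lambda>_. 0, \<mu>) ?T (?r4, mem sA)"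
        using exec.Seq[OF 1(1)[unfolded snd_conv] F] .
      moreover have "?T \<le> D * (TA + 1) * p W"
      proof -
        have "?T \<le> p0 W + (TA + (W * ((2 * (W + 1 + (DA + TA)) + 2 * W + 4) + 2 * W + 6) + 1)) + (2 * W + 7 + digits \<theta>)"
          using 1(2) n digits_le_Suc[of ?n] digits_le_Suc[of "?n + 1"] by simp
        also have "\<dots> \<le> D * (TA + 1) * p W"
          unfolding p_def by (rule polynomial_absorb) (simp_all add: D_def algebra_simps)
        finally show ?thesis .
      qed
      moreover have "reg (?r4, mem sA) 0 \<noteq> 0 \<longleftrightarrow> \<theta> \<le> ?n" by auto
      ultimately show ?thesis by (intro exI[of _ ?T] exI[of _ "(?r4, mem sA)"] conjI)
    qed
    then show ?thesis
      by (intro exI[of _ "Seq (Seq (C0 b k \<kappa> q d L) (Seq A L1)) F"] exI[of _ D]) (simp add: Let_def)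
  qed
  ultimately show ?thesis by (intro exI[of _ p] conjI allI)
qed

section \<open>Covering almost all clauses by few parts\<close>

lemma length_concat_uniform: "\<forall>x\<in>set xss. length x = r \<Longrightarrow> length (concat xss) = length xss * r"
  by (induction xss) auto

lemma nth_concat_uniform:
  "\<forall>x\<in>set xss. length x = r \<Longrightarrow> p < length xss \<Longrightarrow> j < r \<Longrightarrow> concat xss ! (p * r + j) = xss ! p ! j"
proof (induction xss arbitrary: p)
  case (Cons x xss)
  then show ?case by (cases p) (auto simp: nth_append add.assoc)
qed simp

text \<open>With \<open>P\<close> a power of \<open>k\<close>, this counts the numbers with a
  prescribed digit. Deleting that digit, that is, joining \<open>c div (P * k)\<close> and
  \<open>c mod P\<close>, is injective and leaves a number below \<open>m div k + P\<close>.\<close>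

lemma card_digit_le:
  fixes P k m :: nat
  assumes "0 < P" "0 < k"
  shows "card {c. c < m \<and> c div P mod k = i} \<le> m div k + P"
proof -
  let ?S = "{c. c < m \<and> c div P mod k = i}"
  define h where "h c = c div (P * k) * P + c mod P" for c
  have c: "c = (c div (P * k) * k + c div P mod k) * P + c mod P" for c
    by (simp add: div_mult2_eq)
  have "inj_on h ?S"
  proof (rule inj_onI)
    fix x y assume xy: "x \<in> ?S" "y \<in> ?S" "h x = h y"
    have "h x div P = x div (P * k)" "h y div P = y div (P * k)" "h x mod P = x mod P" "h y mod P = y mod P"
      using assms(1) by (simp_all add: h_def)
    with xy show "x = y" using c[of x] c[of y] by simp
  qed
  moreover have "h ` ?S \<subseteq> {..<m div k + P}"
  proof
    fix z assume "z \<in> h ` ?S"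
    then obtain c where c: "c < m" "z = h c" by auto
    have "c div (P * k) * P \<le> c div k"
      by (subst mult.commute[of P k], subst div_mult2_eq) (rule div_times_less_eq_dividend)
    also have "\<dots> \<le> m div k" using c by (intro div_le_mono) simp
    finally have "c div (P * k) * P \<le> m div k" .
    moreover have "c mod P < P" using assms by simp
    ultimately show "z \<in> {..<m div k + P}" unfolding c h_def by simp
  qed
  ultimately have "card ?S \<le> card {..<m div k + P}" by (intro card_inj_on_le) auto
  then show ?thesis by simp
qed

text \<open>Splitting off the lowest digit leaves \<open>k - card R\<close> choices for it and the
  same problem with one digit less; after \<open>q\<close> digits a number below \<open>j\<close>
  remains.\<close>

lemma card_avoid_digits_le:
  fixes k q j m :: nat
  assumes "0 < k" "R \<subseteq> {..<k}" "m \<le> j * k ^ q"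
  shows "card {c. c < m \<and> (\<forall>t<q. c div k ^ t mod k \<notin> R)} \<le> (k - card R) ^ q * j"
  using assms(3)
proof (induction q arbitrary: m)
  case 0
  then show ?case by simp
next
  case (Suc q)
  let ?S = "{c. c < m \<and> (\<forall>t<Suc q. c div k ^ t mod k \<notin> R)}"
  let ?T = "{c. c < j * k ^ q \<and> (\<forall>t<q. c div k ^ t mod k \<notin> R)}"
  define h where "h c = (c mod k, c div k)" for c
  have inj: "inj_on h ?S"
  proof (rule inj_onI)
    fix x y assume "h x = h y"
    then show "x = y" unfolding h_def by (metis div_mult_mod_eq prod.inject)
  qed
  have "h ` ?S \<subseteq> ({..<k} - R) \<times> ?T"
  proof
    fix z assume "z \<in> h ` ?S"
    then obtain c where c: "c < m" "\<And>t. t < Suc q \<Longrightarrow> c div k ^ t mod k \<notin> R" "z = h c" by auto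
    have "c < j * k ^ q * k" using c(1) Suc.prems by (simp add: mult.assoc mult.commute[of k])
    then have "c div k < j * k ^ q" using assms(1) by (simp add: div_less_iff_less_mult)
    moreover have "c mod k \<notin> R" using c(2)[of 0] by simp
    moreover have "c div k div k ^ t mod k \<notin> R" if "t < q" for t
      using c(2)[of "Suc t"] that by (simp add: div_mult2_eq)
    ultimately show "z \<in> ({..<k} - R) \<times> ?T" using assms(1) by (simp add: c(3) h_def)
  qed
  then have "card ?S \<le> card (({..<k} - R) \<times> ?T)" using inj by (intro card_inj_on_le) auto
  also have "\<dots> = (k - card R) * card ?T"
    using assms(2) by (simp add: card_cartesian_product card_Diff_subset finite_subset)
  also have "\<dots> \<le> (k - card R) * ((k - card R) ^ q * j)"
    using Suc.IH[of "j * k ^ q"] by (intro mult_le_mono2) simp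
  finally show ?case by (simp add: mult.assoc)
qed

lemma lit_code_eq: "lit_code l = 2 * v \<longleftrightarrow> l = Pos v" "lit_code l = 2 * v + 1 \<longleftrightarrow> l = Neg v"
  by (cases l; simp; presburger)+

lemma set_encode_less: "B \<subseteq> {..<w} \<Longrightarrow> set_encode B < 2 ^ w"
proof -
  assume B: "B \<subseteq> {..<w}"
  have "set_encode B \<le> (\<Sum>v<w. 2 ^ v)" unfolding set_encode_def using B by (intro sum_mono2) auto
  also have "\<dots> < 2 ^ w" by (induction w) simp_all
  finally show ?thesis .
qed

section \<open>The reduction for a fixed formula\<close>

locale reduction =
  fixes n \<kappa> q d :: nat and cs :: "nat literal list list" and \<mu> :: "nat \<Rightarrow> nat"
  assumes length_clause: "C \<in> set cs \<Longrightarrow> length C = 3"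
    and vars_clause: "C \<in> set cs \<Longrightarrow> l \<in> set C \<Longrightarrow> var l < n"
    and mem_0: "\<mu> 0 = n" and mem_1: "\<mu> 1 = length cs"
    and mem_lit: "c < length cs \<Longrightarrow> t < 3 \<Longrightarrow> \<mu> (2 + (3 * c + t)) = lit_code (cs ! c ! t)"
    and q: "1 \<le> q" and d: "(2 ^ \<kappa>) * (2 ^ \<kappa>) \<le> d"
begin

definition "k = (2::nat) ^ \<kappa>"
definition "g = globals k \<kappa> q d (k ^ q) \<mu>"

lemma k_pos: "0 < k" by (simp add: k_def)

lemma g_simps: "g 0 = n" "g 1 = length cs" "g (Suc 0) = length cs" "g 2 = k" "g 3 = \<kappa>" "g 4 = q" "g 5 = d"
  "g 6 = 2 ^ (3 * (q * (length cs div k + k ^ q)))" "g 7 = k ^ q"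
  unfolding g_def by (simp_all only: globals_simps mem_0 mem_1)

lemma in_part_iff: "in_part g i c \<longleftrightarrow> length cs < k ^ q \<or> (\<exists>t<q. c div k ^ t mod k = i)"
  unfolding in_part_def by (simp add: g_simps k_def power_mult)

lemma ex_lit_iff:
  assumes "c < length cs" shows "(\<exists>t<3. P (\<mu> (2 + (3 * c + t)))) \<longleftrightarrow> (\<exists>l\<in>set (cs ! c). P (lit_code l))"
proof -
  have "length (cs ! c) = 3" using length_clause assms by simp
  then have "(\<exists>l\<in>set (cs ! c). P (lit_code l)) \<longleftrightarrow> (\<exists>t<3. P (lit_code (cs ! c ! t)))"
    by (metis in_set_conv_nth)
  also have "\<dots> \<longleftrightarrow> (\<exists>t<3. P (\<mu> (2 + (3 * c + t))))" using mem_lit[OF assms] by (metis)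
  finally show ?thesis by simp
qed

lemma in_vars_iff: "in_vars g \<mu> i v \<longleftrightarrow> (\<exists>c<length cs. in_part g i c \<and> v \<in> var ` set (cs ! c))"
proof -
  have "(\<exists>t<3. \<mu> (2 + (3 * c + t)) = 2 * v \<or> \<mu> (2 + (3 * c + t)) = 2 * v + 1) \<longleftrightarrow> v \<in> var ` set (cs ! c)"
    if "c < length cs" for c
    unfolding ex_lit_iff[OF that, of "\<lambda>x. x = 2 * v \<or> x = 2 * v + 1"] lit_code_eq image_iff
    by (metis literal.exhaust_sel literal.sel)
  then show ?thesis unfolding in_vars_def g_simps by blast
qed

lemma in_vars_less: "in_vars g \<mu> i v \<Longrightarrow> v < n"
  unfolding in_vars_iff using vars_clause nth_mem by blast

lemma satisfies_iff:
  "satisfies g \<mu> i x \<longleftrightarrow>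
    (\<forall>c<length cs. in_part g i c \<longrightarrow> (\<exists>l\<in>set (cs ! c). lit_true (assigned g \<mu> i x) l))"
proof -
  have "(\<exists>t<3. \<exists>v<n. \<mu> (2 + (3 * c + t)) = 2 * v \<and> assigned g \<mu> i x v \<or>
      \<mu> (2 + (3 * c + t)) = 2 * v + 1 \<and> \<not> assigned g \<mu> i x v) \<longleftrightarrow>
      (\<exists>l\<in>set (cs ! c). lit_true (assigned g \<mu> i x) l)" if c: "c < length cs" for c
  proof -
    have "(\<exists>v<n. l = Pos v \<and> assigned g \<mu> i x v \<or> l = Neg v \<and> \<not> assigned g \<mu> i x v) \<longleftrightarrow>
        lit_true (assigned g \<mu> i x) l" if "l \<in> set (cs ! c)" for l
      using vars_clause[OF nth_mem[OF c] that] by (cases l) auto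
    then show ?thesis
      unfolding ex_lit_iff[OF c, of "\<lambda>y. \<exists>v<n. y = 2 * v \<and> assigned g \<mu> i x v \<or> y = 2 * v + 1 \<and> \<not> assigned g \<mu> i x v"]
        lit_code_eq by (rule bex_cong[OF refl])
  qed
  then show ?thesis unfolding satisfies_def g_simps by blast
qed

lemma finite_in_vars: "finite {v. in_vars g \<mu> i v}"
  by (rule finite_subset[of _ "{..<n}"]) (use in_vars_less in auto)

text \<open>A clause has three literals, and a part collects, for each of the \<open>q\<close> digit
  positions, the clauses with a given digit there. When there are fewer than \<open>k ^ q\<close>
  clauses a part contains all of them, which the summand \<open>k ^ q\<close> covers.\<close>

lemma card_in_vars: "card {v. in_vars g \<mu> i v} \<le> 3 * (q * (length cs div k + k ^ q))"
proof -
  let ?P = "{c. c < length cs \<and> in_part g i c}"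
  have P: "card ?P \<le> q * (length cs div k + k ^ q)"
  proof (cases "length cs < k ^ q")
    case True
    have "card ?P \<le> card {..<length cs}" by (rule card_mono) auto
    also have "\<dots> \<le> 1 * (length cs div k + k ^ q)" using True by simp
    also have "\<dots> \<le> q * (length cs div k + k ^ q)" using q by (rule mult_le_mono1)
    finally show ?thesis .
  next
    case False
    have "?P = (\<Union>t<q. {c. c < length cs \<and> c div k ^ t mod k = i})"
      unfolding in_part_iff using False by blast
    then have "card ?P \<le> (\<Sum>t<q. card {c. c < length cs \<and> c div k ^ t mod k = i})"
      by (simp only: card_UN_le finite_lessThan)
    also have "\<dots> \<le> (\<Sum>t<q. length cs div k + k ^ q)"
    proof (rule sum_mono)
      fix t assume t: "t \<in> {..<q}"
      have "card {c. c < length cs \<and> c div k ^ t mod k = i} \<le> length cs div k + k ^ t"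
        using k_pos by (intro card_digit_le) simp_all
      moreover have "k ^ t \<le> k ^ q" using t k_pos by (intro power_increasing) simp_all
      ultimately show "card {c. c < length cs \<and> c div k ^ t mod k = i} \<le> length cs div k + k ^ q" by linarith
    qed
    finally show ?thesis by simp
  qed
  have fin: "finite ?P" by simp
  have "{v. in_vars g \<mu> i v} = (\<Union>c\<in>?P. var ` set (cs ! c))" unfolding in_vars_iff by blast
  then have "card {v. in_vars g \<mu> i v} \<le> (\<Sum>c\<in>?P. card (var ` set (cs ! c)))"
    by (simp only: card_UN_le[OF fin])
  also have "\<dots> \<le> (\<Sum>c\<in>?P. 3)"
  proof (rule sum_mono)
    fix c assume "c \<in> ?P"
    then have "length (cs ! c) = 3" using length_clause by simp
    then show "card (var ` set (cs ! c)) \<le> 3"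
      using card_image_le[of "set (cs ! c)" var] card_length[of "cs ! c"] by simp
  qed
  also have "\<dots> = 3 * card ?P" by simp
  finally show ?thesis using P by linarith
qed

section \<open>Partial assignments as numbers\<close>

lemma var_rank_eq: "var_rank g \<mu> i v = card {u. u < v \<and> in_vars g \<mu> i u}"
  unfolding var_rank_def by (simp add: of_bool_def sum.If_cases Int_def)

lemma var_rank_less: "u < v \<Longrightarrow> in_vars g \<mu> i u \<Longrightarrow> var_rank g \<mu> i u < var_rank g \<mu> i v"
  unfolding var_rank_eq by (rule psubset_card_mono) auto

lemma inj_var_rank: "inj_on (var_rank g \<mu> i) {v. in_vars g \<mu> i v}"
  by (rule linorder_inj_onI) (use var_rank_less in force)+

lemma var_rank_bound: "in_vars g \<mu> i v \<Longrightarrow> var_rank g \<mu> i v < 3 * (q * (length cs div k + k ^ q))"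
proof -
  assume v: "in_vars g \<mu> i v"
  have "var_rank g \<mu> i v < card {v. in_vars g \<mu> i v}"
    unfolding var_rank_eq by (rule psubset_card_mono[OF finite_in_vars]) (use v in auto)
  then show ?thesis using card_in_vars[of i] by linarith
qed

text \<open>The witness has its bits at the ranks of the true variables of the part. Ranks are
  injective on these variables and stay below the exponent in \<open>g 6\<close>.\<close>

lemma ex_assigned:
  "\<exists>x<g 6. \<forall>v. in_vars g \<mu> i v \<longrightarrow> (assigned g \<mu> i x v \<longleftrightarrow> \<sigma> v)"
proof -
  let ?B = "var_rank g \<mu> i ` {v. in_vars g \<mu> i v \<and> \<sigma> v}"
  have fin: "finite ?B" using finite_in_vars[of i] by (intro finite_imageI finite_subset[OF _ finite_in_vars[of i]]) auto
  have "set_encode ?B < g 6" unfolding g_simps by (rule set_encode_less) (use var_rank_bound in auto)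
  moreover have "assigned g \<mu> i (set_encode ?B) v \<longleftrightarrow> \<sigma> v" if v: "in_vars g \<mu> i v" for v
  proof -
    have "assigned g \<mu> i (set_encode ?B) v \<longleftrightarrow> var_rank g \<mu> i v \<in> set_decode (set_encode ?B)"
      by (simp add: assigned_def set_decode_def odd_iff_mod_2_eq_one)
    also have "\<dots> \<longleftrightarrow> var_rank g \<mu> i v \<in> ?B" using fin by simp
    also have "\<dots> \<longleftrightarrow> \<sigma> v" using inj_var_rank[of i] v by (auto simp: inj_on_def)
    finally show ?thesis .
  qed
  ultimately show ?thesis by blast
qed

text \<open>Binary encoding of finite sets is injective, so equal shared values mean equal sets of
  true common variables.\<close>

lemma shared_value_eq:
  "shared_value g \<mu> i j x = set_encode {v. in_vars g \<mu> i v \<and> in_vars g \<mu> j v \<and> assigned g \<mu> i x v}"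
proof -
  have "{v. in_vars g \<mu> i v \<and> in_vars g \<mu> j v \<and> assigned g \<mu> i x v} =
      {v \<in> {..<n}. in_vars g \<mu> i v \<and> in_vars g \<mu> j v \<and> assigned g \<mu> i x v}"
    using in_vars_less by auto
  then show ?thesis unfolding shared_value_def set_encode_def g_simps by (simp add: sum.If_cases Int_def)
qed

end

section \<open>Completeness and soundness of the reduction\<close>

context reduction
begin

text \<open>The shift \<open>j - 1\<close> translates coordinates counted from 1 into columns
  counted from 0.\<close>

definition knapsack_instance :: "nat knapsack" where
  "knapsack_instance = \<lparr>items = {..<num_items g}, profit = (\<lambda>_. 1),
    cost = (\<lambda>p j. column_cost g \<mu> p (j - 1)), budget = (\<lambda>j. column_budget g (j - 1))\<rparr>"

lemma instance_simps:
  "items knapsack_instance = {..<num_items g}" "profit knapsack_instance p = 1"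
  "cost knapsack_instance p j = column_cost g \<mu> p (j - 1)"
  "budget knapsack_instance j = column_budget g (j - 1)"
  by (simp_all add: knapsack_instance_def)

lemma numbered_instance: "numbered_knapsack knapsack_instance"
  by (auto simp: numbered_knapsack_def instance_simps)

lemma encode_instance:
  "length (encode_knapsack d knapsack_instance) = enc_len g"
  "a < enc_len g \<Longrightarrow> encode_knapsack d knapsack_instance ! a = cell g \<mu> a"
proof -
  let ?N = "num_items g"
  let ?b = "\<lambda>i. profit knapsack_instance i # map (cost knapsack_instance i) [1..<d + 1]"
  let ?bs = "map ?b [0..<?N]"
  let ?h = "?N # d # map (budget knapsack_instance) [1..<d + 1]"
  have enc: "encode_knapsack d knapsack_instance = ?h @ concat ?bs"
    by (simp add: encode_knapsack_def instance_simps(1))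
  have u: "\<forall>x\<in>set ?bs. length x = d + 1" by simp
  have lh: "length ?h = d + 2" by simp
  have lc: "length (concat ?bs) = ?N * (d + 1)"
    using length_concat_uniform[OF u] by simp
  show len: "length (encode_knapsack d knapsack_instance) = enc_len g"
    unfolding enc length_append lh lc by (simp add: enc_len_def num_items_def g_simps)
  assume a: "a < enc_len g"
  show "encode_knapsack d knapsack_instance ! a = cell g \<mu> a"
  proof (cases "a < d + 2")
    case True
    then have h: "encode_knapsack d knapsack_instance ! a = ?h ! a"
      unfolding enc by (simp only: nth_append lh if_True)
    consider "a = 0" | "a = 1" | "2 \<le> a" by linarith
    then show ?thesis
    proof cases
      case 3
      have "?h ! a = budget knapsack_instance ([1..<d + 1] ! (a - 2))"
        using True 3 by (simp add: nth_Cons' numeral_2_eq_2 del: upt_Suc)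
      also have "[1..<d + 1] ! (a - 2) = a - 1" using True 3 by (subst nth_upt) simp_all
      finally have "?h ! a = budget knapsack_instance (a - 1)" .
      moreover have "budget knapsack_instance (a - 1) = column_budget g (a - 2)"
        by (simp add: instance_simps numeral_2_eq_2)
      moreover have "cell g \<mu> a = column_budget g (a - 2)" using 3 True by (simp add: cell_def g_simps)
      ultimately show ?thesis unfolding h by (simp only:)
    next
      case 1
      show ?thesis unfolding h unfolding 1 cell_def num_items_def by simp
    next
      case 2
      show ?thesis unfolding h unfolding 2 cell_def by (simp add: g_simps)
    qed
  next
    case False
    let ?z = "a - (d + 2)"
    let ?p = "?z div (d + 1)" and ?j = "?z mod (d + 1)"
    have z: "?z < ?N * (d + 1)" using a False by (simp add: enc_len_def num_items_def g_simps)
    then have p: "?p < ?N" by (simp add: div_less_iff_less_mult)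
    have j: "?j < d + 1" by simp
    have "encode_knapsack d knapsack_instance ! a = concat ?bs ! ?z"
      unfolding enc using False by (simp only: nth_append lh if_False)
    also have "concat ?bs ! ?z = concat ?bs ! (?p * (d + 1) + ?j)" by (simp only: div_mult_mod_eq)
    also have "\<dots> = ?bs ! ?p ! ?j" by (rule nth_concat_uniform[OF u]) (use p j in simp_all)
    also have "?bs ! ?p = ?b ?p" using p by simp
    also have "?b ?p ! ?j = (if ?j = 0 then 1 else column_cost g \<mu> ?p (?j - 1))"
    proof (cases "?j = 0")
      case True
      then show ?thesis by (simp add: instance_simps)
    next
      case False
      have "?b ?p ! ?j = map (cost knapsack_instance ?p) [1..<d + 1] ! (?j - 1)"
        using False by (simp only: nth_Cons' if_False)
      also have "\<dots> = cost knapsack_instance ?p ([1..<d + 1] ! (?j - 1))"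
      proof (rule nth_map)
        have "x - 1 < length [1..<d + 1]" if "x \<noteq> 0" "x < d + 1" for x using that by auto
        then show "?j - 1 < length [1..<d + 1]" using False j by blast
      qed
      also have "[1..<d + 1] ! (?j - 1) = ?j" using False j by (subst nth_upt) linarith+
      finally have "?b ?p ! ?j = cost knapsack_instance ?p ?j" .
      then show ?thesis using False by (simp only: instance_simps(3) if_False)
    qed
    finally show ?thesis using False by (simp add: cell_def g_simps)
  qed
qed

text \<open>Lets the guarantees of the approximation algorithm, which speak about
  \<open>initial\<close>, apply to the memory that the reduction program builds.\<close>

lemma initial_encode: "initial (encode_knapsack d knapsack_instance) = (\<lambda>_. 0, enc_mem g \<mu>)"
  unfolding initial_def enc_mem_def encode_instance(1) by (auto simp: encode_instance(2))

lemma finite_solutions: "finite {S. knapsack_solution d knapsack_instance S}"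
  by (rule finite_subset[of _ "Pow {..<num_items g}"]) (auto simp: knapsack_solution_def instance_simps)

lemma total_profit_card: "total_profit knapsack_instance S = card S"
  by (simp add: total_profit_def instance_simps)

lemma card_le_OPT:
  assumes "knapsack_solution d knapsack_instance S" shows "card S \<le> knapsack_OPT d knapsack_instance"
proof -
  have "finite {total_profit knapsack_instance S |S. knapsack_solution d knapsack_instance S}"
    using finite_solutions by simp
  then show ?thesis unfolding knapsack_OPT_def
    using assms total_profit_card by (intro Max_ge) auto
qed

lemma solution_column:
  assumes "knapsack_solution d knapsack_instance S" "a < k" "b < k"
  shows "(\<Sum>p\<in>S. pair_cost g \<mu> (p mod k) (p div k) a b) \<le> (if a = b then 1 else 2 ^ n)"
proof -
  let ?j = "a * k + b"
  have "(a + 1) * k \<le> k * k" using assms(2) by (intro mult_le_mono1) simp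
  then have lt: "?j < k * k" using assms(3) by simp
  have "?j + 1 \<in> {1..d}" using lt d by (simp add: k_def)
  with assms(1) have "(\<Sum>p\<in>S. column_cost g \<mu> p ?j) \<le> column_budget g ?j"
    unfolding knapsack_solution_def instance_simps by fastforce
  moreover have "?j div k = a" "?j mod k = b" using assms(3) by simp_all
  ultimately show ?thesis using lt by (cases "a = b") (simp_all add: column_cost_def column_budget_def g_simps)
qed

text \<open>Restrict \<open>\<sigma>\<close> to each part and take the corresponding item. Dimension
  \<open>(a, a)\<close> then costs 1, and for \<open>a \<noteq> b\<close> both shared values are the
  same number \<open>s\<close>, so the cost s + (2^n - s) meets the budget exactly.\<close>

lemma completeness:
  assumes sat: "\<And>c. c < length cs \<Longrightarrow> \<exists>l\<in>set (cs ! c). lit_true \<sigma> l"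
  shows "k \<le> knapsack_OPT d knapsack_instance"
proof -
  have "\<exists>X. \<forall>i. X i < g 6 \<and> (\<forall>v. in_vars g \<mu> i v \<longrightarrow> (assigned g \<mu> i (X i) v \<longleftrightarrow> \<sigma> v))"
    by (rule choice, rule allI, rule ex_assigned[of _ \<sigma>, simplified])
  then obtain X where X: "\<And>i. X i < g 6" "\<And>i v. in_vars g \<mu> i v \<Longrightarrow> assigned g \<mu> i (X i) v \<longleftrightarrow> \<sigma> v"
    by blast
  define it where "it i = X i * k + i" for i
  have it: "it i mod k = i" "it i div k = X i" if "i < k" for i using that by (simp_all add: it_def)
  have inj: "inj_on it {..<k}" by (rule inj_onI) (metis it(1) lessThan_iff)
  have sats: "satisfies g \<mu> i (X i)" for i
  proof (unfold satisfies_iff, intro allI impI)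
    fix c assume c: "c < length cs" "in_part g i c"
    obtain l where l: "l \<in> set (cs ! c)" "lit_true \<sigma> l" using sat[OF c(1)] by blast
    have "in_vars g \<mu> i (var l)" unfolding in_vars_iff using c l(1) by blast
    then have "lit_true (assigned g \<mu> i (X i)) l" using X(2) l(2) by (cases l) simp_all
    then show "\<exists>l\<in>set (cs ! c). lit_true (assigned g \<mu> i (X i)) l" using l(1) by blast
  qed
  have shared: "shared_value g \<mu> a b (X a) = shared_value g \<mu> b a (X b)" for a b
  proof -
    have "{v. in_vars g \<mu> a v \<and> in_vars g \<mu> b v \<and> assigned g \<mu> a (X a) v} =
      {v. in_vars g \<mu> b v \<and> in_vars g \<mu> a v \<and> assigned g \<mu> b (X b) v}" using X(2) by blast
    then show ?thesis unfolding shared_value_eq by simp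
  qed
  have pair: "(\<Sum>i<k. pair_cost g \<mu> i (X i) a b) \<le> (if a = b then 1 else 2 ^ n)" if "a < k" "b < k" for a b
  proof (cases "a = b")
    case True
    have "(\<Sum>i<k. pair_cost g \<mu> i (X i) a b) = (\<Sum>i<k. if i = a then 1 else 0)"
      using True sats by (intro sum.cong refl) (simp add: pair_cost_def)
    then show ?thesis using True that by simp
  next
    case False
    have "(\<Sum>i<k. pair_cost g \<mu> i (X i) a b) =
        (\<Sum>i<k. (if i = a then shared_value g \<mu> a b (X a) else 0) +
          (if i = b then 2 ^ n - shared_value g \<mu> b a (X b) else 0))"
      using False by (intro sum.cong refl) (simp add: pair_cost_def g_simps)
    also have "\<dots> = shared_value g \<mu> a b (X a) + (2 ^ n - shared_value g \<mu> b a (X b))"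
      using that by (simp add: sum.distrib)
    also have "\<dots> = 2 ^ n" using shared[of a b] shared_value_less[of g \<mu> b a "X b"] by (simp add: g_simps)
    finally show ?thesis using False by simp
  qed
  have "knapsack_solution d knapsack_instance (it ` {..<k})"
    unfolding knapsack_solution_def instance_simps
  proof (intro conjI ballI)
    show "it ` {..<k} \<subseteq> {..<num_items g}"
    proof
      fix p assume "p \<in> it ` {..<k}"
      then obtain i where i: "i < k" "p = it i" by auto
      have "(X i + 1) * k \<le> g 6 * k" using X(1)[of i] by (intro mult_le_mono1) simp
      then show "p \<in> {..<num_items g}" using i by (simp add: it_def num_items_def g_simps(4) mult.commute[of k])
    qed
    fix j assume "j \<in> {1..d}"
    let ?j = "j - 1"
    have eq: "(\<Sum>p\<in>it ` {..<k}. column_cost g \<mu> p ?j) = (\<Sum>i<k. column_cost g \<mu> (it i) ?j)"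
      using inj by (simp add: sum.reindex)
    show "(\<Sum>p\<in>it ` {..<k}. column_cost g \<mu> p ?j) \<le> column_budget g ?j"
    proof (cases "?j < k * k")
      case True
      then have "?j div k < k" by (simp add: div_less_iff_less_mult k_pos)
      moreover have "?j mod k < k" using k_pos by simp
      moreover have "(\<Sum>i<k. column_cost g \<mu> (it i) ?j) =
          (\<Sum>i<k. pair_cost g \<mu> i (X i) (?j div k) (?j mod k))"
        using True it by (intro sum.cong refl) (simp add: column_cost_def g_simps)
      ultimately show ?thesis unfolding eq using pair[of "?j div k" "?j mod k"]
        by (cases "?j div k = ?j mod k") (simp_all add: column_budget_def g_simps)
    next
      case False
      then show ?thesis unfolding eq by (simp add: column_cost_def g_simps)
    qed
  qed
  from card_le_OPT[OF this] show ?thesis using inj by (simp add: card_image)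
qed

text \<open>In a block of \<open>k ^ q\<close> consecutive indices, (k - card R)^q of them have no
  digit in \<open>R\<close>. Rounding the number of blocks up at most doubles it, because there is
  at least one full block; this is the 2 in \<open>2 * (1 - \<rho>) ^ q\<close>. With fewer than
  \<open>k ^ q\<close> clauses any single part covers everything.\<close>

lemma uncovered_le:
  fixes \<rho> \<epsilon> :: real
  assumes R: "R \<subseteq> {..<k}" "R \<noteq> {}" "real (card R) \<ge> \<rho> * real k"
    and \<rho>: "0 < \<rho>" "\<rho> < 1" and \<epsilon>: "2 * (1 - \<rho>) ^ q \<le> \<epsilon>"
  shows "real (card {c. c < length cs \<and> (\<forall>i\<in>R. \<not> in_part g i c)}) \<le> \<epsilon> * real (length cs)"
proof (cases "length cs < k ^ q")
  case True
  have "0 \<le> 2 * (1 - \<rho>) ^ q" using \<rho> by simp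
  then have "0 \<le> \<epsilon>" using \<epsilon> by linarith
  moreover have "{c. c < length cs \<and> (\<forall>i\<in>R. \<not> in_part g i c)} = {}" using True R(2) by (auto simp: in_part_iff)
  ultimately show ?thesis by (simp only: card.empty of_nat_0) simp
next
  case False
  let ?L = "k ^ q" and ?m = "length cs"
  have L: "0 < ?L" using k_pos by simp
  have "{c. c < ?m \<and> (\<forall>i\<in>R. \<not> in_part g i c)} \<subseteq> {c. c < ?m \<and> (\<forall>t<q. c div k ^ t mod k \<notin> R)}"
    by (auto simp: in_part_iff)
  then have "card {c. c < ?m \<and> (\<forall>i\<in>R. \<not> in_part g i c)} \<le> card {c. c < ?m \<and> (\<forall>t<q. c div k ^ t mod k \<notin> R)}"
    by (intro card_mono) auto
  also have "\<dots> \<le> (k - card R) ^ q * (?m div ?L + 1)"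
  proof (rule card_avoid_digits_le[OF k_pos R(1)])
    have "?m = ?m div ?L * ?L + ?m mod ?L" by (rule div_mult_mod_eq[symmetric])
    moreover have "?m mod ?L < ?L" using L by simp
    ultimately show "?m \<le> (?m div ?L + 1) * ?L" unfolding add_mult_distrib by linarith
  qed
  finally have "real (card {c. c < ?m \<and> (\<forall>i\<in>R. \<not> in_part g i c)}) \<le> real ((k - card R) ^ q * (?m div ?L + 1))"
    by (rule of_nat_mono)
  also have "\<dots> = real (k - card R) ^ q * (real (?m div ?L) + 1)"
    by (simp only: of_nat_mult of_nat_power of_nat_add of_nat_1)
  also have "\<dots> \<le> ((1 - \<rho>) * real k) ^ q * (2 * (real ?m / real ?L))"
  proof (rule mult_mono)
    have "card R \<le> k" using card_mono[OF _ R(1)] by simp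
    then show "real (k - card R) ^ q \<le> ((1 - \<rho>) * real k) ^ q"
      using R(3) by (intro power_mono) (simp_all add: of_nat_diff algebra_simps)
    have "1 \<le> real ?m / real ?L" using False L by (simp add: le_divide_eq del: of_nat_power)
    moreover have "real (?m div ?L) \<le> real ?m / real ?L" by (rule of_nat_div_le_of_nat)
    ultimately show "real (?m div ?L) + 1 \<le> 2 * (real ?m / real ?L)" by linarith
  qed (use \<rho> in simp_all)
  also have "\<dots> = 2 * (1 - \<rho>) ^ q * real ?m" using k_pos by (simp add: power_mult_distrib)
  also have "\<dots> \<le> \<epsilon> * real ?m" using \<epsilon> by (rule mult_right_mono) simp
  finally show ?thesis .
qed

text \<open>The chosen items belong to distinct parts, satisfy the clauses of their parts and agree
  on common variables. Hence they glue to one assignment, which can violate only clauses outside all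
  chosen parts.\<close>

lemma soundness:
  fixes \<rho> \<epsilon> :: real
  assumes S: "knapsack_solution d knapsack_instance S" and card: "real (card S) \<ge> \<rho> * real k"
    and \<rho>: "0 < \<rho>" "\<rho> < 1" and \<epsilon>: "2 * (1 - \<rho>) ^ q \<le> \<epsilon>"
  shows "\<exists>\<sigma>. real (card {c. c < length cs \<and> (\<exists>l\<in>set (cs ! c). lit_true \<sigma> l)}) \<ge> (1 - \<epsilon>) * real (length cs)"
proof -
  have fin: "finite S" using S by (auto simp: knapsack_solution_def instance_simps intro: finite_subset)
  define R where "R = (\<lambda>p. p mod k) ` S"
  \<comment> \<open>Costs are nonnegative, so every subset of the solution respects the budgets;
    singletons and pairs are enough below.\<close>
  have sub: "(\<Sum>p\<in>A. pair_cost g \<mu> (p mod k) (p div k) a b) \<le> (if a = b then 1 else 2 ^ n)"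
    if "A \<subseteq> S" "a < k" "b < k" for A a b
    using sum_mono2[OF fin that(1), of "\<lambda>p. pair_cost g \<mu> (p mod k) (p div k) a b"]
      solution_column[OF S that(2,3)] by linarith
  have mod: "p mod k < k" for p using k_pos by simp
  \<comment> \<open>Each item of part \<open>a\<close> costs at least 1 in dimension
    \<open>(a, a)\<close>, whose budget is 1.\<close>
  have inj: "inj_on (\<lambda>p. p mod k) S"
  proof (rule inj_onI, rule ccontr)
    fix p p' assume p: "p \<in> S" "p' \<in> S" "p mod k = p' mod k" "p \<noteq> p'"
    have "pair_cost g \<mu> (p mod k) (p div k) (p mod k) (p mod k) \<ge> 1"
      "pair_cost g \<mu> (p' mod k) (p' div k) (p mod k) (p mod k) \<ge> 1"
      using p(3) by (simp_all add: pair_cost_def)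
    then show False using sub[of "{p, p'}" "p mod k" "p mod k"] p mod by simp
  qed
  have sats: "satisfies g \<mu> (p mod k) (p div k)" if "p \<in> S" for p
    using sub[of "{p}" "p mod k" "p mod k"] that mod by (simp add: pair_cost_def split: if_splits)
  \<comment> \<open>The dimension of the two parts reads s + (2^n - t) \<le> 2^n, which gives s
    \<le> t; exchanging the parts gives the converse.\<close>
  have le: "shared_value g \<mu> (p mod k) (p' mod k) (p div k) \<le> shared_value g \<mu> (p' mod k) (p mod k) (p' div k)"
    if p: "p \<in> S" "p' \<in> S" "p mod k \<noteq> p' mod k" for p p'
  proof -
    have "p \<noteq> p'" using p by auto
    then show ?thesis using sub[of "{p, p'}" "p mod k" "p' mod k"] p mod
        shared_value_less[of g \<mu> "p' mod k" "p mod k" "p' div k"]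
      by (simp add: pair_cost_def g_simps)
  qed
  have agree: "assigned g \<mu> (p mod k) (p div k) v = assigned g \<mu> (p' mod k) (p' div k) v"
    if p: "p \<in> S" "p' \<in> S" and v: "in_vars g \<mu> (p mod k) v" "in_vars g \<mu> (p' mod k) v" for p p' v
  proof (cases "p mod k = p' mod k")
    case True
    then show ?thesis using inj p by (auto dest: inj_onD)
  next
    case False
    have "shared_value g \<mu> (p mod k) (p' mod k) (p div k) = shared_value g \<mu> (p' mod k) (p mod k) (p' div k)"
      using le[OF p False] le[OF p(2,1)] False by simp
    moreover have "finite {v. in_vars g \<mu> i v \<and> Q v}" for i Q
      by (rule finite_subset[OF _ finite_in_vars[of i]]) auto
    ultimately have "{v. in_vars g \<mu> (p mod k) v \<and> in_vars g \<mu> (p' mod k) v \<and> assigned g \<mu> (p mod k) (p div k) v} =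
        {v. in_vars g \<mu> (p' mod k) v \<and> in_vars g \<mu> (p mod k) v \<and> assigned g \<mu> (p' mod k) (p' div k) v}"
      unfolding shared_value_eq by (simp add: set_encode_eq)
    then show ?thesis using v by blast
  qed
  \<comment> \<open>Variables that occur in no chosen part get the value
    \<open>False\<close>.\<close>
  define \<sigma> where "\<sigma> v \<longleftrightarrow> (\<exists>p\<in>S. in_vars g \<mu> (p mod k) v \<and> assigned g \<mu> (p mod k) (p div k) v)" for v
  have \<sigma>: "\<sigma> v = assigned g \<mu> (p mod k) (p div k) v" if "p \<in> S" "in_vars g \<mu> (p mod k) v" for p v
    unfolding \<sigma>_def using agree that by blast
  have cov: "\<exists>l\<in>set (cs ! c). lit_true \<sigma> l" if c: "c < length cs" and i: "i \<in> R" "in_part g i c" for c i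
  proof -
    obtain p where p: "p \<in> S" "i = p mod k" using i(1) by (auto simp: R_def)
    obtain l where l: "l \<in> set (cs ! c)" "lit_true (assigned g \<mu> i (p div k)) l"
      using sats[OF p(1)] c i(2) unfolding satisfies_iff p(2) by blast
    have "in_vars g \<mu> (p mod k) (var l)" unfolding in_vars_iff using c i(2) l(1) p(2) by blast
    from \<sigma>[OF p(1) this] have "lit_true \<sigma> l" using l(2) p(2) by (cases l) simp_all
    then show ?thesis using l(1) by blast
  qed
  have cR: "card R = card S" unfolding R_def by (rule card_image[OF inj])
  have "0 < \<rho> * real k" using \<rho> k_pos by simp
  then have "S \<noteq> {}" using card by auto
  then have "real (card {c. c < length cs \<and> (\<forall>i\<in>R. \<not> in_part g i c)}) \<le> \<epsilon> * real (length cs)"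
    using card mod cR \<rho> \<epsilon> by (intro uncovered_le[where \<rho> = \<rho>]) (auto simp: R_def)
  moreover have "length cs = card {..<length cs}" by simp
  moreover have "card {..<length cs} \<le> card ({c. c < length cs \<and> (\<exists>l\<in>set (cs ! c). lit_true \<sigma> l)} \<union>
      {c. c < length cs \<and> (\<forall>i\<in>R. \<not> in_part g i c)})"
    using cov by (intro card_mono) auto
  moreover have "\<dots> \<le> card {c. c < length cs \<and> (\<exists>l\<in>set (cs ! c). lit_true \<sigma> l)} +
      card {c. c < length cs \<and> (\<forall>i\<in>R. \<not> in_part g i c)}" by (rule card_Un_le)
  ultimately have "(1 - \<epsilon>) * real (length cs) \<le> real (card {c. c < length cs \<and> (\<exists>l\<in>set (cs ! c). lit_true \<sigma> l)})"
    unfolding left_diff_distrib by linarith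
  then show ?thesis by blast
qed

end

section \<open>Size and running time\<close>

text \<open>Raise \<open>1 + c * n \<le> exp (c * n)\<close> to the power \<open>Suc J\<close>, with
  \<open>c\<close> chosen so that the right-hand side becomes \<open>2 powr (\<eta> * n)\<close>.
  Taking \<open>Suc J\<close> keeps the denominator of \<open>c\<close> positive, and
  \<open>b \<le> 1\<close> allows \<open>n + 1\<close> in place of \<open>n\<close>.\<close>

lemma polynomial_bigo_exp:
  fixes \<eta> :: real assumes "0 < \<eta>"
  shows "(\<lambda>n. (real n + 1) ^ J) \<in> O(\<lambda>n. 2 powr (\<eta> * real n))"
proof -
  define c where "c = \<eta> * ln 2 / real (Suc J)"
  define b where "b = min 1 c"
  have c: "0 < c" using assms by (simp add: c_def)
  then have b: "0 < b" "b \<le> 1" "b \<le> c" by (simp_all add: b_def)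
  have "(real n + 1) ^ J \<le> (1 / b) ^ Suc J * 2 powr (\<eta> * real n)" for n
  proof -
    have "b * real n \<le> c * real n" using b by (intro mult_right_mono) simp_all
    then have "b * (real n + 1) \<le> 1 + c * real n" using b by (simp add: algebra_simps)
    also have "\<dots> \<le> exp (c * real n)" by (rule exp_ge_add_one_self)
    finally have "(b * (real n + 1)) ^ Suc J \<le> exp (c * real n) ^ Suc J"
      using b by (intro power_mono) simp_all
    also have "\<dots> = exp (real (Suc J) * (c * real n))" by (rule exp_of_nat_mult[symmetric])
    also have "real (Suc J) * (c * real n) = \<eta> * real n * ln 2" by (simp add: c_def field_simps)
    also have "exp \<dots> = 2 powr (\<eta> * real n)" by (simp add: powr_def mult.commute)
    finally have "b ^ Suc J * (real n + 1) ^ Suc J \<le> 2 powr (\<eta> * real n)" by (simp only: power_mult_distrib)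
    then have "(real n + 1) ^ Suc J \<le> (1 / b) ^ Suc J * 2 powr (\<eta> * real n)"
      using b by (simp add: power_one_over field_simps del: power_Suc)
    moreover have "(real n + 1) ^ J \<le> (real n + 1) ^ Suc J" by (rule power_increasing) simp_all
    ultimately show ?thesis by linarith
  qed
  then have "norm ((real n + 1) ^ J) \<le> (1 / b) ^ Suc J * norm (2 powr (\<eta> * real n))" for n
    by simp
  then show ?thesis by (intro bigoI[of _ "(1 / b) ^ Suc J"] always_eventually allI)
qed

text \<open>The finitely many exceptions go into the additive constant. A bound at every argument is
  needed because it is applied to the size of each constructed instance, small or not.\<close>

lemma bigo_nat_bound:
  fixes T :: "nat \<Rightarrow> real" and f :: "nat \<Rightarrow> real"
  assumes "T \<in> O(f)" "\<And>x. 0 \<le> f x"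
  shows "\<exists>C1 C2. 0 \<le> C1 \<and> 0 \<le> C2 \<and> (\<forall>x. T x \<le> C1 + C2 * f x)"
proof -
  obtain c where c: "0 < c" "\<forall>\<^sub>F x in at_top. norm (T x) \<le> c * norm (f x)"
    using assms(1) by (rule landau_o.bigE)
  then obtain N where N: "\<And>x. N \<le> x \<Longrightarrow> norm (T x) \<le> c * norm (f x)"
    by (auto simp: eventually_at_top_linorder)
  let ?C = "\<Sum>x<N. \<bar>T x\<bar>"
  have "T x \<le> ?C + c * f x" for x
  proof (cases "x < N")
    case True
    then have "\<bar>T x\<bar> \<le> ?C" by (intro member_le_sum) auto
    moreover have "0 \<le> c * f x" using assms(2) c by simp
    ultimately show ?thesis by linarith
  next
    case False
    then have "T x \<le> c * f x" using N[of x] assms(2)[of x] by simp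
    moreover have "0 \<le> ?C" by (rule sum_nonneg) simp
    ultimately show ?thesis by linarith
  qed
  moreover have "0 \<le> ?C" by (rule sum_nonneg) simp
  ultimately show ?thesis using c(1) by (intro exI[of _ ?C] exI[of _ c]) simp
qed

text \<open>Rounding \<open>k\<close> down to a power of two costs at most a factor 2 in
  \<open>sqrt d \<le> 2 * k\<close>.\<close>

lemma ex_power_of_four: "1 \<le> d \<Longrightarrow> \<exists>\<kappa>. 2 ^ \<kappa> * 2 ^ \<kappa> \<le> d \<and> d < 4 * (2 ^ \<kappa> * 2 ^ \<kappa>)" for d :: nat
proof (induction d rule: less_induct)
  case (less d)
  show ?case
  proof (cases "d < 4")
    case True
    then show ?thesis using less.prems by (intro exI[of _ 0]) simp
  next
    case False
    then have "d div 4 < d" "1 \<le> d div 4" by auto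
    then obtain \<kappa> where "2 ^ \<kappa> * 2 ^ \<kappa> \<le> d div 4" "d div 4 < 4 * (2 ^ \<kappa> * 2 ^ \<kappa>)"
      using less.IH by blast
    then have "2 ^ Suc \<kappa> * 2 ^ Suc \<kappa> \<le> d" "d < 4 * (2 ^ Suc \<kappa> * 2 ^ Suc \<kappa>)" by auto
    then show ?thesis by blast
  qed
qed

context reduction
begin

text \<open>The parameter \<open>W\<close> at which the program is run. It bounds all parameters and
  addresses; the only summand that can be exponential in \<open>n\<close> is
  \<open>k * g 6 * (d + 1)\<close>, the number of row cells.\<close>

definition width :: nat where
  "width = k * g 6 * (d + 1) + d + 4 + 3 * length cs + n + \<kappa> + q + k ^ q + k + 2"

lemma width_bounds:
  "2 \<le> width" "\<forall>i. g i \<le> width" "enc_base g \<le> width" "\<forall>a. \<mu> a \<le> 2 * n + length cs + 1 \<Longrightarrow> \<forall>a. \<mu> a \<le> 2 ^ width"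
proof -
  show "2 \<le> width" by (simp add: width_def)
  have "1 * g 6 * 1 \<le> k * g 6 * (d + 1)" using k_pos by (intro mult_le_mono) simp_all
  then have g6: "g 6 \<le> k * g 6 * (d + 1)" by simp
  show "enc_base g \<le> width" unfolding enc_base_def enc_len_def width_def by (simp add: g_simps(1-4,7))
  show "\<forall>i. g i \<le> width"
  proof
    fix i :: nat
    define j where "j = min i 7"
    have j: "g i = g j" by (simp add: g_def globals_def j_def)
    have "j \<le> 7" by (simp add: j_def)
    then consider "j = 0" | "j = 1" | "j = 2" | "j = 3" | "j = 4" | "j = 5" | "j = 6" | "j = 7" by linarith
    then show "g i \<le> width" unfolding j
    proof cases
      assume "j = 6"
      then show "g j \<le> width" using g6 unfolding width_def by simp
    qed (simp_all add: width_def g_simps)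
  qed
  assume a: "\<forall>a. \<mu> a \<le> 2 * n + length cs + 1"
  have "2 * n + length cs + 1 \<le> 2 ^ width"
  proof -
    have "2 * n + length cs + 1 \<le> 2 * width" by (simp add: width_def)
    also have "\<dots> \<le> 2 * 2 ^ (width - 1)"
    proof -
      have "width \<le> 2 ^ (width - 1)" using less_exp[of "width - 1"] \<open>2 \<le> width\<close> by linarith
      then show ?thesis by simp
    qed
    also have "\<dots> = 2 ^ width" using \<open>2 \<le> width\<close> by (subst power_Suc[symmetric]) simp
    finally show ?thesis .
  qed
  then show "\<forall>a. \<mu> a \<le> 2 ^ width" using a order_trans by blast
qed

text \<open>At most \<open>width\<close> cells of at most \<open>width + 2\<close> symbols. The
  exponent 3 returns as the factor in \<open>3 * \<gamma>\<close> of the time estimate.\<close>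

lemma encoding_size_le: "encoding_size (encode_knapsack d knapsack_instance) \<le> width ^ 3"
proof -
  let ?e = "encode_knapsack d knapsack_instance"
  have len: "enc_len g \<le> width" using width_bounds(3) by (simp add: enc_base_def)
  then have num: "g 2 * g 6 \<le> width" by (simp add: enc_len_def)
  have dig: "digits x + 1 \<le> width + 2" if el: "x \<in> set ?e" for x
  proof -
    obtain a where a: "a < length ?e" "?e ! a = x" using el unfolding in_set_conv_nth by blast
    have "a < enc_len g" using a(1) unfolding encode_instance(1) .
    then have x: "x = cell g \<mu> a" using a(2) encode_instance(2) by simp
    have "x \<le> 2 ^ width"
      unfolding x
    proof (rule cell_le)
      show "2 \<le> width" "g 5 \<le> width" "g 0 \<le> width" using width_bounds(1,2) by simp_all
    qed (rule num)
    then show ?thesis using digits_le_power[of x width] by simp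
  qed
  have "encoding_size ?e \<le> (\<Sum>x\<leftarrow>?e. width + 2)"
    unfolding encoding_size_def by (rule sum_list_mono) (rule dig)
  also have "\<dots> = enc_len g * (width + 2)"
    by (simp only: sum_list_triv encode_instance(1) of_nat_id)
  also have "\<dots> \<le> width * (width * width)"
  proof (rule mult_le_mono[OF len])
    have "width + 2 \<le> 2 * width" using width_bounds(1) by simp
    also have "\<dots> \<le> width * width" using width_bounds(1) by (rule mult_le_mono1)
    finally show "width + 2 \<le> width * width" .
  qed
  finally show ?thesis unfolding power3_eq_cube mult.assoc .
qed

text \<open>With at most \<open>D * n\<close> clauses the exponent in \<open>g 6\<close> is at most
  \<open>3 * q * D / k * n\<close> up to a constant, and its rate decreases with \<open>k\<close>.
  All other summands are constant or linear in \<open>n\<close>.\<close>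

lemma width_le:
  assumes "length cs \<le> D * n"
  shows "real width \<le> real (k * 2 ^ (3 * (q * k ^ q)) * (d + 1) + (d + \<kappa> + q + k ^ q + k + 6) + 3 * D + 1) *
    (real n + 1) * 2 powr (3 * real q * real D / real k * real n)" (is "_ \<le> real ?c * _ * ?E")
proof -
  have E1: "1 \<le> ?E" by (rule ge_one_powr_ge_zero) simp_all
  let ?X = "(real n + 1) * ?E"
  have X1: "1 \<le> ?X" using mult_mono[of 1 "real n + 1" 1 ?E] E1 by simp
  have Xn: "real n \<le> ?X" using mult_mono[of "real n" "real n + 1" 1 ?E] E1 by simp
  have "real (length cs div k) \<le> real D * real n / real k"
  proof -
    have "real (length cs div k) \<le> real (length cs) / real k" by (rule of_nat_div_le_of_nat)
    also have "\<dots> \<le> real D * real n / real k"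
      using assms of_nat_mono[of "length cs" "D * n", where 'a = real] by (intro divide_right_mono) simp_all
    finally show ?thesis .
  qed
  then have "3 * real q * real (length cs div k) \<le> 3 * real q * (real D * real n / real k)"
    by (intro mult_left_mono) simp_all
  then have "2 powr (3 * real q * real (length cs div k)) \<le> ?E"
    by (intro powr_mono) simp_all
  moreover have "real (g 6) = 2 ^ (3 * (q * k ^ q)) * 2 powr (3 * real q * real (length cs div k))"
  proof -
    have "real (g 6) = 2 powr real (3 * (q * (length cs div k + k ^ q)))"
      unfolding g_simps by (simp only: of_nat_power of_nat_numeral powr_realpow zero_less_numeral)
    also have "\<dots> = 2 powr (real (3 * (q * k ^ q)) + 3 * real q * real (length cs div k))"
      by (simp add: algebra_simps)
    also have "\<dots> = 2 powr real (3 * (q * k ^ q)) * 2 powr (3 * real q * real (length cs div k))"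
      by (rule powr_add)
    also have "2 powr real (3 * (q * k ^ q)) = (2::real) ^ (3 * (q * k ^ q))"
      by (rule powr_realpow) simp
    finally show ?thesis .
  qed
  ultimately have g6: "real (g 6) \<le> 2 ^ (3 * (q * k ^ q)) * ?X"
  proof -
    assume a: "2 powr (3 * real q * real (length cs div k)) \<le> ?E"
      and b: "real (g 6) = 2 ^ (3 * (q * k ^ q)) * 2 powr (3 * real q * real (length cs div k))"
    have "?E \<le> ?X" using E1 by (simp add: mult_le_cancel_right1)
    with a have "2 powr (3 * real q * real (length cs div k)) \<le> ?X" by (rule order_trans)
    then show ?thesis unfolding b by (rule mult_left_mono) simp
  qed
  have "real (length cs) \<le> real D * ?X"
  proof -
    have "real (length cs) \<le> real D * real n" using assms by (metis of_nat_mono of_nat_mult)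
    also have "\<dots> \<le> real D * ?X" using Xn by (intro mult_left_mono) simp_all
    finally show ?thesis .
  qed
  moreover have "real (k * g 6 * (d + 1)) \<le> real (k * 2 ^ (3 * (q * k ^ q)) * (d + 1)) * ?X"
  proof -
    have "real (k * g 6 * (d + 1)) = real (k * (d + 1)) * real (g 6)" by (simp add: algebra_simps)
    also have "\<dots> \<le> real (k * (d + 1)) * (2 ^ (3 * (q * k ^ q)) * ?X)"
      using g6 by (rule mult_left_mono) simp
    also have "\<dots> = real (k * 2 ^ (3 * (q * k ^ q)) * (d + 1)) * ?X" by (simp add: algebra_simps)
    finally show ?thesis .
  qed
  moreover have "real (d + \<kappa> + q + k ^ q + k + 6) \<le> real (d + \<kappa> + q + k ^ q + k + 6) * ?X"
    using mult_left_mono[OF X1 of_nat_0_le_iff[of "d + \<kappa> + q + k ^ q + k + 6"]] by (simp only: mult_1_right)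
  moreover have "real width = real (k * g 6 * (d + 1)) + real (d + \<kappa> + q + k ^ q + k + 6) + 3 * real (length cs) + real n"
    unfolding width_def by simp
  ultimately have "real width \<le> real (k * 2 ^ (3 * (q * k ^ q)) * (d + 1)) * ?X +
      real (d + \<kappa> + q + k ^ q + k + 6) * ?X + 3 * (real D * ?X) + ?X"
    using Xn by linarith
  also have "\<dots> = real ?c * ?X"
    unfolding of_nat_add of_nat_mult[of 3] by (simp only: distrib_right of_nat_numeral of_nat_1 mult_1 mult.assoc)
  finally show ?thesis by (simp only: mult.assoc)
qed

end

section \<open>The reduction as a decision procedure\<close>

lemma SAT_set_finite: "finite {card {c \<in> clauses \<phi>. \<exists>l\<in>c. lit_true \<sigma> l} |\<sigma>. True}"
  if "finite (clauses \<phi>)"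
  by (rule finite_subset[of _ "{..card (clauses \<phi>)}"]) (use that in \<open>auto intro!: card_mono\<close>)

lemma SAT_ge: "finite (clauses \<phi>) \<Longrightarrow> card {c \<in> clauses \<phi>. \<exists>l\<in>c. lit_true \<sigma> l} \<le> SAT \<phi>"
  unfolding SAT_def by (rule Max_ge[OF SAT_set_finite]) auto

lemma SAT_attained:
  assumes "finite (clauses \<phi>)" "SAT \<phi> = card (clauses \<phi>)"
  shows "\<exists>\<sigma>. \<forall>c\<in>clauses \<phi>. \<exists>l\<in>c. lit_true \<sigma> l"
proof -
  have "SAT \<phi> \<in> {card {c \<in> clauses \<phi>. \<exists>l\<in>c. lit_true \<sigma> l} |\<sigma>. True}"
    unfolding SAT_def by (rule Max_in[OF SAT_set_finite[OF assms(1)]]) auto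
  then obtain \<sigma> where "card {c \<in> clauses \<phi>. \<exists>l\<in>c. lit_true \<sigma> l} = card (clauses \<phi>)" using assms(2) by auto
  then have "{c \<in> clauses \<phi>. \<exists>l\<in>c. lit_true \<sigma> l} = clauses \<phi>"
    by (intro card_subset_eq[OF assms(1)]) auto
  then show ?thesis by blast
qed

text \<open>The bound \<open>length cs \<le> D * n\<close> holds since each clause contains some
  variable and each variable lies in at most \<open>D\<close> clauses. It converts part sizes,
  counted in clauses, into the measure \<open>n\<close> of Gap-ETH.\<close>

lemma decoded_cnf:
  assumes "sat3_instance D \<phi>" "encodes_cnf xs \<phi>"
  obtains n cs where "vars \<phi> = {..<n}" "clauses \<phi> = set ` set cs" "distinct (map set cs)"
    "xs = n # length cs # concat (map (map lit_code) cs)"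
    "\<And>C. C \<in> set cs \<Longrightarrow> length C = 3" "\<And>C l. C \<in> set cs \<Longrightarrow> l \<in> set C \<Longrightarrow> var l < n"
    "card (clauses \<phi>) = length cs" "length cs \<le> D * n"
proof -
  obtain n cs where 1: "vars \<phi> = {..<n}" "clauses \<phi> = set ` set cs" "distinct (map set cs)"
    "\<forall>c\<in>set cs. distinct c" "xs = n # length cs # concat (map (map lit_code) cs)"
    using assms(2) unfolding encodes_cnf_def by blast
  have cl: "card (set C) = 3" "var ` set C \<subseteq> {..<n}" if "C \<in> set cs" for C
    using assms(1) that unfolding sat3_instance_def 1(1,2) by auto
  have len: "length C = 3" if "C \<in> set cs" for C using cl(1)[OF that] 1(4) that distinct_card by metis
  have vars: "var l < n" if "C \<in> set cs" "l \<in> set C" for C l using cl(2)[OF that(1)] that(2) by auto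
  have card: "card (clauses \<phi>) = length cs"
    using distinct_card[OF 1(3)] unfolding 1(2) by simp
  have "clauses \<phi> = (\<Union>v<n. {c \<in> clauses \<phi>. v \<in> var ` c})"
  proof -
    have "\<exists>v<n. v \<in> var ` c" if c: "c \<in> clauses \<phi>" for c
    proof -
      obtain C where C: "C \<in> set cs" "c = set C" using c 1(2) by auto
      then have "C \<noteq> []" using len by fastforce
      then have "hd C \<in> set C" by simp
      then show ?thesis using vars C by blast
    qed
    then show ?thesis by blast
  qed
  then have "card (clauses \<phi>) \<le> (\<Sum>v<n. card {c \<in> clauses \<phi>. v \<in> var ` c})"
    using card_UN_le[of "{..<n}" "\<lambda>v. {c \<in> clauses \<phi>. v \<in> var ` c}"] by simp
  also have "\<dots> \<le> (\<Sum>v<n. D)"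
    using assms(1) unfolding sat3_instance_def 1(1) by (intro sum_mono) simp
  finally have "length cs \<le> D * n" unfolding card by (simp add: mult.commute)
  from that[OF 1(1-3,5) len vars card this] show ?thesis .
qed

text \<open>Parts are formed from list positions while \<open>SAT\<close> counts sets; distinctness
  of the clause sets makes the two counts agree.\<close>

lemma card_clauses_nth:
  assumes "distinct (map set cs)"
  shows "card {c \<in> set ` set cs. P c} = card {i. i < length cs \<and> P (set (cs ! i))}"
proof -
  have "inj_on (\<lambda>i. set (cs ! i)) {i. i < length cs \<and> P (set (cs ! i))}"
    using assms by (auto simp: inj_on_def distinct_conv_nth)
  moreover have "(\<lambda>i. set (cs ! i)) ` {i. i < length cs \<and> P (set (cs ! i))} = {c \<in> set ` set cs. P c}"
  proof -
    have "set cs = (!) cs ` {..<length cs}" by (auto simp: set_conv_nth)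
    then show ?thesis by auto
  qed
  ultimately show ?thesis using card_image by fastforce
qed

lemma ex_power_le:
  fixes x y :: real assumes "0 \<le> x" "x < 1" "0 < y" shows "\<exists>q\<ge>1. 2 * x ^ q \<le> y"
proof -
  obtain q where q: "x ^ q < y / 2" using real_arch_pow_inv[of "y / 2" x] assms by auto
  have "x ^ Suc q \<le> x ^ q" using assms by (intro power_decreasing) simp_all
  then have "2 * x ^ Suc q \<le> y" using q by linarith
  then show ?thesis by (intro exI[of _ "Suc q"]) simp
qed

text \<open>A satisfiable formula has optimum at least \<open>k\<close>, so the algorithm selects at
  least \<open>\<rho> * k\<close> items and meets the threshold; meeting it yields a good assignment
  by soundness. The size \<open>x\<close> is kept explicitly because \<open>TA\<close> need not be
  monotone.\<close>

lemma reduction_decides: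
  assumes red: "reduction n \<kappa> q d cs \<mu>" and \<mu>W: "\<forall>a. \<mu> a \<le> 2 * n + length cs + 1"
    and z: "\<forall>a. 2 + 3 * length cs \<le> a \<longrightarrow> \<mu> a = 0"
    and B: "\<forall>W \<mu> TA sA. (let g = globals (2 ^ \<kappa>) \<kappa> q d ((2 ^ \<kappa>) ^ q) \<mu> in
      2 \<le> W \<and> (\<forall>i. g i \<le> W) \<and> enc_base g \<le> W \<and> (\<forall>a. \<mu> a \<le> 2 ^ W) \<and>
      (\<forall>a. 2 + 3 * \<mu> 1 \<le> a \<longrightarrow> \<mu> a = 0) \<and> exec A (\<lambda>_. 0, enc_mem g \<mu>) TA sA \<longrightarrow>
      (\<exists>T s. exec B (\<lambda>_. 0, \<mu>) T s \<and> T \<le> DB * (TA + 1) * p W \<and>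
        (reg s 0 \<noteq> 0 \<longleftrightarrow> nat \<lceil>\<rho> * real (2 ^ \<kappa>)\<rceil> \<le> card {i. i < num_items g \<and> mem sA i \<noteq> 0})))"
    and A: "knapsack_approximation \<rho> d A" "knapsack_time d A TA"
    and \<rho>: "0 < \<rho>" "\<rho> < 1" and \<epsilon>: "2 * (1 - \<rho>) ^ q \<le> \<epsilon>"
  shows "\<exists>T s x. exec B (\<lambda>_. 0, \<mu>) T s \<and> x \<le> reduction.width n \<kappa> q d cs \<mu> ^ 3 \<and>
    real T \<le> real DB * (TA x + 1) * real (p (reduction.width n \<kappa> q d cs \<mu>)) \<and>
    ((\<exists>\<sigma>. \<forall>c<length cs. \<exists>l\<in>set (cs ! c). lit_true \<sigma> l) \<longrightarrow> accepts s) \<and>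
    ((\<forall>\<sigma>. real (card {c. c < length cs \<and> (\<exists>l\<in>set (cs ! c). lit_true \<sigma> l)}) < (1 - \<epsilon>) * real (length cs)) \<longrightarrow>
      \<not> accepts s)"
proof -
  interpret reduction n \<kappa> q d cs \<mu> by (rule red)
  let ?I = knapsack_instance
  let ?e = "encode_knapsack d ?I"
  obtain t sA where A1: "exec A (\<lambda>_. 0, enc_mem g \<mu>) t sA"
      "knapsack_solution d ?I (output_items ?I sA)"
      "real (total_profit ?I (output_items ?I sA)) \<ge> \<rho> * real (knapsack_OPT d ?I)"
    using A(1) numbered_instance initial_encode unfolding knapsack_approximation_def by metis
  obtain t' sA' where A2: "exec A (\<lambda>_. 0, enc_mem g \<mu>) t' sA'" "real t' \<le> TA (encoding_size ?e)"
    using A(2) numbered_instance initial_encode unfolding knapsack_time_def by metis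
  \<comment> \<open>Correctness and running time each provide a run of \<open>A\<close>; by
    determinism these are the same run.\<close>
  have t: "real t \<le> TA (encoding_size ?e)" using A2 exec_deterministic[OF A1(1) A2(1)] by simp
  have gk: "globals (2 ^ \<kappa>) \<kappa> q d ((2 ^ \<kappa>) ^ q) \<mu> = g" unfolding g_def k_def ..
  have "\<exists>T s. exec B (\<lambda>_. 0, \<mu>) T s \<and> T \<le> DB * (t + 1) * p width \<and>
      (reg s 0 \<noteq> 0 \<longleftrightarrow> nat \<lceil>\<rho> * real (2 ^ \<kappa>)\<rceil> \<le> card {i. i < num_items g \<and> mem sA i \<noteq> 0})"
    using B[rule_format, of \<mu> width t sA] width_bounds(1-3) width_bounds(4)[OF \<mu>W] z A1(1)
    unfolding gk Let_def mem_1 by blast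
  then obtain T s where T: "exec B (\<lambda>_. 0, \<mu>) T s" "T \<le> DB * (t + 1) * p width"
    and s: "reg s 0 \<noteq> 0 \<longleftrightarrow> nat \<lceil>\<rho> * real (2 ^ \<kappa>)\<rceil> \<le> card {i. i < num_items g \<and> mem sA i \<noteq> 0}" by blast
  have "{i. i < num_items g \<and> mem sA i \<noteq> 0} = output_items ?I sA"
    by (auto simp: output_items_def instance_simps)
  then have acc: "accepts s \<longleftrightarrow> \<rho> * real k \<le> real (card (output_items ?I sA))"
    unfolding accepts_def s k_def by (simp add: nat_le_iff ceiling_le_iff)
  have "accepts s" if sat: "\<forall>c<length cs. \<exists>l\<in>set (cs ! c). lit_true \<sigma> l" for \<sigma>
  proof -
    have "k \<le> knapsack_OPT d ?I" using sat by (intro completeness[of \<sigma>]) blast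
    then have "\<rho> * real k \<le> \<rho> * real (knapsack_OPT d ?I)" using \<rho> by (intro mult_left_mono) simp_all
    then show ?thesis unfolding acc using A1(3) unfolding total_profit_card by linarith
  qed
  moreover have "\<not> accepts s"
    if unsat: "\<forall>\<sigma>. real (card {c. c < length cs \<and> (\<exists>l\<in>set (cs ! c). lit_true \<sigma> l)}) < (1 - \<epsilon>) * real (length cs)"
  proof
    assume "accepts s"
    then have "\<rho> * real k \<le> real (card (output_items ?I sA))" using acc by simp
    from soundness[OF A1(2) this \<rho> \<epsilon>] show False using unsat by (meson not_le)
  qed
  moreover have "real T \<le> real DB * (TA (encoding_size ?e) + 1) * real (p width)"
  proof -
    have "real T \<le> real (DB * (t + 1) * p width)" using T(2) by (rule of_nat_mono)
    also have "\<dots> = real DB * (real t + 1) * real (p width)" by (simp add: algebra_simps)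
    also have "\<dots> \<le> real DB * (TA (encoding_size ?e) + 1) * real (p width)"
      using t by (intro mult_right_mono mult_left_mono) simp_all
    finally show ?thesis .
  qed
  ultimately show ?thesis using T(1) encoding_size_le by blast
qed

text \<open>The algorithm contributes w^(3 \<gamma>) and the overhead w^K. Each turns the factor
  \<open>2 powr (\<beta> * n)\<close> of \<open>w\<close> into at most
  \<open>2 powr (\<eta> * n)\<close>, and \<open>Y\<close> contributes a power with natural exponent
  \<open>J + K\<close>, hence a polynomial when \<open>Y\<close> is linear in
  \<open>n\<close>.\<close>

lemma time_estimate:
  fixes Y \<beta> \<gamma> \<eta> C1 C2 Tx :: real and n w x K J P :: nat
  assumes w: "1 \<le> w" "real w \<le> Y * 2 powr (\<beta> * real n)" and Y: "1 \<le> Y" and \<beta>: "0 \<le> \<beta>"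
    and x: "x \<le> w ^ 3" and P: "P \<le> w ^ K" and Tx: "Tx \<le> C1 + C2 * real x powr \<gamma>" and C: "0 \<le> C1" "0 \<le> C2"
    and \<gamma>: "0 \<le> \<gamma>" "3 * \<gamma> \<le> real J" and \<eta>: "\<beta> * (3 * \<gamma>) \<le> \<eta>" "\<beta> * real K \<le> \<eta>"
  shows "(Tx + 1) * real P \<le> (C1 + C2 + 1) * (Y ^ (J + K) * 2 powr (2 * \<eta> * real n))"
proof -
  let ?E = "2 powr (\<beta> * real n)" and ?H = "2 powr (\<eta> * real n)"
  have \<eta>0: "0 \<le> \<eta>" using \<eta>(2) \<beta> by (meson mult_nonneg_nonneg of_nat_0_le_iff order_trans)
  have H1: "1 \<le> ?H" by (rule ge_one_powr_ge_zero) (simp_all add: \<eta>0)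
  have E0: "0 < ?E" by simp
  have Y1: "1 \<le> Y ^ J" using Y by (rule one_le_power)
  have "real x powr \<gamma> \<le> (real w ^ 3) powr \<gamma>"
    using x \<gamma> of_nat_mono[of x "w ^ 3", where 'a = real] by (intro powr_mono2) simp_all
  also have "(real w ^ 3) powr \<gamma> = real w powr (3 * \<gamma>)"
  proof -
    have "real w ^ 3 = real w powr real 3" by (rule powr_realpow[symmetric]) (use w(1) in simp)
    then show ?thesis by (simp only: powr_powr of_nat_numeral)
  qed
  also have "\<dots> \<le> (Y * ?E) powr (3 * \<gamma>)" using w \<gamma> by (intro powr_mono2) simp_all
  also have "\<dots> = Y powr (3 * \<gamma>) * 2 powr (\<beta> * (3 * \<gamma>) * real n)"
  proof -
    have "(Y * ?E) powr (3 * \<gamma>) = Y powr (3 * \<gamma>) * ?E powr (3 * \<gamma>)" by (rule powr_mult)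
    moreover have "\<beta> * real n * (3 * \<gamma>) = \<beta> * (3 * \<gamma>) * real n" by simp
    ultimately show ?thesis by (simp only: powr_powr)
  qed
  also have "\<dots> \<le> Y ^ J * ?H"
  proof (rule mult_mono)
    have "Y powr (3 * \<gamma>) \<le> Y powr real J" using Y \<gamma>(2) by (intro powr_mono) simp_all
    then show "Y powr (3 * \<gamma>) \<le> Y ^ J" using Y by (simp add: powr_realpow)
    show "2 powr (\<beta> * (3 * \<gamma>) * real n) \<le> ?H" using \<eta>(1) by (intro powr_mono mult_right_mono) simp_all
  qed (use Y in simp_all)
  finally have xb: "real x powr \<gamma> \<le> Y ^ J * ?H" .
  have 1: "1 \<le> Y ^ J * ?H" using mult_mono[OF Y1 H1] Y1 by simp
  have "Tx + 1 \<le> C1 * 1 + C2 * (Y ^ J * ?H) + 1 * 1"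
    using Tx mult_left_mono[OF xb C(2)] by simp
  also have "\<dots> \<le> C1 * (Y ^ J * ?H) + C2 * (Y ^ J * ?H) + 1 * (Y ^ J * ?H)"
    using 1 C Y by (intro add_mono mult_left_mono) simp_all
  also have "\<dots> = (C1 + C2 + 1) * (Y ^ J * ?H)" by (simp add: algebra_simps)
  finally have T: "Tx + 1 \<le> (C1 + C2 + 1) * (Y ^ J * ?H)" .
  have "real P \<le> real w ^ K" using of_nat_mono[OF P, where 'a = real] by simp
  also have "\<dots> \<le> (Y * ?E) ^ K" using w by (intro power_mono) simp_all
  also have "\<dots> = Y ^ K * 2 powr (\<beta> * real K * real n)"
  proof -
    have "?E ^ K = ?E powr real K" by (rule powr_realpow[symmetric]) simp
    moreover have "\<beta> * real n * real K = \<beta> * real K * real n" by simp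
    ultimately show ?thesis by (simp only: power_mult_distrib powr_powr)
  qed
  also have "\<dots> \<le> Y ^ K * ?H"
    using \<eta>(2) Y by (intro mult_left_mono powr_mono mult_right_mono) simp_all
  finally have PK: "real P \<le> Y ^ K * ?H" .
  have "(Tx + 1) * real P \<le> ((C1 + C2 + 1) * (Y ^ J * ?H)) * (Y ^ K * ?H)"
    using T PK C Y by (intro mult_mono) simp_all
  also have "\<dots> = (C1 + C2 + 1) * (Y ^ (J + K) * (?H * ?H))" by (simp add: power_add algebra_simps)
  also have "?H * ?H = 2 powr (2 * \<eta> * real n)"
  proof -
    have "?H * ?H = 2 powr (\<eta> * real n + \<eta> * real n)" by (rule powr_add[symmetric])
    moreover have "\<eta> * real n + \<eta> * real n = 2 * \<eta> * real n" by simp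
    ultimately show ?thesis by (simp only:)
  qed
  finally show ?thesis .
qed

lemma cnf_reduction:
  assumes "xs = n # length cs # concat (map (map lit_code) cs)"
    "\<And>C. C \<in> set cs \<Longrightarrow> length C = 3" "\<And>C l. C \<in> set cs \<Longrightarrow> l \<in> set C \<Longrightarrow> var l < n"
    and "1 \<le> q" "2 ^ \<kappa> * 2 ^ \<kappa> \<le> d"
  shows "reduction n \<kappa> q d cs (mem (initial xs))"
    and "\<forall>a. mem (initial xs) a \<le> 2 * n + length cs + 1"
    and "\<forall>a. 2 + 3 * length cs \<le> a \<longrightarrow> mem (initial xs) a = 0"
proof -
  let ?ls = "map (map lit_code) cs"
  have u: "\<forall>x\<in>set ?ls. length x = 3" using assms(2) by simp
  have len: "length xs = 2 + 3 * length cs" using length_concat_uniform[OF u] assms(1) by simp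
  then show "\<forall>a. 2 + 3 * length cs \<le> a \<longrightarrow> mem (initial xs) a = 0" by (simp add: initial_def)
  have code: "lit_code l \<le> 2 * n + length cs + 1" if "var l < n" for l using that by (cases l) simp_all
  have "\<forall>x\<in>set xs. x \<le> 2 * n + length cs + 1" unfolding assms(1) using assms(3) code by auto
  then show "\<forall>a. mem (initial xs) a \<le> 2 * n + length cs + 1" by (simp add: initial_def)
  show "reduction n \<kappa> q d cs (mem (initial xs))"
  proof
    show "mem (initial xs) 0 = n" "mem (initial xs) 1 = length cs" using assms(1) by (simp_all add: initial_def)
    fix c t :: nat assume ct: "c < length cs" "t < 3"
    have "mem (initial xs) (2 + (3 * c + t)) = xs ! (2 + (3 * c + t))" using ct len by (simp add: initial_def)
    also have "\<dots> = concat ?ls ! (c * 3 + t)" unfolding assms(1) by (simp add: mult.commute)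
    also have "\<dots> = ?ls ! c ! t" by (rule nth_concat_uniform[OF u]) (use ct in simp_all)
    also have "\<dots> = lit_code (cs ! c ! t)" using ct assms(2) by simp
    finally show "mem (initial xs) (2 + (3 * c + t)) = lit_code (cs ! c ! t)" .
  qed (use assms in auto)
qed

theorem theorem1p4:
  assumes "Gap_ETH"
  shows "\<forall>\<rho>::real. 0 < \<rho> \<and> \<rho> < 1 \<longrightarrow>
    (\<exists>\<delta>::real. \<delta> > 0 \<and> (\<exists>d\<^sub>0::nat. \<forall>d::nat. d \<ge> d\<^sub>0 \<longrightarrow>
      \<not> (\<exists>A T. knapsack_approximation \<rho> d A \<and> knapsack_time d A T \<and>
            T \<in> O(\<lambda>n. real n powr (\<delta> * sqrt (real d))))))"
proof (intro allI impI)
  fix \<rho> :: real assume "0 < \<rho> \<and> \<rho> < 1"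
  then have \<rho>: "0 < \<rho>" "\<rho> < 1" by simp_all
  obtain D \<delta>' \<epsilon> where gap: "0 < \<delta>'" "0 < \<epsilon>" "\<epsilon> < 1"
    "\<not> (\<exists>A T. distinguishes_gap D \<epsilon> A \<and> sat3_time D A T \<and> T \<in> O(\<lambda>n. 2 powr (\<delta>' * real n)))"
    using assms unfolding Gap_ETH_def by blast
  obtain p where "polyb p" and p: "\<forall>A k \<kappa> q d L \<theta>. \<exists>B DB. \<forall>W \<mu> TA sA.
    (let g = globals k \<kappa> q d L \<mu> in
      2 \<le> W \<and> (\<forall>i. g i \<le> W) \<and> enc_base g \<le> W \<and> (\<forall>a. \<mu> a \<le> 2 ^ W) \<and>
      (\<forall>a. 2 + 3 * \<mu> 1 \<le> a \<longrightarrow> \<mu> a = 0) \<and> exec A (\<lambda>_. 0, enc_mem g \<mu>) TA sA \<longrightarrow>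
      (\<exists>T s. exec B (\<lambda>_. 0, \<mu>) T s \<and> T \<le> DB * (TA + 1) * p W \<and>
        (reg s 0 \<noteq> 0 \<longleftrightarrow> \<theta> \<le> card {i. i < num_items g \<and> mem sA i \<noteq> 0})))"
    using reduction_program by (elim exE conjE) (rule that)
  obtain K where K: "\<And>W. 2 \<le> W \<Longrightarrow> p W \<le> W ^ K" using \<open>polyb p\<close> unfolding polyb_def by blast
  obtain q where q: "1 \<le> q" "2 * (1 - \<rho>) ^ q \<le> \<epsilon>" using ex_power_le[of "1 - \<rho>" \<epsilon>] \<rho> gap(2) by auto
  \<comment> \<open>Since \<open>\<gamma> \<le> 2 * \<delta> * k\<close>, the product
    \<open>\<beta> * (3 * \<gamma>)\<close> is at most 18 q D \<delta>, and 72 = 4 * 18 makes it at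
    most \<delta>'/4. The added 1 avoids division by zero for \<open>D = 0\<close>.\<close>
  define \<delta> where "\<delta> = \<delta>' / (72 * (real q * real D + 1))"
  have den: "0 < real q * real D + 1" by (simp add: add_nonneg_pos)
  then have \<delta>: "0 < \<delta>" unfolding \<delta>_def using gap(1) by simp
  \<comment> \<open>The condition \<open>k \<ge> N\<close> makes the overhead rate 3 q D K / k at
    most \<delta>'/4. It follows from \<open>d \<ge> 4 * (N * N)\<close> because
    \<open>d < 4 * (k * k)\<close>.\<close>
  define N where "N = nat \<lceil>12 * real q * real D * real K / \<delta>'\<rceil> + 1"
  have "\<not> (\<exists>A T. knapsack_approximation \<rho> d A \<and> knapsack_time d A T \<and>
            T \<in> O(\<lambda>n. real n powr (\<delta> * sqrt (real d))))" if d: "4 * (N * N) \<le> d" for d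
  proof
    assume "\<exists>A T. knapsack_approximation \<rho> d A \<and> knapsack_time d A T \<and>
            T \<in> O(\<lambda>n. real n powr (\<delta> * sqrt (real d)))"
    then obtain A T where A: "knapsack_approximation \<rho> d A" "knapsack_time d A T"
      "T \<in> O(\<lambda>n. real n powr (\<delta> * sqrt (real d)))" by blast
    define \<gamma> where "\<gamma> = \<delta> * sqrt (real d)"
    have \<gamma>0: "0 \<le> \<gamma>" using \<delta> by (simp add: \<gamma>_def)
    obtain C1 C2 where C: "0 \<le> C1" "0 \<le> C2" "\<And>x. T x \<le> C1 + C2 * real x powr \<gamma>"
      using bigo_nat_bound[OF A(3)] unfolding \<gamma>_def[symmetric] by auto
    have "1 \<le> d" using d by (simp add: N_def)
    then obtain \<kappa> where \<kappa>: "2 ^ \<kappa> * 2 ^ \<kappa> \<le> d" "d < 4 * (2 ^ \<kappa> * 2 ^ \<kappa>)" using ex_power_of_four by blast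
    define k where "k = (2::nat) ^ \<kappa>"
    have k: "k * k \<le> d" "d < 4 * (k * k)" "0 < k" using \<kappa> by (simp_all add: k_def)
    have "N < k"
    proof (rule ccontr)
      assume "\<not> N < k"
      then have "k * k \<le> N * N" by (intro mult_le_mono) simp_all
      then show False using d k(2) by linarith
    qed
    then have Nk: "12 * real q * real D * real K / \<delta>' \<le> real k" unfolding N_def by linarith
    define \<beta> where "\<beta> = 3 * real q * real D / real k"
    have \<beta>0: "0 \<le> \<beta>" by (simp add: \<beta>_def)
    have \<beta>K: "\<beta> * real K \<le> \<delta>' / 4"
      using Nk k(3) gap(1) unfolding \<beta>_def by (simp add: field_simps)
    have sq: "sqrt (real d) \<le> 2 * real k"
    proof (rule real_le_lsqrt)
      have "real d \<le> real (4 * (k * k))" using k(2) by (intro of_nat_mono) simp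
      then show "real d \<le> (2 * real k)\<^sup>2" by (simp add: power2_eq_square)
    qed simp
    have "\<beta> * (3 * \<gamma>) \<le> \<beta> * (3 * (\<delta> * (2 * real k)))"
      unfolding \<gamma>_def using sq \<delta> \<beta>0 by (intro mult_left_mono) simp_all
    also have "\<dots> = 18 * (real q * real D) * \<delta>" using k(3) by (simp add: \<beta>_def)
    also have "\<dots> \<le> 18 * (real q * real D + 1) * \<delta>" using \<delta> by (intro mult_right_mono) simp_all
    also have "\<dots> = \<delta>' / 4" unfolding \<delta>_def using den by (simp add: field_simps)
    finally have \<beta>\<gamma>: "\<beta> * (3 * \<gamma>) \<le> \<delta>' / 4" .
    obtain B DB where B: "\<forall>W \<mu> TA sA. (let g = globals (2 ^ \<kappa>) \<kappa> q d ((2 ^ \<kappa>) ^ q) \<mu> in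
      2 \<le> W \<and> (\<forall>i. g i \<le> W) \<and> enc_base g \<le> W \<and> (\<forall>a. \<mu> a \<le> 2 ^ W) \<and>
      (\<forall>a. 2 + 3 * \<mu> 1 \<le> a \<longrightarrow> \<mu> a = 0) \<and> exec A (\<lambda>_. 0, enc_mem g \<mu>) TA sA \<longrightarrow>
      (\<exists>T s. exec B (\<lambda>_. 0, \<mu>) T s \<and> T \<le> DB * (TA + 1) * p W \<and>
        (reg s 0 \<noteq> 0 \<longleftrightarrow> nat \<lceil>\<rho> * real (2 ^ \<kappa>)\<rceil> \<le> card {i. i < num_items g \<and> mem sA i \<noteq> 0})))"
      using p[THEN spec[of _ A], THEN spec[of _ "2 ^ \<kappa>"], THEN spec[of _ \<kappa>], THEN spec[of _ q],
        THEN spec[of _ d], THEN spec[of _ "(2 ^ \<kappa>) ^ q"], THEN spec[of _ "nat \<lceil>\<rho> * real (2 ^ \<kappa>)\<rceil>"]]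
      by (elim exE) (rule that)
    define c where "c = k * 2 ^ (3 * (q * k ^ q)) * (d + 1) + (d + \<kappa> + q + k ^ q + k + 6) + 3 * D + 1"
    define J where "J = nat \<lceil>3 * \<gamma>\<rceil>"
    have J: "3 * \<gamma> \<le> real J" unfolding J_def by linarith
    define M where "M = real DB * ((C1 + C2 + 1) * real c ^ (J + K))"
    \<comment> \<open>Algorithm and overhead use \<delta>'/4 each, together half of the exponent;
      the other half absorbs the polynomial factor, whose degree is constant once \<open>d\<close>
      is fixed.\<close>
    define TB where "TB n = M * ((real n + 1) ^ (J + K) * 2 powr (\<delta>' / 2 * real n))" for n
    have TB: "TB \<in> O(\<lambda>n. 2 powr (\<delta>' * real n))"
    proof -
      have "(\<lambda>n. (real n + 1) ^ (J + K) * 2 powr (\<delta>' / 2 * real n)) \<in>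
          O(\<lambda>n. 2 powr (\<delta>' / 2 * real n) * 2 powr (\<delta>' / 2 * real n))"
        by (rule landau_o.big.mult[OF polynomial_bigo_exp]) (use gap(1) in simp_all)
      moreover have "(\<lambda>n. 2 powr (\<delta>' / 2 * real n) * 2 powr (\<delta>' / 2 * real n)) = (\<lambda>n. 2 powr (\<delta>' * real n))"
      proof
        fix n :: nat
        have "2 powr (\<delta>' / 2 * real n) * 2 powr (\<delta>' / 2 * real n) = 2 powr (\<delta>' / 2 * real n + \<delta>' / 2 * real n)"
          by (rule powr_add[symmetric])
        then show "2 powr (\<delta>' / 2 * real n) * 2 powr (\<delta>' / 2 * real n) = 2 powr (\<delta>' * real n)" by simp
      qed
      ultimately have "(\<lambda>n. (real n + 1) ^ (J + K) * 2 powr (\<delta>' / 2 * real n)) \<in> O(\<lambda>n. 2 powr (\<delta>' * real n))"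
        by (simp only:)
      then show ?thesis unfolding TB_def[abs_def] by (cases "M = 0") simp_all
    qed
    have run: "\<exists>t s. exec B (initial xs) t s \<and> real t \<le> TB (card (vars \<phi>)) \<and>
        (SAT \<phi> = card (clauses \<phi>) \<longrightarrow> accepts s) \<and>
        (real (SAT \<phi>) < (1 - \<epsilon>) * real (card (clauses \<phi>)) \<longrightarrow> \<not> accepts s)"
      if \<phi>: "sat3_instance D \<phi>" "encodes_cnf xs \<phi>" for \<phi> xs
    proof -
      obtain n cs where cnf: "vars \<phi> = {..<n}" "clauses \<phi> = set ` set cs" "distinct (map set cs)"
        "xs = n # length cs # concat (map (map lit_code) cs)"
        "\<And>C. C \<in> set cs \<Longrightarrow> length C = 3" "\<And>C l. C \<in> set cs \<Longrightarrow> l \<in> set C \<Longrightarrow> var l < n"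
        "card (clauses \<phi>) = length cs" "length cs \<le> D * n"
        using decoded_cnf[OF \<phi>] by blast
      let ?\<mu> = "mem (initial xs)"
      have red: "reduction n \<kappa> q d cs ?\<mu>"
        by (rule cnf_reduction(1)[OF cnf(4) _ _ q(1) \<kappa>(1)]) (use cnf(5,6) in blast)+
      have mem_le: "\<forall>a. ?\<mu> a \<le> 2 * n + length cs + 1"
        by (rule cnf_reduction(2)[OF cnf(4) _ _ q(1) \<kappa>(1)]) (use cnf(5,6) in blast)+
      have mem_0: "\<forall>a. 2 + 3 * length cs \<le> a \<longrightarrow> ?\<mu> a = 0"
        by (rule cnf_reduction(3)[OF cnf(4) _ _ q(1) \<kappa>(1)]) (use cnf(5,6) in blast)+
      let ?w = "reduction.width n \<kappa> q d cs ?\<mu>"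
      obtain t s x where r: "exec B (\<lambda>_. 0, ?\<mu>) t s" "x \<le> ?w ^ 3"
        "real t \<le> real DB * (T x + 1) * real (p ?w)"
        "(\<exists>\<sigma>. \<forall>c<length cs. \<exists>l\<in>set (cs ! c). lit_true \<sigma> l) \<longrightarrow> accepts s"
        "(\<forall>\<sigma>. real (card {c. c < length cs \<and> (\<exists>l\<in>set (cs ! c). lit_true \<sigma> l)}) < (1 - \<epsilon>) * real (length cs)) \<longrightarrow>
          \<not> accepts s"
        using reduction_decides[OF red mem_le mem_0 B A(1,2) \<rho> q(2)] by (elim exE conjE) (rule that)
      have w2: "2 \<le> ?w" by (rule reduction.width_bounds(1)[OF red])
      have "real ?w \<le> real c * (real n + 1) * 2 powr (\<beta> * real n)"
        using reduction.width_le[OF red cnf(8)] unfolding reduction.k_def[OF red] k_def[symmetric] c_def \<beta>_def .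
      moreover have "1 \<le> real c * (real n + 1)"
      proof -
        have "1 * 1 \<le> real c * (real n + 1)" by (rule mult_mono) (simp_all add: c_def)
        then show ?thesis by simp
      qed
      ultimately have "(T x + 1) * real (p ?w) \<le>
          (C1 + C2 + 1) * ((real c * (real n + 1)) ^ (J + K) * 2 powr (2 * (\<delta>' / 4) * real n))"
        using w2 r(2) K[OF w2] C J \<gamma>0 \<beta>0 \<beta>\<gamma> \<beta>K by (intro time_estimate[where \<beta> = \<beta> and \<gamma> = \<gamma> and w = ?w and x = x]) simp_all
      then have "real DB * ((T x + 1) * real (p ?w)) \<le>
          real DB * ((C1 + C2 + 1) * ((real c * (real n + 1)) ^ (J + K) * 2 powr (2 * (\<delta>' / 4) * real n)))"
        by (rule mult_left_mono) simp
      also have "\<dots> = TB n" unfolding TB_def M_def by (simp add: power_mult_distrib)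
      finally have tn: "real t \<le> TB (card (vars \<phi>))" using r(3) by (simp add: cnf(1) mult.assoc)
      have fin: "finite (clauses \<phi>)" unfolding cnf(2) by simp
      have "accepts s" if sat: "SAT \<phi> = card (clauses \<phi>)"
      proof -
        obtain \<sigma> where "\<forall>c\<in>clauses \<phi>. \<exists>l\<in>c. lit_true \<sigma> l" using SAT_attained[OF fin sat] by blast
        then have "\<forall>c<length cs. \<exists>l\<in>set (cs ! c). lit_true \<sigma> l" unfolding cnf(2) by simp
        then show ?thesis using r(4) by blast
      qed
      moreover have "\<not> accepts s" if unsat: "real (SAT \<phi>) < (1 - \<epsilon>) * real (card (clauses \<phi>))"
      proof -
        have "real (card {c. c < length cs \<and> (\<exists>l\<in>set (cs ! c). lit_true \<sigma> l)}) < (1 - \<epsilon>) * real (length cs)" for \<sigma>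
        proof -
          have "card {c. c < length cs \<and> (\<exists>l\<in>set (cs ! c). lit_true \<sigma> l)} \<le> SAT \<phi>"
            using SAT_ge[OF fin, of \<sigma>] unfolding cnf(2) card_clauses_nth[OF cnf(3)] .
          then show ?thesis using unsat unfolding cnf(7) by linarith
        qed
        then show ?thesis using r(5) by blast
      qed
      moreover have "exec B (initial xs) t s" using r(1) by (simp add: initial_def)
      ultimately show ?thesis using tn by blast
    qed
    have "distinguishes_gap D \<epsilon> B" unfolding distinguishes_gap_def using run by blast
    moreover have "sat3_time D B TB" unfolding sat3_time_def using run by blast
    ultimately show False using gap(4) TB by blast
  qed
  then show "\<exists>\<delta>::real. \<delta> > 0 \<and> (\<exists>d\<^sub>0::nat. \<forall>d::nat. d \<ge> d\<^sub>0 \<longrightarrow>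
      \<not> (\<exists>A T. knapsack_approximation \<rho> d A \<and> knapsack_time d A T \<and>
            T \<in> O(\<lambda>n. real n powr (\<delta> * sqrt (real d)))))"
    using \<delta> by blast
qed

end
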